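(* Let $L>0$, $\gamma>0$, $f\in\dot H^2_{\rm per}$ (time independent), and let $\rho=4R$, where $R$ is a constant with $\sup_{s\in\mathbb R}|u(s)|_{H^2}\le R$ for every trajectory $u(\cdot)$ in the global attractor of $$u_t+uu_x+u_{xxx}+\gamma u=f,\qquad u(t,x)=u(t,x+L).\tag{K}$$ Let $u(s)$ be the solution of (K) and assume that $|P_mu(s)|_{H^2}<\rho$ for all $s\ge s_0$. Let $w(s)$ be the solution of the corresponding continuous data assimilation equation $$w_s+ww_x+w_{xxx}+\gamma w=f-\mu[P_mw-P_mu],$$ with an arbitrary initial datum $w(s_0)\in\dot H^2$, $|w(s_0)|_{H^2}<\rho$, subject to the periodic boundary conditions $\partial_x^jw(s,x)=\partial_x^jw(s,x+L)$, $j=0,1,2$. Assume that $\mu>0$ and $m\in\mathbb N$ are large enough that, with the bounds described in the context, $$\frac{\mu L^2}{2\pi^2(m+1)^2}\tilde{\tilde{\mathcal R}}_1^2\le\mu,\qquad \frac{\mu L^2\tilde{\mathcal R}_2^2}{4\pi^2(m+1)^2}\le\mu^{4/3},\qquad C_3^0\le\mu,$$ $$\frac{C_3^0L^2}{4\pi^2(m+1)^2}\le\frac{\gamma}{2m},\qquad \frac1m\Big((\gamma+2\mu)\mathcal R_\infty+2(\mathcal R')^4\gamma^{-3}\Big)\le\frac\gamma2 .$$ Then $|w(s)-u(s)|\to0$ as $s\to\infty$, at an exponential rate with exponent $\frac\gamma4$.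
   Context: Spaces and norms. $\dot H^k_{\rm per}$ (also $\dot H^k$) is the space of $L$-periodic functions in $H^k[0,L]$ with spatial mean zero; all functions are $L$-periodic in $x$ with mean zero. Integrals are over $[0,L]$, $|u|^2=\int u^2$, $|u|_{H^1}^2=\int u_x^2$, $|u|_{H^2}^2=\int u_{xx}^2$, $|u|_\infty=\sup_{[0,L]}|u|$. $P_m$ is the $L^2$-orthogonal projection onto $\mathrm{span}\{e^{ikx2\pi/L}:0<|k|\le m\}$. The global attractor is the maximal compact invariant set in $\dot H^2_{\rm per}$ under the solution operator of (K); it is known that $R$ exists, depending only on $\gamma$ and $|f|_{H^2}$. Solutions. $u$ and $w$ are global solutions for $s\ge s_0$, belonging to $L^\infty([s_0,\infty),\dot H^2)$, with the equations holding in $L^\infty((s_0,\infty),\dot H^{-1})$. Bounds. The following symbols denote upper bounds valid for all $s\ge s_0$, depending on $\gamma,f,L,\mu,\rho$: $\tilde{\tilde{\mathcal R}}_1$ is a bound for $|w_x(s)|$; $\tilde{\mathcal R}_2$ is a bound for $|w_{xx}(s)|$; $\mathcal R_\infty$ is a bound for $|u(s)|_\infty$ and $|w(s)|_\infty$; $\mathcal R'$ is a bound for $|u_s(s)|_{H^{-1}}$ and $|w_s(s)|_{H^{-1}}$. Further $C_3^0=(\mathcal R_1^0)^{1/2}(\mathcal R_2^0)^{1/2}$, where $\mathcal R_1^0$ and $\mathcal R_2^0$ are bounds, independent of $\mu$, for $|u_x(s)|$ and $|u_{xx}(s)|$ for $s\ge s_0$ (the bounds for the equation with $\mu=0$). "Exponential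 rate with exponent $\gamma/4$" means $|w(s)-u(s)|\le Ke^{-\frac\gamma4(s-s_0)}$ for some constant $K$ and all large $s$. *)

theory Defs
  imports "HOL-Analysis.Analysis"
begin

(* Functions on the circle of length L are represented by L-periodic functions on the whole line.
   Elements of L2 are not quotiented by equality almost everywhere. *)

definition L2_per :: "real \<Rightarrow> (real \<Rightarrow> real) set" where
  "L2_per L = {u. u \<in> borel_measurable lebesgue \<and> (\<forall>x. u (x + L) = u x) \<and>
     integrable (lebesgue_on {0..L}) (\<lambda>x. (u x)\<^sup>2)}"

definition L2_inner :: "real \<Rightarrow> (real \<Rightarrow> real) \<Rightarrow> (real \<Rightarrow> real) \<Rightarrow> real" where
  "L2_inner L u v = (LINT x|lebesgue_on {0..L}. u x * v x)"

definition L2_norm :: "real \<Rightarrow> (real \<Rightarrow> real) \<Rightarrow> real" where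
  "L2_norm L u = sqrt (LINT x|lebesgue_on {0..L}. (u x)\<^sup>2)"

definition sup_norm :: "real \<Rightarrow> (real \<Rightarrow> real) \<Rightarrow> real" where
  "sup_norm L u = (SUP x\<in>{0..L}. \<bar>u x\<bar>)"

definition smooth_per :: "real \<Rightarrow> (real \<Rightarrow> real) set" where
  "smooth_per L = {\<phi>. (\<forall>x. \<phi> (x + L) = \<phi> x) \<and>
     (\<forall>k x. (deriv ^^ k) \<phi> field_differentiable at x)}"

(* Testing against periodic functions makes this the distributional derivative on the circle, so
   that a jump between the endpoints 0 and L is excluded. *)
definition has_weak_deriv :: "real \<Rightarrow> (real \<Rightarrow> real) \<Rightarrow> (real \<Rightarrow> real) \<Rightarrow> bool" where
  "has_weak_deriv L u v \<longleftrightarrow> v \<in> L2_per L \<and>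
     (\<forall>\<phi>\<in>smooth_per L. L2_inner L u (deriv \<phi>) = - L2_inner L v \<phi>)"

(* Determined only up to null sets; it is used exclusively inside integrals over a period. *)
definition weak_deriv :: "real \<Rightarrow> (real \<Rightarrow> real) \<Rightarrow> (real \<Rightarrow> real)" where
  "weak_deriv L u = (SOME v. has_weak_deriv L u v)"

(* For k > 0 the elements are the continuous representatives, hence determined pointwise. *)
definition Hdot :: "real \<Rightarrow> nat \<Rightarrow> (real \<Rightarrow> real) set" where
  "Hdot L k = {u \<in> L2_per L. (LINT x|lebesgue_on {0..L}. u x) = 0 \<and>
     (\<forall>j<k. \<exists>v. has_weak_deriv L ((weak_deriv L ^^ j) u) v) \<and>
     (k > 0 \<longrightarrow> continuous_on UNIV u)}"

definition Hdot_norm :: "real \<Rightarrow> nat \<Rightarrow> (real \<Rightarrow> real) \<Rightarrow> real" where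
  "Hdot_norm L k u = L2_norm L ((weak_deriv L ^^ k) u)"

(* Elements of the dual of Hdot L 1 are functionals whose values outside Hdot L 1 are irrelevant;
   g in L2_per L corresponds to the functional L2_inner L g. *)
definition Hdot_dual :: "real \<Rightarrow> ((real \<Rightarrow> real) \<Rightarrow> real) set" where
  "Hdot_dual L = {F.
     (\<forall>\<phi>\<in>Hdot L 1. \<forall>\<psi>\<in>Hdot L 1. \<forall>a b. F (\<lambda>x. a * \<phi> x + b * \<psi> x) = a * F \<phi> + b * F \<psi>) \<and>
     (\<exists>B. \<forall>\<phi>\<in>Hdot L 1. \<bar>F \<phi>\<bar> \<le> B * Hdot_norm L 1 \<phi>)}"

definition Hdot_dual_norm :: "real \<Rightarrow> ((real \<Rightarrow> real) \<Rightarrow> real) \<Rightarrow> real" where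
  "Hdot_dual_norm L F = (SUP \<phi>\<in>{\<phi> \<in> Hdot L 1. Hdot_norm L 1 \<phi> \<le> 1}. \<bar>F \<phi>\<bar>)"

(* The real-valued elements of the complex span of exp (2 pi i k x / L), 0 < |k| \<le> m. *)
definition fourier_modes :: "real \<Rightarrow> nat \<Rightarrow> (real \<Rightarrow> real) set" where
  "fourier_modes L m = {v. \<exists>c :: int \<Rightarrow> complex. \<forall>x.
     complex_of_real (v x) =
       (\<Sum>k\<in>{k. 0 < \<bar>k\<bar> \<and> \<bar>k\<bar> \<le> int m}. c k * cis (of_int k * x * (2 * pi / L)))}"

definition proj :: "real \<Rightarrow> nat \<Rightarrow> (real \<Rightarrow> real) \<Rightarrow> (real \<Rightarrow> real)" where
  "proj L m u = (THE v. v \<in> fourier_modes L m \<and>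
     (\<forall>g\<in>fourier_modes L m. L2_inner L (\<lambda>x. u x - v x) g = 0))"

(* Scalar measurability of s \<mapsto> u s suffices, since the space is separable (Pettis). *)
definition bounded_in_Hdot2 :: "real \<Rightarrow> real \<Rightarrow> (real \<Rightarrow> real \<Rightarrow> real) \<Rightarrow> bool" where
  "bounded_in_Hdot2 L s0 u \<longleftrightarrow>
     (\<forall>s\<ge>s0. u s \<in> Hdot L 2) \<and> (\<exists>B. \<forall>s\<ge>s0. Hdot_norm L 2 (u s) \<le> B) \<and>
     (\<forall>\<phi>\<in>L2_per L. (\<lambda>s. L2_inner L (u s) \<phi>) \<in> borel_measurable (lebesgue_on {s0..}))"

definition Linf_Hdot_dual :: "real \<Rightarrow> real \<Rightarrow> (real \<Rightarrow> (real \<Rightarrow> real) \<Rightarrow> real) \<Rightarrow> bool" where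
  "Linf_Hdot_dual L s0 F \<longleftrightarrow>
     (\<exists>B. AE s in lebesgue_on {s0..}. F s \<in> Hdot_dual L \<and> Hdot_dual_norm L (F s) \<le> B) \<and>
     (\<forall>\<phi>\<in>Hdot L 1. (\<lambda>s. F s \<phi>) \<in> borel_measurable (lebesgue_on {s0..}))"

definition has_time_deriv ::
  "real \<Rightarrow> real \<Rightarrow> (real \<Rightarrow> real \<Rightarrow> real) \<Rightarrow> (real \<Rightarrow> (real \<Rightarrow> real) \<Rightarrow> real) \<Rightarrow> bool" where
  "has_time_deriv L s0 u u' \<longleftrightarrow> Linf_Hdot_dual L s0 u' \<and>
     (\<forall>\<phi>\<in>Hdot L 1. \<forall>a b. s0 \<le> a \<and> a \<le> b \<longrightarrow>
        L2_inner L (u b) \<phi> - L2_inner L (u a) \<phi> = (LINT s|lebesgue_on {a..b}. u' s \<phi>))"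

(* u_s + u u_x + u_xxx + \<gamma> u = g in the dual of Hdot L 1, for almost every s > s0; the functional
   u_xxx is \<phi> \<mapsto> - \<integral> u_xx \<phi>_x. The argument u' is the time derivative u_s. *)
definition kdv_solution :: "real \<Rightarrow> real \<Rightarrow> real \<Rightarrow> (real \<Rightarrow> real \<Rightarrow> real) \<Rightarrow>
    (real \<Rightarrow> real \<Rightarrow> real) \<Rightarrow> (real \<Rightarrow> (real \<Rightarrow> real) \<Rightarrow> real) \<Rightarrow> bool" where
  "kdv_solution L \<gamma> s0 g u u' \<longleftrightarrow> bounded_in_Hdot2 L s0 u \<and> has_time_deriv L s0 u u' \<and>
     (AE s in lebesgue_on {s0..}. \<forall>\<phi>\<in>Hdot L 1.
        u' s \<phi> + L2_inner L (\<lambda>x. u s x * weak_deriv L (u s) x) \<phi>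
          + (- L2_inner L (weak_deriv L (weak_deriv L (u s))) (weak_deriv L \<phi>))
          + \<gamma> * L2_inner L (u s) \<phi> = L2_inner L (g s) \<phi>)"

definition kdv_solution_op ::
  "real \<Rightarrow> real \<Rightarrow> (real \<Rightarrow> real) \<Rightarrow> real \<Rightarrow> (real \<Rightarrow> real) \<Rightarrow> (real \<Rightarrow> real)" where
  "kdv_solution_op L \<gamma> f t u0 =
     (THE v. \<exists>u u'. kdv_solution L \<gamma> 0 (\<lambda>_. f) u u' \<and> u 0 = u0 \<and> u t = v)"

definition Hdot2_topology :: "real \<Rightarrow> (real \<Rightarrow> real) topology" where
  "Hdot2_topology L =
     Metric_space.mtopology (Hdot L 2) (\<lambda>u v. Hdot_norm L 2 (\<lambda>x. u x - v x))"

definition compact_invariant ::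
  "real \<Rightarrow> real \<Rightarrow> (real \<Rightarrow> real) \<Rightarrow> (real \<Rightarrow> real) set \<Rightarrow> bool" where
  "compact_invariant L \<gamma> f A \<longleftrightarrow>
     compactin (Hdot2_topology L) A \<and> (\<forall>t\<ge>0. kdv_solution_op L \<gamma> f t ` A = A)"

definition is_global_attractor ::
  "real \<Rightarrow> real \<Rightarrow> (real \<Rightarrow> real) \<Rightarrow> (real \<Rightarrow> real) set \<Rightarrow> bool" where
  "is_global_attractor L \<gamma> f A \<longleftrightarrow>
     compact_invariant L \<gamma> f A \<and> (\<forall>B. compact_invariant L \<gamma> f B \<longrightarrow> B \<subseteq> A)"

definition trajectory_in :: "real \<Rightarrow> real \<Rightarrow> (real \<Rightarrow> real) \<Rightarrow> (real \<Rightarrow> real) set \<Rightarrow>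
    (real \<Rightarrow> real \<Rightarrow> real) \<Rightarrow> bool" where
  "trajectory_in L \<gamma> f A v \<longleftrightarrow>
     (\<forall>s. v s \<in> A) \<and> (\<forall>s t. 0 \<le> t \<longrightarrow> v (s + t) = kdv_solution_op L \<gamma> f t (v s))"

end

theory Submission
  imports Defs "HOL-Real_Asymp.Real_Asymp"
begin

text \<open>
Let \<open>v = w - u\<close> be the difference and \<open>a = (u + w) / 2\<close> the mean of the two solutions. Since
\<open>w w_x - u u_x = (a v)_x\<close>, the difference solves \<open>v_s + (a v)_x + v_xxx + \<gamma> v = - \<mu> P_m v\<close>.

Testing with \<open>v\<close> gives damping of \<open>|v|\<^sup>2\<close> at rate \<open>2 \<gamma>\<close>, extra damping \<open>2 \<mu> |P_m v|\<^sup>2\<close> of the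
low modes, and the bad term \<open>- \<integral> u_x v\<^sup>2\<close>. Agmon's inequality bounds \<open>|u_x|\<close> by \<open>C_3\<^sup>0\<close>. On the low modes
the bad term is absorbed by the nudging because \<open>C_3\<^sup>0 \<le> \<mu>\<close>; on the modes above \<open>m\<close> it costs
\<open>C_3\<^sup>0 (L / (2 \<pi> (m + 1)))\<^sup>2 |v_x|\<^sup>2\<close>, which has to be paid by damping of \<open>|v_x|\<^sup>2\<close>. This damping comes
from a second functional, \<open>|v_x|\<^sup>2 - \<integral> a v\<^sup>2\<close>: its time derivative comes from testing with \<open>v_xx + a v\<close>, the flux whose
derivative is the conservative part of the equation, so that this part drops out. What remains, besides damping and terms of order \<open>|v|\<^sup>2\<close>, is \<open>- \<integral> a_s v\<^sup>2\<close>, of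
size \<open>2 R' |v| \<^sup>1\<^sup>/\<^sup>2 |v_x| \<^sup>3\<^sup>/\<^sup>2\<close>, and is split by Young's inequality. The energy
\<open>|v|\<^sup>2 + (|v_x|\<^sup>2 - \<integral> a v\<^sup>2) / m\<close> therefore decays at rate \<open>\<gamma> / 2\<close>; since it dominates \<open>|v|\<^sup>2 / 2\<close>, the
norm \<open>|v|\<close> decays at rate \<open>\<gamma> / 4\<close>.

The solutions only have \<open>u_s\<close> in the dual of \<open>H\<^sup>1\<close> and \<open>u_xx\<close> in \<open>L\<^sup>2\<close>, so testing with \<open>v_xx + a v\<close> makes no
sense directly. The whole argument is carried out for the truncations \<open>v_N\<close>, \<open>a_N\<close> to the modes up to \<open>N\<close>,
with the test function \<open>v_N,xx + P_N (a_N v_N)\<close>. The cancellation is then still exact, and the only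
errors come from truncating the nonlinearity \<open>u u_x\<close> and from replacing \<open>a\<close> by \<open>a_N\<close>; they
are \<open>O(1/N)\<close> uniformly in time (\<open>advection_error_bound\<close>, \<open>nrm_AV\<close>). The truncated energy is a polynomial
in finitely many coefficients, each a Lipschitz function of time with a known almost everywhere
derivative, so its evolution (\<open>energy_poly_primitive\<close>) needs only the product rule for such
functions. The differential inequality is \<open>energy_inequality\<close>, its integration is \<open>gronwall\<close>, and
the limit \<open>N \<rightarrow> \<infinity>\<close> rests on the completeness of the trigonometric system (\<open>trunc_tendsto\<close>).
\<close>

section \<open>Square-integrable functions on a period\<close>

lemma LINT_derivative:
  fixes F f :: "real \<Rightarrow> real"
  assumes "\<And>x. (F has_real_derivative f x) (at x)" and "continuous_on UNIV f" and "a \<le> b"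
  shows "(LINT x|lebesgue_on {a..b}. f x) = F b - F a"
proof -
  have "(f has_integral (F b - F a)) {a..b}"
    using assms(1,3)
    by (intro fundamental_theorem_of_calculus)
       (auto simp: has_real_derivative_iff_has_vector_derivative intro: has_vector_derivative_at_within)
  moreover have "integrable (lebesgue_on {a..b}) f"
    using assms(2) by (intro continuous_imp_integrable_real) (auto intro: continuous_on_subset)
  ultimately show ?thesis
    by (simp add: lebesgue_integral_eq_integral integral_unique)
qed

locale period =
  fixes L :: real
  assumes L_pos: "0 < L"
begin

abbreviation "leb \<equiv> lebesgue_on {0..L}"
abbreviation "ip \<equiv> L2_inner L"
abbreviation "nrm \<equiv> L2_norm L"

text \<open>
Square integrability over one period, without periodicity: products and differences of truncated
functions are only ever paired over \<open>{0..L}\<close>.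
\<close>

definition square_integrable :: "(real \<Rightarrow> real) \<Rightarrow> bool" where
  "square_integrable f \<longleftrightarrow> f \<in> borel_measurable leb \<and> integrable leb (\<lambda>x. (f x)\<^sup>2)"

lemma square_integrable_measurable: "square_integrable f \<Longrightarrow> f \<in> borel_measurable leb"
  by (simp add: square_integrable_def)

lemma square_integrable_L2_per: "f \<in> L2_per L \<Longrightarrow> square_integrable f"
  by (auto simp: square_integrable_def L2_per_def measurable_completion intro: measurable_restrict_space1)

lemma measurable_cont: "continuous_on UNIV f \<Longrightarrow> f \<in> borel_measurable leb" for f :: "real \<Rightarrow> real"
  by (rule continuous_imp_measurable_on_sets_lebesgue) (auto intro: continuous_on_subset)

lemma square_integrable_cont: "continuous_on UNIV f \<Longrightarrow> square_integrable f"
  unfolding square_integrable_def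
  by (intro conjI measurable_cont continuous_imp_integrable_real continuous_on_subset[where s=UNIV and t="{0..L}"] continuous_intros) auto

lemma square_integrable_integrable_mult:
  assumes "square_integrable f" "square_integrable g"
  shows "integrable leb (\<lambda>x. f x * g x)"
proof (rule Bochner_Integration.integrable_bound)
  show "integrable leb (\<lambda>x. (f x)\<^sup>2 + (g x)\<^sup>2)"
    using assms by (auto simp: square_integrable_def)
  show "(\<lambda>x. f x * g x) \<in> borel_measurable leb"
    using assms by (auto simp: square_integrable_def)
  have "\<bar>a * b\<bar> \<le> a\<^sup>2 + b\<^sup>2" for a b :: real
    using sum_squares_bound[of "\<bar>a\<bar>" "\<bar>b\<bar>"] abs_ge_zero[of "a*b"] unfolding abs_mult power2_abs by linarith
  then show "AE x in leb. norm (f x * g x) \<le> norm ((f x)\<^sup>2 + (g x)\<^sup>2)"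
    by (auto intro!: AE_I2)
qed

lemma square_integrable_add:
  assumes "square_integrable f" "square_integrable g" shows "square_integrable (\<lambda>x. f x + g x)"
  unfolding square_integrable_def
proof
  show "(\<lambda>x. f x + g x) \<in> borel_measurable leb" using assms by (auto simp: square_integrable_def)
  have "integrable leb (\<lambda>x. (f x)\<^sup>2 + (g x)\<^sup>2 + 2 * (f x * g x))"
    using assms square_integrable_integrable_mult[OF assms] by (auto simp: square_integrable_def)
  then show "integrable leb (\<lambda>x. (f x + g x)\<^sup>2)" by (simp add: power2_sum mult.assoc)
qed

lemma square_integrable_scale: "square_integrable f \<Longrightarrow> square_integrable (\<lambda>x. a * f x)"
  by (auto simp: square_integrable_def power_mult_distrib)

lemma square_integrable_const: "square_integrable (\<lambda>x. a)"
  by (rule square_integrable_cont) auto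

lemma square_integrable_diff: "square_integrable f \<Longrightarrow> square_integrable g \<Longrightarrow> square_integrable (\<lambda>x. f x - g x)"
  using square_integrable_add[OF _ square_integrable_scale[of g "-1"]] by simp

lemma square_integrable_sum: "(\<And>i. i \<in> I \<Longrightarrow> square_integrable (f i)) \<Longrightarrow> square_integrable (\<lambda>x. \<Sum>i\<in>I. f i x)"
  by (induction I rule: infinite_finite_induct) (auto intro: square_integrable_add square_integrable_const)

lemma square_integrable_integrable: "square_integrable f \<Longrightarrow> integrable leb f"
  using square_integrable_integrable_mult[of f "\<lambda>_. 1"] by (simp add: square_integrable_const)

text \<open>
The estimate behind every nonlinear term below: one factor in the sup norm, the other in \<open>L\<^sup>2\<close>.
\<close>

lemma square_integrable_bounded_mult:
  assumes "square_integrable f" "g \<in> borel_measurable leb" "\<And>x. x \<in> {0..L} \<Longrightarrow> \<bar>g x\<bar> \<le> B"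
  shows "square_integrable (\<lambda>x. g x * f x)" and "nrm (\<lambda>x. g x * f x) \<le> B * nrm f"
proof -
  have B: "B \<ge> 0" using assms(3)[of 0] L_pos by auto
  have le: "(g x * f x)\<^sup>2 \<le> B\<^sup>2 * (f x)\<^sup>2" if "x \<in> {0..L}" for x
    using assms(3)[OF that] by (auto simp: power_mult_distrib abs_le_square_iff[symmetric] intro!: mult_right_mono)
  have int: "integrable leb (\<lambda>x. B\<^sup>2 * (f x)\<^sup>2)" using assms by (auto simp: square_integrable_def)
  show s: "square_integrable (\<lambda>x. g x * f x)"
    unfolding square_integrable_def
    by (rule conjI, use assms in \<open>auto simp: square_integrable_def\<close>, rule Bochner_Integration.integrable_bound[OF int])
       (use assms le B in \<open>auto simp: square_integrable_def intro!: AE_I2\<close>)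
  have "(LINT x|leb. (g x * f x)\<^sup>2) \<le> (LINT x|leb. B\<^sup>2 * (f x)\<^sup>2)"
    by (rule integral_mono[OF _ int]) (use s le in \<open>auto simp: square_integrable_def\<close>)
  also have "\<dots> = B\<^sup>2 * (LINT x|leb. (f x)\<^sup>2)" by simp
  finally show "nrm (\<lambda>x. g x * f x) \<le> B * nrm f"
    using B unfolding L2_norm_def by (metis real_sqrt_le_mono real_sqrt_mult real_sqrt_unique)
qed

lemma ip_commute: "ip f g = ip g f"
  by (simp add: L2_inner_def mult.commute)

lemma ip_add_left: "square_integrable f \<Longrightarrow> square_integrable g \<Longrightarrow> square_integrable h \<Longrightarrow> ip (\<lambda>x. f x + g x) h = ip f h + ip g h"
  unfolding L2_inner_def by (simp add: distrib_right square_integrable_integrable_mult)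

lemma ip_diff_left: "square_integrable f \<Longrightarrow> square_integrable g \<Longrightarrow> square_integrable h \<Longrightarrow> ip (\<lambda>x. f x - g x) h = ip f h - ip g h"
  unfolding L2_inner_def by (simp add: left_diff_distrib square_integrable_integrable_mult)

lemma ip_scale_left: "ip (\<lambda>x. a * f x) h = a * ip f h"
  unfolding L2_inner_def by (simp add: mult.assoc)

lemma ip_add_right: "square_integrable f \<Longrightarrow> square_integrable g \<Longrightarrow> square_integrable h \<Longrightarrow> ip h (\<lambda>x. f x + g x) = ip h f + ip h g"
  using ip_add_left by (simp add: ip_commute)

lemma ip_diff_right: "square_integrable f \<Longrightarrow> square_integrable g \<Longrightarrow> square_integrable h \<Longrightarrow> ip h (\<lambda>x. f x - g x) = ip h f - ip h g"
  using ip_diff_left by (simp add: ip_commute)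

lemma ip_scale_right: "ip h (\<lambda>x. a * f x) = a * ip h f"
  using ip_scale_left by (simp add: ip_commute)

lemma ip_sum_left:
  "(\<And>i. i \<in> I \<Longrightarrow> square_integrable (f i)) \<Longrightarrow> square_integrable h \<Longrightarrow> ip (\<lambda>x. \<Sum>i\<in>I. f i x) h = (\<Sum>i\<in>I. ip (f i) h)"
  by (induction I rule: infinite_finite_induct)
     (auto simp: ip_add_left square_integrable_sum, auto simp: L2_inner_def)

lemma ip_sum_right:
  "(\<And>i. i \<in> I \<Longrightarrow> square_integrable (f i)) \<Longrightarrow> square_integrable h \<Longrightarrow> ip h (\<lambda>x. \<Sum>i\<in>I. f i x) = (\<Sum>i\<in>I. ip h (f i))"
  using ip_sum_left[of I f h] by (simp add: ip_commute)

lemma ip_self_nonneg: "0 \<le> ip f f"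
  by (simp add: L2_inner_def)

lemma nrm_eq: "nrm f = sqrt (ip f f)"
  by (simp add: L2_norm_def L2_inner_def power2_eq_square)

lemma nrm_sq: "(nrm f)\<^sup>2 = ip f f"
  by (simp add: nrm_eq ip_self_nonneg)

lemma nrm_nonneg: "0 \<le> nrm f"
  by (simp add: nrm_eq ip_self_nonneg)

lemma cauchy_schwarz:
  assumes f: "square_integrable f" and g: "square_integrable g"
  shows "\<bar>ip f g\<bar> \<le> nrm f * nrm g"
proof -
  have q: "0 \<le> t\<^sup>2 * ip f f + 2 * t * ip f g + ip g g" for t
  proof -
    have "0 \<le> ip (\<lambda>x. t * f x + g x) (\<lambda>x. t * f x + g x)" by (rule ip_self_nonneg)
    also have "\<dots> = t\<^sup>2 * ip f f + 2 * t * ip f g + ip g g"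
      using f g by (simp add: ip_add_left ip_add_right square_integrable_add square_integrable_scale ip_scale_left ip_scale_right
          power2_eq_square algebra_simps ip_commute[of g f])
    finally show ?thesis .
  qed
  have "(ip f g)\<^sup>2 \<le> ip f f * ip g g"
  proof (cases "ip f f = 0")
    case True
    have "ip f g = 0"
    proof (rule ccontr)
      assume n: "ip f g \<noteq> 0"
      have "0 \<le> 2 * (- (ip g g + 1) / (2 * ip f g)) * ip f g + ip g g" using q[of "- (ip g g + 1) / (2 * ip f g)"] True by simp
      also have "\<dots> = -1" using n by (simp add: field_simps)
      finally show False by simp
    qed
    then show ?thesis using True by simp
  next
    case False
    then have p: "ip f f > 0" using ip_self_nonneg[of f] by simp
    have "0 \<le> (ip f g / ip f f)\<^sup>2 * ip f f - 2 * (ip f g / ip f f) * ip f g + ip g g"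
      using q[of "- (ip f g / ip f f)"] by simp
    also have "\<dots> = ip g g - (ip f g)\<^sup>2 / ip f f" using p by (simp add: field_simps power2_eq_square)
    finally show ?thesis using p by (simp add: field_simps)
  qed
  then have "sqrt ((ip f g)\<^sup>2) \<le> sqrt (ip f f * ip g g)" by (rule real_sqrt_le_mono)
  then show ?thesis by (simp add: nrm_eq real_sqrt_mult)
qed

lemma nrm_scale: "nrm (\<lambda>x. a * f x) = \<bar>a\<bar> * nrm f"
  by (simp add: nrm_eq ip_scale_left ip_scale_right real_sqrt_mult mult.assoc[symmetric] power2_eq_square[symmetric])

lemma nrm_minus: "nrm (\<lambda>x. - f x) = nrm f"
  using nrm_scale[of "-1" f] by simp

lemma nrm_triangle:
  assumes f: "square_integrable f" and g: "square_integrable g"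
  shows "nrm (\<lambda>x. f x + g x) \<le> nrm f + nrm g"
proof (rule power2_le_imp_le)
  have "(nrm (\<lambda>x. f x + g x))\<^sup>2 = (nrm f)\<^sup>2 + 2 * ip f g + (nrm g)\<^sup>2"
    using f g by (simp add: nrm_sq ip_add_left ip_add_right square_integrable_add ip_commute[of g f])
  also have "\<dots> \<le> (nrm f + nrm g)\<^sup>2"
    using cauchy_schwarz[OF f g] by (simp add: power2_sum)
  finally show "(nrm (\<lambda>x. f x + g x))\<^sup>2 \<le> (nrm f + nrm g)\<^sup>2" .
qed (simp add: nrm_nonneg)

lemma nrm_triangle_diff:
  "square_integrable f \<Longrightarrow> square_integrable g \<Longrightarrow> nrm (\<lambda>x. f x - g x) \<le> nrm f + nrm g"
  using nrm_triangle[of f "\<lambda>x. -1 * g x"] nrm_minus[of g] square_integrable_scale[of g "-1"] by simp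

lemma nrm_bounded:
  assumes "f \<in> borel_measurable leb" "\<And>x. x \<in> {0..L} \<Longrightarrow> \<bar>f x\<bar> \<le> B"
  shows "nrm f \<le> B * sqrt L"
proof -
  have "nrm (\<lambda>x. 1) = sqrt L" using L_pos by (simp add: L2_norm_def measure_restrict_space)
  then show ?thesis using square_integrable_bounded_mult(2)[OF square_integrable_const[of 1] assms] by simp
qed

section \<open>The Hartley basis and truncation\<close>

definition wavenum :: "int \<Rightarrow> real" where
  "wavenum k = 2 * pi * real_of_int k / L"

text \<open>
The functions \<open>cos + sin\<close> with frequencies indexed by all integers form one real orthonormal family.
Differentiation sends the function with index \<open>k\<close> to a multiple of the one with index \<open>- k\<close>, so no case
distinction between sines and cosines is ever needed.
\<close>

definition hartley :: "int \<Rightarrow> real \<Rightarrow> real" where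
  "hartley k x = (cos (wavenum k * x) + sin (wavenum k * x)) / sqrt L"

definition modes :: "nat \<Rightarrow> int set" where
  "modes N = {k. 0 < \<bar>k\<bar> \<and> \<bar>k\<bar> \<le> int N}"

lemma finite_modes [simp]: "finite (modes N)"
  by (rule finite_subset[of _ "{- int N..int N}"]) (auto simp: modes_def)

lemma uminus_modes [simp]: "- k \<in> modes N \<longleftrightarrow> k \<in> modes N"
  by (auto simp: modes_def)

lemma zero_notin_modes [simp]: "0 \<notin> modes N" by (simp add: modes_def)

lemma modes_mono: "M \<le> N \<Longrightarrow> modes M \<subseteq> modes N" by (auto simp: modes_def)

lemma sum_modes_uminus: "(\<Sum>k\<in>modes N. F (- k)) = (\<Sum>k\<in>modes N. F k)"
  by (rule sum.reindex_bij_witness[of _ uminus uminus]) auto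

lemma wavenum_minus [simp]: "wavenum (- k) = - wavenum k" by (simp add: wavenum_def)

lemma hartley_deriv: "(hartley k has_real_derivative wavenum k * hartley (- k) x) (at x)"
proof -
  have "((\<lambda>x. cos (wavenum k * x) + sin (wavenum k * x)) has_real_derivative
      wavenum k * (cos (wavenum (- k) * x) + sin (wavenum (- k) * x))) (at x)"
    by (auto intro!: derivative_eq_intros simp: algebra_simps)
  from DERIV_cdivide[OF this, of "sqrt L"] show ?thesis
    by (simp add: hartley_def[abs_def])
qed

lemma hartley_cont: "continuous_on S (hartley k)"
  by (meson DERIV_isCont hartley_deriv continuous_at_imp_continuous_on)

lemma hartley_square_integrable: "square_integrable (hartley k)"
  by (simp add: square_integrable_cont hartley_cont)

lemma cos_wavenum_per: "cos (wavenum k * (x + L)) = cos (wavenum k * x)"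
  and sin_wavenum_per: "sin (wavenum k * (x + L)) = sin (wavenum k * x)"
proof -
  have "wavenum k * (x + L) = wavenum k * x + 2 * pi * real_of_int k"
    using L_pos by (simp add: wavenum_def field_simps)
  then show "cos (wavenum k * (x + L)) = cos (wavenum k * x)" "sin (wavenum k * (x + L)) = sin (wavenum k * x)"
    by (simp_all only: cos_add sin_add cos_int_2pin sin_int_2pin)
qed

lemma hartley_per: "hartley k (x + L) = hartley k x"
  by (simp add: hartley_def cos_wavenum_per sin_wavenum_per)

lemma LINT_sin_wavenum: "(LINT x|leb. sin (wavenum k * x)) = 0"
proof (cases "k = 0")
  case False
  then have w: "wavenum k \<noteq> 0" using L_pos by (simp add: wavenum_def)
  have "(LINT x|leb. sin (wavenum k * x)) = - cos (wavenum k * L) / wavenum k - (- cos (wavenum k * 0) / wavenum k)"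
    by (rule LINT_derivative) (use w L_pos in \<open>auto intro!: derivative_eq_intros continuous_intros\<close>)
  also have "\<dots> = 0" using cos_wavenum_per[of k 0] by simp
  finally show ?thesis .
qed (simp add: wavenum_def)

lemma LINT_cos_wavenum: "(LINT x|leb. cos (wavenum k * x)) = (if k = 0 then L else 0)"
proof (cases "k = 0")
  case True
  then show ?thesis using L_pos by (simp add: wavenum_def measure_restrict_space)
next
  case False
  then have w: "wavenum k \<noteq> 0" using L_pos by (simp add: wavenum_def)
  have "(LINT x|leb. cos (wavenum k * x)) = sin (wavenum k * L) / wavenum k - sin (wavenum k * 0) / wavenum k"
    by (rule LINT_derivative) (use w L_pos in \<open>auto intro!: derivative_eq_intros continuous_intros\<close>)
  also have "\<dots> = 0" using sin_wavenum_per[of k 0] by simp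
  finally show ?thesis using False by simp
qed

lemma hartley_mult:
  "hartley j x * hartley k x = (cos (wavenum (j - k) * x) + sin (wavenum (j + k) * x)) / L"
proof -
  have "wavenum (j - k) * x = wavenum j * x - wavenum k * x" "wavenum (j + k) * x = wavenum j * x + wavenum k * x"
    by (simp_all add: wavenum_def field_simps add_divide_distrib diff_divide_distrib)
  then have "cos (wavenum (j - k) * x) + sin (wavenum (j + k) * x)
      = (cos (wavenum j * x) + sin (wavenum j * x)) * (cos (wavenum k * x) + sin (wavenum k * x))"
    by (simp only: cos_diff sin_add) (simp add: algebra_simps)
  then show ?thesis
    using L_pos by (simp add: hartley_def)
qed

lemma hartley_orthonormal: "ip (hartley j) (hartley k) = (if j = k then 1 else 0)"
proof -
  have "ip (hartley j) (hartley k) = (LINT x|leb. (cos (wavenum (j - k) * x) + sin (wavenum (j + k) * x)) / L)"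
    by (simp add: L2_inner_def hartley_mult)
  also have "\<dots> = ((LINT x|leb. cos (wavenum (j - k) * x)) + (LINT x|leb. sin (wavenum (j + k) * x))) / L"
    by (subst integral_divide_zero, subst Bochner_Integration.integral_add)
       (auto intro!: square_integrable_integrable square_integrable_cont continuous_intros)
  also have "\<dots> = (if j = k then 1 else 0)"
    using L_pos by (simp add: LINT_sin_wavenum LINT_cos_wavenum)
  finally show ?thesis .
qed

definition trig :: "nat \<Rightarrow> (int \<Rightarrow> real) \<Rightarrow> real \<Rightarrow> real" where
  "trig N c x = (\<Sum>k\<in>modes N. c k * hartley k x)"

definition coef :: "(real \<Rightarrow> real) \<Rightarrow> int \<Rightarrow> real" where
  "coef g k = ip g (hartley k)"

text \<open>
Differentiation in terms of coefficients: the derivative of \<open>hartley k\<close> is \<open>wavenum k\<close> times \<open>hartley (- k)\<close>, so the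
coefficient \<open>c (- k)\<close> arrives at index \<open>k\<close> with the factor \<open>wavenum (- k)\<close>.
\<close>

definition dcoef :: "(int \<Rightarrow> real) \<Rightarrow> int \<Rightarrow> real" where
  "dcoef c k = - wavenum k * c (- k)"

abbreviation trunc :: "nat \<Rightarrow> (real \<Rightarrow> real) \<Rightarrow> real \<Rightarrow> real" where
  "trunc N g \<equiv> trig N (coef g)"

lemma trig_cont: "continuous_on S (trig N c)"
  unfolding trig_def[abs_def] by (intro continuous_intros hartley_cont)

lemma trig_square_integrable: "square_integrable (trig N c)" by (simp add: square_integrable_cont trig_cont)

lemma trig_per: "trig N c (x + L) = trig N c x"
  by (simp add: trig_def hartley_per)

lemma trig_deriv: "(trig N c has_real_derivative trig N (dcoef c) x) (at x)"
proof -
  have "(trig N c has_real_derivative (\<Sum>k\<in>modes N. c k * (wavenum k * hartley (- k) x))) (at x)"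
    unfolding trig_def[abs_def] by (intro DERIV_sum DERIV_cmult hartley_deriv)
  also have "(\<Sum>k\<in>modes N. c k * (wavenum k * hartley (- k) x)) = trig N (dcoef c) x"
    unfolding trig_def by (subst sum_modes_uminus[symmetric]) (simp add: dcoef_def mult_ac)
  finally show ?thesis .
qed

lemma trig_add: "trig N c x + trig N d x = trig N (\<lambda>k. c k + d k) x"
  by (simp add: trig_def sum.distrib distrib_right)

lemma trig_diff: "trig N c x - trig N d x = trig N (\<lambda>k. c k - d k) x"
  by (simp add: trig_def sum_subtractf left_diff_distrib)

lemma trig_scale: "a * trig N c x = trig N (\<lambda>k. a * c k) x"
  by (simp add: trig_def sum_distrib_left mult.assoc)

lemma ip_trig: "square_integrable g \<Longrightarrow> ip g (trig N c) = (\<Sum>k\<in>modes N. c k * coef g k)"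
  unfolding trig_def[abs_def] coef_def
  by (subst ip_sum_right) (auto intro: square_integrable_scale hartley_square_integrable simp: ip_scale_right)

lemma coef_trig: "coef (trig N c) k = (if k \<in> modes N then c k else 0)"
proof -
  have "coef (trig N c) k = (\<Sum>j\<in>modes N. c j * ip (hartley j) (hartley k))"
    unfolding trig_def[abs_def] coef_def
    by (subst ip_sum_left) (auto intro: square_integrable_scale hartley_square_integrable simp: ip_scale_left)
  also have "\<dots> = (\<Sum>j\<in>modes N. if j = k then c j else 0)"
    by (rule sum.cong) (auto simp: hartley_orthonormal)
  finally show ?thesis by (simp add: sum.delta')
qed

lemma ip_trig_trig: "ip (trig N c) (trig N d) = (\<Sum>k\<in>modes N. c k * d k)"
  by (simp add: ip_trig trig_square_integrable coef_trig mult.commute cong: sum.cong)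

lemma trig_extend:
  assumes "M \<le> N"
  shows "trig M c = trig N (\<lambda>k. if k \<in> modes M then c k else 0)"
proof
  fix x
  show "trig M c x = trig N (\<lambda>k. if k \<in> modes M then c k else 0) x"
    unfolding trig_def by (rule sum.mono_neutral_cong_left) (use modes_mono[OF assms] in auto)
qed

lemma trig_cong: "(\<And>k. k \<in> modes N \<Longrightarrow> c k = d k) \<Longrightarrow> trig N c = trig N d"
  by (auto simp: trig_def fun_eq_iff)

text \<open>
Truncation is symmetric and fixes trigonometric polynomials of degree at most \<open>N\<close>, hence disappears when
paired with them.
\<close>

lemma ip_trunc: "square_integrable g \<Longrightarrow> ip (trunc N g) (trig N c) = ip g (trig N c)"
  by (simp add: ip_trig trig_square_integrable coef_trig cong: sum.cong)

lemma ip_trunc_self: "square_integrable g \<Longrightarrow> ip (trunc N g) (trunc N g) = (\<Sum>k\<in>modes N. (coef g k)\<^sup>2)"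
  by (simp add: ip_trig_trig power2_eq_square)

lemma trunc_orthogonal: "square_integrable g \<Longrightarrow> ip (\<lambda>x. g x - trunc N g x) (trig N c) = 0"
  by (simp add: ip_diff_left trig_square_integrable ip_trunc)

lemma nrm_sub_trunc:
  assumes "square_integrable g"
  shows "(nrm (\<lambda>x. g x - trunc N g x))\<^sup>2 = ip g g - (\<Sum>k\<in>modes N. (coef g k)\<^sup>2)"
proof -
  have "(nrm (\<lambda>x. g x - trunc N g x))\<^sup>2 = ip (\<lambda>x. g x - trunc N g x) g - ip (\<lambda>x. g x - trunc N g x) (trunc N g)"
    unfolding nrm_sq using assms by (intro ip_diff_right square_integrable_diff trig_square_integrable)
  also have "\<dots> = ip g g - ip g (trunc N g)"
    using assms ip_commute[of "trunc N g" g] by (simp add: ip_trunc ip_diff_left trig_square_integrable)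
  also have "ip g (trunc N g) = (\<Sum>k\<in>modes N. (coef g k)\<^sup>2)"
    using assms by (simp add: ip_trig power2_eq_square)
  finally show ?thesis .
qed

lemma bessel: "square_integrable g \<Longrightarrow> (\<Sum>k\<in>modes N. (coef g k)\<^sup>2) \<le> ip g g"
  using nrm_sub_trunc[of g N] by (metis diff_ge_0_iff_ge zero_le_power2)

lemma nrm_trunc_le: "square_integrable g \<Longrightarrow> nrm (trunc N g) \<le> nrm g"
  using bessel[of g N] by (simp add: nrm_eq ip_trunc_self)

lemma trunc_best:
  assumes g: "square_integrable g"
  shows "nrm (\<lambda>x. g x - trunc N g x) \<le> nrm (\<lambda>x. g x - trig N c x)"
proof (rule power2_le_imp_le)
  let ?r = "\<lambda>x. g x - trunc N g x" and ?t = "trig N (\<lambda>k. coef g k - c k)"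
  have r: "square_integrable ?r" using g by (intro square_integrable_diff trig_square_integrable)
  have e: "(\<lambda>x. g x - trig N c x) = (\<lambda>x. ?r x + ?t x)"
    by (auto simp: trig_diff[symmetric])
  have "ip (\<lambda>x. ?r x + ?t x) (\<lambda>x. ?r x + ?t x) = ip ?r ?r + ip ?t ?t"
    using r trunc_orthogonal[OF g, of N "\<lambda>k. coef g k - c k"]
    by (simp add: ip_add_left ip_add_right square_integrable_add trig_square_integrable ip_commute[of ?t ?r])
  then show "(nrm ?r)\<^sup>2 \<le> (nrm (\<lambda>x. g x - trig N c x))\<^sup>2"
    unfolding e nrm_sq using ip_self_nonneg[of ?t] by simp
qed (rule nrm_nonneg)

section \<open>Completeness of the trigonometric system\<close>

text \<open>
Trigonometric polynomials with a constant term. The phases are left free in order that closure under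
multiplication follows from the addition formulas.
\<close>

inductive_set trig_poly :: "(real \<Rightarrow> real) set" where
  const: "(\<lambda>x. a) \<in> trig_poly"
| basis: "(\<lambda>x. a * cos (wavenum k * x) + b * sin (wavenum k * x)) \<in> trig_poly"
| add: "f \<in> trig_poly \<Longrightarrow> g \<in> trig_poly \<Longrightarrow> (\<lambda>x. f x + g x) \<in> trig_poly"

lemma trig_poly_trig:
  assumes "p \<in> trig_poly"
  shows "\<exists>a N c. \<forall>x. p x = a + trig N c x"
  using assms
proof induction
  case (const a)
  have "a = a + trig 0 (\<lambda>_. 0) x" for x by (simp add: trig_def)
  then show ?case by blast
next
  case (basis a k b)
  show ?case
  proof (cases "k = 0")
    case True
    have "a * cos (wavenum k * x) + b * sin (wavenum k * x) = a + trig 0 (\<lambda>_. 0) x" for x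
      using True by (simp add: trig_def wavenum_def)
    then show ?thesis by blast
  next
    case False
    define c where "c j = (if j = k then (a + b) * sqrt L / 2 else if j = - k then (a - b) * sqrt L / 2 else 0)" for j
    have s: "{k, -k} \<subseteq> modes (nat \<bar>k\<bar>)" using False by (auto simp: modes_def)
    have "trig (nat \<bar>k\<bar>) c x = a * cos (wavenum k * x) + b * sin (wavenum k * x)" for x
    proof -
      have "trig (nat \<bar>k\<bar>) c x = (\<Sum>j\<in>{k, -k}. c j * hartley j x)"
        unfolding trig_def by (rule sum.mono_neutral_right) (use s in \<open>auto simp: c_def\<close>)
      also have "\<dots> = (a + b) / 2 * (sqrt L * hartley k x) + (a - b) / 2 * (sqrt L * hartley (- k) x)"
        using False by (simp add: c_def)
      also have "\<dots> = (a + b) / 2 * (cos (wavenum k * x) + sin (wavenum k * x))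
          + (a - b) / 2 * (cos (wavenum k * x) - sin (wavenum k * x))"
        using L_pos by (simp add: hartley_def)
      also have "\<dots> = a * cos (wavenum k * x) + b * sin (wavenum k * x)"
        by (simp add: field_simps)
      finally show ?thesis .
    qed
    then have "\<forall>x. a * cos (wavenum k * x) + b * sin (wavenum k * x) = 0 + trig (nat \<bar>k\<bar>) c x" by simp
    then show ?thesis by blast
  qed
next
  case (add f g)
  then obtain a N c b M d where f: "\<And>x. f x = a + trig N c x" and g: "\<And>x. g x = b + trig M d x" by metis
  have "f x + g x = (a + b) + trig (max M N) (\<lambda>k. (if k \<in> modes N then c k else 0) + (if k \<in> modes M then d k else 0)) x" for x
    unfolding f g trig_extend[of N "max M N" c, simplified] trig_extend[of M "max M N" d, simplified]
    by (simp add: trig_add)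
  then show ?case by blast
qed

lemma trig_poly_scale: "f \<in> trig_poly \<Longrightarrow> (\<lambda>x. r * f x) \<in> trig_poly"
proof (induction rule: trig_poly.induct)
  case (basis a k b)
  show ?case using trig_poly.basis[of "r * a" k "r * b"] by (simp add: algebra_simps)
qed (auto simp: distrib_left intro: trig_poly.intros)

lemma trig_poly_mult_basis:
  "(\<lambda>x. (a * cos (wavenum k * x) + b * sin (wavenum k * x)) * (c * cos (wavenum l * x) + d * sin (wavenum l * x))) \<in> trig_poly"
proof -
  have w: "wavenum (k + l) * x = wavenum k * x + wavenum l * x" "wavenum (k - l) * x = wavenum k * x - wavenum l * x" for x
    by (simp_all add: wavenum_def field_simps add_divide_distrib diff_divide_distrib)
  have "(a * cos (wavenum k * x) + b * sin (wavenum k * x)) * (c * cos (wavenum l * x) + d * sin (wavenum l * x))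
    = ((a*c - b*d)/2 * cos (wavenum (k + l) * x) + (a*d + b*c)/2 * sin (wavenum (k + l) * x))
    + ((a*c + b*d)/2 * cos (wavenum (k - l) * x) + (b*c - a*d)/2 * sin (wavenum (k - l) * x))" for x
    unfolding w cos_add cos_diff sin_add sin_diff by (simp add: field_simps)
  then show ?thesis by (simp only:) (intro trig_poly.intros)
qed

lemma trig_poly_mult:
  assumes "f \<in> trig_poly" "g \<in> trig_poly"
  shows "(\<lambda>x. f x * g x) \<in> trig_poly"
  using assms(1)
proof induction
  case (const a) then show ?case using trig_poly_scale assms(2) by blast
next
  case (basis a k b)
  show ?case using assms(2)
  proof induction
    case (const c)
    show ?case using trig_poly_scale[OF trig_poly.basis[of a k b], of c] by (simp add: mult.commute)
  next
    case (basis c l d)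
    show ?case by (rule trig_poly_mult_basis)
  next
    case (add f g)
    then show ?case using trig_poly.add[OF add.IH] by (simp add: distrib_left)
  qed
next
  case (add f1 f2)
  then show ?case using trig_poly.add[OF add.IH] by (simp add: distrib_right)
qed

text \<open>
A function with equal values at the ends of the period is a continuous function on the unit circle, where the
Stone-Weierstrass theorem supplies a polynomial in the two coordinates; along the parametrisation by
the angle such a polynomial is trigonometric.
\<close>

lemma trig_dense_continuous:
  assumes cont: "continuous_on {0..L} h" and h: "h 0 = h L" and e: "e > 0"
  obtains a N c where "\<And>x. x \<in> {0..L} \<Longrightarrow> \<bar>h x - (a + trig N c x)\<bar> < e"
proof -
  define p where "p = (\<lambda>t. h (L * t))"
  have "path p"
    unfolding path_def p_def
    by (rule continuous_on_compose2[OF cont]) (use L_pos in \<open>auto intro!: continuous_intros mult_left_le\<close>)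
  moreover have "pathfinish p = pathstart p" using h by (simp add: pathfinish_def pathstart_def p_def)
  ultimately have "homotopic_loops UNIV p p" by (simp add: homotopic_loops_refl)
  from homotopic_loops_imp_homotopic_circlemaps[OF this]
  have ch: "continuous_on (sphere 0 1) (p \<circ> (\<lambda>z. Arg2pi z / (2 * pi)))"
    using homotopic_with_imp_continuous by blast
  obtain g where g: "real_polynomial_function g"
    and ge: "\<And>z. z \<in> sphere 0 1 \<Longrightarrow> \<bar>(p \<circ> (\<lambda>z. Arg2pi z / (2 * pi))) z - g z\<bar> < e"
    using Stone_Weierstrass_real_polynomial_function[OF compact_sphere ch e] by metis
  have "(\<lambda>x. g (cis (wavenum 1 * x))) \<in> trig_poly"
    using g
  proof induction
    case (linear f)
    have "f (cis (wavenum 1 * x)) = f 1 * cos (wavenum 1 * x) + f \<i> * sin (wavenum 1 * x)" for x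
    proof -
      have "cis (wavenum 1 * x) = cos (wavenum 1 * x) *\<^sub>R 1 + sin (wavenum 1 * x) *\<^sub>R \<i>"
        by (simp add: complex_eq_iff)
      then show ?thesis using linear by (simp add: bounded_linear.linear linear_add linear_scale)
    qed
    then show ?case using trig_poly.basis by simp
  qed (auto intro: trig_poly.intros trig_poly_mult)
  then obtain a N c where q: "\<And>x. g (cis (wavenum 1 * x)) = a + trig N c x"
    using trig_poly_trig by blast
  have lt: "\<bar>h x - (a + trig N c x)\<bar> < e" if x: "0 \<le> x" "x < L" for x
  proof -
    have "Arg2pi (cis (wavenum 1 * x)) = wavenum 1 * x"
      by (rule Arg2pi_unique[of 1]) (use x L_pos in \<open>auto simp: wavenum_def field_simps cis_conv_exp\<close>)
    then have "(p \<circ> (\<lambda>z. Arg2pi z / (2 * pi))) (cis (wavenum 1 * x)) = h x"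
      using L_pos by (simp add: p_def wavenum_def)
    then show ?thesis using ge[of "cis (wavenum 1 * x)"] q by simp
  qed
  have "\<bar>h x - (a + trig N c x)\<bar> < e" if "x \<in> {0..L}" for x
  proof (cases "x = L")
    case True
    then show ?thesis using lt[of 0] h L_pos trig_per[of N c 0] by simp
  qed (use that lt in auto)
  then show ?thesis by (rule that)
qed

lemma AE_leb_I:
  assumes "negligible N" "\<And>x. x \<in> {0<..<L} - N \<Longrightarrow> P x"
  shows "AE x in leb. P x"
proof -
  have "negligible (N \<union> {0, L})" by (rule negligible_Un[OF assms(1) negligible_finite]) simp
  then have "AE x in lebesgue. x \<notin> N \<union> {0, L}"
    by (intro AE_not_in) (simp add: negligible_iff_null_sets)
  then have "AE x in leb. x \<notin> N \<union> {0, L}"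
    by (subst AE_restrict_space_iff) auto
  moreover have "AE x in leb. x \<in> {0..L}" by (rule AE_I2) simp
  ultimately show ?thesis by eventually_elim (rule assms(2), auto)
qed

definition cutoff :: "real \<Rightarrow> real \<Rightarrow> real" where
  "cutoff M y = max (- M) (min M y)"

lemma nrm_tendsto_0:
  assumes s: "\<And>n. s n \<in> borel_measurable leb" and w: "integrable leb w"
    and lim: "AE x in leb. (\<lambda>n. s n x) \<longlonglongrightarrow> 0"
    and bd: "\<And>n. AE x in leb. (s n x)\<^sup>2 \<le> w x"
  shows "(\<lambda>n. nrm (s n)) \<longlonglongrightarrow> 0"
proof -
  have "(\<lambda>n. LINT x|leb. (s n x)\<^sup>2) \<longlonglongrightarrow> (LINT x|leb. 0)"
  proof (rule integral_dominated_convergence[where w = w])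
    show "AE x in leb. (\<lambda>n. (s n x)\<^sup>2) \<longlonglongrightarrow> 0"
      using lim by eventually_elim (use tendsto_power[of _ 0 _ 2] in fastforce)
  qed (use s w bd in auto)
  from tendsto_real_sqrt[OF this] show ?thesis
    by (simp add: L2_norm_def)
qed

text \<open>
Three approximations in turn: cutting off the values, replacing the bounded function by
a continuous one that vanishes at both ends of the period, and the uniform approximation of the
latter by trigonometric polynomials.
\<close>

lemma trig_dense_L2:
  assumes g: "g \<in> L2_per L" and e: "e > 0"
  obtains a N c where "nrm (\<lambda>x. g x - (a + trig N c x)) < e"
proof -
  have gs: "square_integrable g" and gm: "g \<in> borel_measurable leb" using g square_integrable_L2_per square_integrable_measurable by blast+
  have cm: "(\<lambda>x. cutoff M (f x)) \<in> borel_measurable leb" if "f \<in> borel_measurable leb" for f M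
    using that unfolding cutoff_def by auto
  have "(\<lambda>n. nrm (\<lambda>x. g x - cutoff (real n) (g x))) \<longlonglongrightarrow> 0"
  proof (rule nrm_tendsto_0[where w = "\<lambda>x. (g x)\<^sup>2"])
    show "AE x in leb. (\<lambda>n. g x - cutoff (real n) (g x)) \<longlonglongrightarrow> 0"
    proof (rule AE_I2, rule tendsto_eventually)
      fix x
      obtain n0 :: nat where "\<bar>g x\<bar> \<le> n0" using real_arch_simple by blast
      then show "\<forall>\<^sub>F n in sequentially. g x - cutoff (real n) (g x) = 0"
        by (intro eventually_sequentiallyI[of n0]) (auto simp: cutoff_def)
    qed
    show "AE x in leb. (g x - cutoff (real n) (g x))\<^sup>2 \<le> (g x)\<^sup>2" for n
      by (rule AE_I2) (auto simp: abs_le_square_iff[symmetric] cutoff_def)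
  qed (use gm gs cm in \<open>auto simp: square_integrable_def\<close>)
  then have "\<forall>\<^sub>F n in sequentially. nrm (\<lambda>x. g x - cutoff (real n) (g x)) < e / 3"
    by (rule order_tendstoD(2)) (use e in simp)
  then obtain n where n: "nrm (\<lambda>x. g x - cutoff (real n) (g x)) < e / 3"
    unfolding eventually_sequentially by blast
  obtain Z h where Z: "negligible Z" and hc: "\<And>n. continuous_on UNIV (h n)"
    and hl: "\<And>x. x \<notin> Z \<Longrightarrow> (\<lambda>n. h n x) \<longlonglongrightarrow> (if x \<in> {0..L} then g x else 0)"
    using lebesgue_measurable_imp_measurable_on[of g "{0..L}"] g
    unfolding measurable_on_def L2_per_def by auto
  \<comment> \<open>The first factor vanishes at both ends of the period and tends to \<open>1\<close> in between.\<close>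
  define q where "q = (\<lambda>j x. min 1 (real j * (x * (L - x))) * cutoff (real n) (h j x))"
  have qc: "continuous_on UNIV (q j)" for j
    unfolding q_def cutoff_def by (intro continuous_intros hc)
  have "(\<lambda>j. nrm (\<lambda>x. cutoff (real n) (g x) - q j x)) \<longlonglongrightarrow> 0"
  proof (rule nrm_tendsto_0[where w = "\<lambda>x. (2 * real n)\<^sup>2"])
    show "(\<lambda>x. cutoff (real n) (g x) - q j x) \<in> borel_measurable leb" for j
      using cm[OF gm] measurable_cont[OF qc] by auto
    show "integrable leb (\<lambda>x. (2 * real n)\<^sup>2)" by (rule square_integrable_integrable[OF square_integrable_const])
    show "AE x in leb. (\<lambda>j. cutoff (real n) (g x) - q j x) \<longlonglongrightarrow> 0"
    proof (rule AE_leb_I[OF Z])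
      fix x assume x: "x \<in> {0<..<L} - Z"
      then have p: "x * (L - x) > 0" by auto
      obtain j0 :: nat where "1 / (x * (L - x)) \<le> j0" using real_arch_simple by blast
      then have j0: "1 \<le> real j0 * (x * (L - x))" using p by (simp add: pos_divide_le_eq)
      have "\<forall>\<^sub>F j in sequentially. min 1 (real j * (x * (L - x))) = 1"
      proof (rule eventually_sequentiallyI[of j0])
        fix j assume "j0 \<le> j"
        then have "real j0 * (x * (L - x)) \<le> real j * (x * (L - x))" using p by (intro mult_right_mono) auto
        then show "min 1 (real j * (x * (L - x))) = 1" using j0 by linarith
      qed
      then have "(\<lambda>j. min 1 (real j * (x * (L - x)))) \<longlonglongrightarrow> 1" by (rule tendsto_eventually)
      moreover have "(\<lambda>j. cutoff (real n) (h j x)) \<longlonglongrightarrow> cutoff (real n) (g x)"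
        using hl[of x] x unfolding cutoff_def by (intro tendsto_intros) auto
      ultimately have "(\<lambda>j. q j x) \<longlonglongrightarrow> 1 * cutoff (real n) (g x)"
        unfolding q_def by (rule tendsto_mult)
      from tendsto_diff[OF tendsto_const[of "cutoff (real n) (g x)"] this]
      show "(\<lambda>j. cutoff (real n) (g x) - q j x) \<longlonglongrightarrow> 0" by simp
    qed
    show "AE x in leb. (cutoff (real n) (g x) - q j x)\<^sup>2 \<le> (2 * real n)\<^sup>2" for j
    proof (rule AE_leb_I[of "{}"])
      fix x assume "x \<in> {0<..<L} - {}"
      then have "0 \<le> min 1 (real j * (x * (L - x)))" "min 1 (real j * (x * (L - x))) \<le> 1" by auto
      moreover have "\<bar>cutoff (real n) y\<bar> \<le> real n" for y by (auto simp: cutoff_def)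
      ultimately have "\<bar>q j x\<bar> \<le> 1 * real n" unfolding q_def abs_mult by (intro mult_mono) auto
      then have "\<bar>cutoff (real n) (g x) - q j x\<bar> \<le> \<bar>2 * real n\<bar>"
        using \<open>\<And>y. \<bar>cutoff (real n) y\<bar> \<le> real n\<close>[of "g x"] by linarith
      then show "(cutoff (real n) (g x) - q j x)\<^sup>2 \<le> (2 * real n)\<^sup>2" by (simp only: abs_le_square_iff)
    qed simp
  qed
  then have "\<forall>\<^sub>F j in sequentially. nrm (\<lambda>x. cutoff (real n) (g x) - q j x) < e / 3"
    by (rule order_tendstoD(2)) (use e in simp)
  then obtain j where j: "nrm (\<lambda>x. cutoff (real n) (g x) - q j x) < e / 3"
    unfolding eventually_sequentially by blast
  obtain a N c where q: "\<And>x. x \<in> {0..L} \<Longrightarrow> \<bar>q j x - (a + trig N c x)\<bar> < e / (3 * sqrt L)"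
    by (rule trig_dense_continuous[of "q j" "e / (3 * sqrt L)"])
       (use e L_pos qc[of j] continuous_on_subset[OF qc[of j], of "{0..L}"] in \<open>auto simp: q_def\<close>)
  have tc: "continuous_on UNIV (\<lambda>x. a + trig N c x)" by (intro continuous_intros trig_cont)
  have "nrm (\<lambda>x. q j x - (a + trig N c x)) \<le> e / (3 * sqrt L) * sqrt L"
    by (rule nrm_bounded) (use q less_imp_le in \<open>auto intro!: measurable_cont continuous_intros qc trig_cont\<close>)
  also have "\<dots> = e / 3" using L_pos by simp
  finally have 3: "nrm (\<lambda>x. q j x - (a + trig N c x)) \<le> e / 3" .
  have s2: "square_integrable (\<lambda>x. cutoff (real n) (g x))"
    using square_integrable_bounded_mult(1)[OF square_integrable_const[of 1] cm[OF gm, of "real n"], of "real n"] by (auto simp: cutoff_def)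
  have s1: "square_integrable (\<lambda>x. g x - cutoff (real n) (g x))" by (intro square_integrable_diff gs s2)
  have s3: "square_integrable (\<lambda>x. cutoff (real n) (g x) - q j x)" by (intro square_integrable_diff s2 square_integrable_cont qc)
  have s4: "square_integrable (\<lambda>x. q j x - (a + trig N c x))" by (intro square_integrable_diff square_integrable_cont qc tc)
  have "nrm (\<lambda>x. g x - (a + trig N c x)) = nrm (\<lambda>x. ((g x - cutoff (real n) (g x)) + (cutoff (real n) (g x) - q j x)) + (q j x - (a + trig N c x)))"
    by (rule arg_cong[where f = nrm]) auto
  also have "\<dots> \<le> nrm (\<lambda>x. (g x - cutoff (real n) (g x)) + (cutoff (real n) (g x) - q j x)) + nrm (\<lambda>x. q j x - (a + trig N c x))"
    by (intro nrm_triangle square_integrable_add s1 s3 s4)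
  also have "\<dots> < e"
    using nrm_triangle[OF s1 s3] n j 3 by linarith
  finally show ?thesis by (rule that)
qed

definition mean_zero :: "(real \<Rightarrow> real) \<Rightarrow> bool" where
  "mean_zero g \<longleftrightarrow> (LINT x|leb. g x) = 0"

lemma mean_zero_hartley: "k \<noteq> 0 \<Longrightarrow> mean_zero (hartley k)"
  using hartley_orthonormal[of k 0] L_pos
  by (simp add: mean_zero_def L2_inner_def hartley_def[of 0] wavenum_def)

lemma mean_zero_trig: "mean_zero (trig N c)"
proof -
  have "(LINT x|leb. trig N c x) = (\<Sum>k\<in>modes N. c k * (LINT x|leb. hartley k x))"
    unfolding trig_def by (subst Bochner_Integration.integral_sum) (auto intro: square_integrable_integrable hartley_square_integrable)
  also have "\<dots> = 0" using mean_zero_hartley by (intro sum.neutral) (auto simp: mean_zero_def modes_def)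
  finally show ?thesis by (simp add: mean_zero_def)
qed

text \<open>
The truncation is the best approximation in \<open>L\<^sup>2\<close>, so density of trigonometric polynomials gives
convergence. The constant term of an approximant is harmless: it is orthogonal to a function of mean
zero, and removing it can only improve the approximation.
\<close>

lemma trunc_tendsto:
  assumes g: "g \<in> L2_per L" and mz: "mean_zero g"
  shows "(\<lambda>N. nrm (\<lambda>x. g x - trunc N g x)) \<longlonglongrightarrow> 0"
proof (rule LIMSEQ_I)
  fix e :: real assume e: "e > 0"
  have gs: "square_integrable g" using g square_integrable_L2_per by blast
  obtain a N c where n: "nrm (\<lambda>x. g x - (a + trig N c x)) < e"
    using trig_dense_L2[OF g e] by metis
  let ?r = "\<lambda>x. g x - trig N c x"
  have rs: "square_integrable ?r" by (intro square_integrable_diff gs trig_square_integrable)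
  have "ip ?r (\<lambda>x. a) = 0"
    using mz mean_zero_trig[of N c] gs
    by (simp add: ip_diff_left trig_square_integrable square_integrable_const) (simp add: L2_inner_def mean_zero_def)
  then have "ip (\<lambda>x. ?r x - a) (\<lambda>x. ?r x - a) = ip ?r ?r + ip (\<lambda>x. a) (\<lambda>x. a)"
    using ip_commute[of ?r "\<lambda>x. a"] by (simp add: ip_diff_left[OF rs] ip_diff_right[OF rs] square_integrable_diff rs square_integrable_const)
  moreover have "(\<lambda>x. ?r x - a) = (\<lambda>x. g x - (a + trig N c x))" by auto
  ultimately have "ip ?r ?r \<le> ip (\<lambda>x. g x - (a + trig N c x)) (\<lambda>x. g x - (a + trig N c x))"
    using ip_self_nonneg by simp
  then have r: "nrm ?r < e" using n by (smt (verit) nrm_eq real_sqrt_le_mono)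
  have "norm (nrm (\<lambda>x. g x - trunc M g x) - 0) < e" if "M \<ge> N" for M
    using trunc_best[OF gs, of M "\<lambda>k. if k \<in> modes N then c k else 0"] r nrm_nonneg[of "\<lambda>x. g x - trunc M g x"]
    unfolding trig_extend[OF that, symmetric] by simp
  then show "\<exists>no. \<forall>n\<ge>no. norm (nrm (\<lambda>x. g x - trunc n g x) - 0) < e" by blast
qed

lemma parseval:
  assumes g: "g \<in> L2_per L" and mz: "mean_zero g"
  shows "(\<lambda>N. \<Sum>k\<in>modes N. (coef g k)\<^sup>2) \<longlonglongrightarrow> ip g g"
proof -
  have "(\<lambda>N. ip g g - (nrm (\<lambda>x. g x - trunc N g x))\<^sup>2) \<longlonglongrightarrow> ip g g - 0\<^sup>2"
    by (intro tendsto_intros trunc_tendsto assms)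
  then show ?thesis using g by (simp add: nrm_sub_trunc square_integrable_L2_per)
qed

lemma nrm_trunc_tendsto:
  assumes g: "g \<in> L2_per L" and mz: "mean_zero g"
  shows "(\<lambda>N. nrm (trunc N g)) \<longlonglongrightarrow> nrm g"
  using tendsto_real_sqrt[OF parseval[OF assms]] g by (simp add: nrm_eq ip_trunc_self square_integrable_L2_per)

section \<open>Weak derivatives\<close>

lemma LINT_periodic_derivative:
  assumes "\<And>x. (F has_real_derivative f x) (at x)" "continuous_on UNIV f" "F L = F 0"
  shows "(LINT x|leb. f x) = 0"
  using LINT_derivative[OF assms(1,2), of 0 L] L_pos assms(3) by simp

lemma deriv_hartley_combination:
  "deriv (\<lambda>x. a * hartley k x + b * hartley (- k) x) = (\<lambda>x. (- wavenum k * b) * hartley k x + (wavenum k * a) * hartley (- k) x)"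
proof
  fix x
  show "deriv (\<lambda>x. a * hartley k x + b * hartley (- k) x) x = (- wavenum k * b) * hartley k x + (wavenum k * a) * hartley (- k) x"
    by (rule DERIV_imp_deriv) (auto intro!: derivative_eq_intros hartley_deriv)
qed

lemma hartley_smooth: "hartley k \<in> smooth_per L"
proof -
  have "\<exists>a b. (deriv ^^ j) (hartley k) = (\<lambda>x. a * hartley k x + b * hartley (- k) x)" for j
  proof (induction j)
    case 0
    show ?case by (intro exI[of _ 1] exI[of _ 0]) simp
  next
    case (Suc j)
    then obtain a b where "(deriv ^^ j) (hartley k) = (\<lambda>x. a * hartley k x + b * hartley (- k) x)" by blast
    then have "(deriv ^^ Suc j) (hartley k) = (\<lambda>x. (- wavenum k * b) * hartley k x + (wavenum k * a) * hartley (- k) x)"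
      by (simp only: funpow.simps comp_apply deriv_hartley_combination)
    then show ?case by blast
  qed
  moreover have "(\<lambda>x. a * hartley k x + b * hartley (- k) x) field_differentiable at x" for a b x
    by (intro field_differentiable_add field_differentiable_mult field_differentiable_const)
       (use hartley_deriv field_differentiable_def in blast)+
  ultimately have "(deriv ^^ j) (hartley k) field_differentiable at x" for j x
    by metis
  then show ?thesis by (simp add: smooth_per_def hartley_per)
qed

lemma const_smooth: "(\<lambda>x. a) \<in> smooth_per L"
proof -
  have "\<exists>b. (deriv ^^ j) (\<lambda>x. a) = (\<lambda>x. b :: real)" for j by (induction j) auto
  then have "(deriv ^^ j) (\<lambda>x. a) field_differentiable at x" for j x
    by (metis field_differentiable_const)
  then show ?thesis by (simp add: smooth_per_def)
qed

text \<open>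
The constant function is a periodic test function, which is where periodicity across the end points
enters.
\<close>

lemma has_weak_deriv_mean_zero:
  assumes "has_weak_deriv L u v"
  shows "mean_zero v"
proof -
  have "ip u (deriv (\<lambda>x. 1)) = - ip v (\<lambda>x. 1)"
    using assms const_smooth[of 1] unfolding has_weak_deriv_def by blast
  then show ?thesis by (simp add: mean_zero_def L2_inner_def)
qed

lemma coef_weak_deriv:
  assumes "has_weak_deriv L u v"
  shows "coef v = dcoef (coef u)"
proof
  fix k
  have "deriv (hartley k) = (\<lambda>x. wavenum k * hartley (- k) x)"
    using DERIV_imp_deriv[OF hartley_deriv] by blast
  moreover have "ip u (deriv (hartley k)) = - ip v (hartley k)"
    using assms hartley_smooth unfolding has_weak_deriv_def by blast
  ultimately show "coef v k = dcoef (coef u) k"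
    by (simp add: coef_def dcoef_def ip_scale_right)
qed

lemma L2_per_diff: "f \<in> L2_per L \<Longrightarrow> g \<in> L2_per L \<Longrightarrow> (\<lambda>x. f x - g x) \<in> L2_per L"
  using square_integrable_diff[of f g] square_integrable_L2_per[of f] square_integrable_L2_per[of g] by (auto simp: L2_per_def square_integrable_def)

text \<open>
Both weak derivatives have the coefficients that integration by parts against the basis dictates, and by
Parseval's identity a function of mean zero is determined by its coefficients.
\<close>

lemma weak_deriv_unique:
  assumes v: "has_weak_deriv L u v" and v': "has_weak_deriv L u v'"
  shows "nrm (\<lambda>x. v x - v' x) = 0"
proof -
  let ?g = "\<lambda>x. v x - v' x"
  have vs: "v \<in> L2_per L" "v' \<in> L2_per L" using assms by (auto simp: has_weak_deriv_def)
  have sv: "square_integrable v" "square_integrable v'" using vs square_integrable_L2_per by blast+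
  have "mean_zero ?g" using has_weak_deriv_mean_zero[OF v] has_weak_deriv_mean_zero[OF v'] sv
    by (simp add: mean_zero_def square_integrable_integrable)
  from parseval[OF L2_per_diff[OF vs] this]
  have "(\<lambda>N. \<Sum>k\<in>modes N. (coef ?g k)\<^sup>2) \<longlonglongrightarrow> ip ?g ?g" .
  moreover have "coef ?g k = coef v k - coef v' k" for k
    unfolding coef_def using sv by (simp add: ip_diff_left hartley_square_integrable)
  ultimately show ?thesis
    by (simp add: coef_weak_deriv[OF v] coef_weak_deriv[OF v'] nrm_eq LIMSEQ_const_iff)
qed

text \<open>
The Poincare inequality on the modes above \<open>N\<close>: each such coefficient of \<open>u\<close> is at most
\<open>L / (2 \<pi> (N + 1))\<close> times a coefficient of its derivative.
\<close>

lemma trunc_tail: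
  assumes u: "u \<in> L2_per L" "mean_zero u" and wd: "has_weak_deriv L u v"
  shows "nrm (\<lambda>x. u x - trunc N u x) \<le> L / (2 * pi * (real N + 1)) * nrm v"
proof (rule power2_le_imp_le)
  let ?d = "L / (2 * pi * (real N + 1))"
  have vs: "square_integrable v" using wd square_integrable_L2_per unfolding has_weak_deriv_def by blast
  have us: "square_integrable u" using u square_integrable_L2_per by blast
  have each: "(coef u k)\<^sup>2 \<le> ?d\<^sup>2 * (coef v (- k))\<^sup>2" if "k \<notin> modes N" "k \<in> modes M" for k M
  proof -
    have "real N + 1 \<le> \<bar>real_of_int k\<bar>" using that by (auto simp: modes_def)
    then have "1 \<le> \<bar>?d * wavenum k\<bar>"
      using L_pos by (simp add: wavenum_def abs_mult divide_simps)
    then have "1 * \<bar>coef u k\<bar> \<le> \<bar>?d * wavenum k\<bar> * \<bar>coef u k\<bar>" by (intro mult_right_mono) auto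
    then have "\<bar>coef u k\<bar> \<le> \<bar>?d * coef v (- k)\<bar>"
      by (simp add: coef_weak_deriv[OF wd] dcoef_def abs_mult)
    then show ?thesis by (simp only: abs_le_square_iff power_mult_distrib)
  qed
  have "(\<Sum>k\<in>modes M. (coef u k)\<^sup>2) - (\<Sum>k\<in>modes N. (coef u k)\<^sup>2) \<le> ?d\<^sup>2 * ip v v" if "N \<le> M" for M
  proof -
    have "(\<Sum>k\<in>modes M. (coef u k)\<^sup>2) - (\<Sum>k\<in>modes N. (coef u k)\<^sup>2) = (\<Sum>k\<in>modes M - modes N. (coef u k)\<^sup>2)"
      using modes_mono[OF that] by (simp add: sum_diff)
    also have "\<dots> \<le> (\<Sum>k\<in>modes M - modes N. ?d\<^sup>2 * (coef v (- k))\<^sup>2)"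
      by (rule sum_mono) (use each in auto)
    also have "\<dots> \<le> (\<Sum>k\<in>modes M. ?d\<^sup>2 * (coef v (- k))\<^sup>2)"
      by (rule sum_mono2) auto
    also have "\<dots> = ?d\<^sup>2 * (\<Sum>k\<in>modes M. (coef v k)\<^sup>2)"
      by (subst sum_modes_uminus[of "\<lambda>k. ?d\<^sup>2 * (coef v k)\<^sup>2"]) (simp add: sum_distrib_left)
    also have "\<dots> \<le> ?d\<^sup>2 * ip v v" by (intro mult_left_mono bessel vs) auto
    finally show ?thesis .
  qed
  then have "\<forall>\<^sub>F M in sequentially. (\<Sum>k\<in>modes M. (coef u k)\<^sup>2) - (\<Sum>k\<in>modes N. (coef u k)\<^sup>2) \<le> ?d\<^sup>2 * ip v v"
    by (rule eventually_sequentiallyI)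
  moreover have "(\<lambda>M. (\<Sum>k\<in>modes M. (coef u k)\<^sup>2) - (\<Sum>k\<in>modes N. (coef u k)\<^sup>2)) \<longlonglongrightarrow> ip u u - (\<Sum>k\<in>modes N. (coef u k)\<^sup>2)"
    by (intro tendsto_intros parseval u)
  ultimately have "ip u u - (\<Sum>k\<in>modes N. (coef u k)\<^sup>2) \<le> ?d\<^sup>2 * ip v v"
    by (intro tendsto_upperbound) auto
  then show "(nrm (\<lambda>x. u x - trunc N u x))\<^sup>2 \<le> (?d * nrm v)\<^sup>2"
    by (simp only: nrm_sub_trunc[OF us] power_mult_distrib nrm_sq)
qed (use L_pos nrm_nonneg in \<open>auto intro!: mult_nonneg_nonneg divide_nonneg_nonneg\<close>)

lemma trig_L2_per: "trig N c \<in> L2_per L"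
  using trig_square_integrable[of N c] unfolding L2_per_def square_integrable_def
  by (auto simp: trig_per trig_cont intro!: measurable_completion borel_measurable_continuous_onI)

lemma periodic_by_parts:
  assumes F: "\<And>x. (F has_real_derivative F' x) (at x)" and G: "\<And>x. (G has_real_derivative G' x) (at x)"
    and c: "continuous_on UNIV F'" "continuous_on UNIV G'" and per: "F L * G L = F 0 * G 0"
  shows "ip F G' = - ip F' G"
proof -
  have cF: "continuous_on UNIV F" and cG: "continuous_on UNIV G"
    using F G by (meson DERIV_isCont continuous_at_imp_continuous_on)+
  have "(LINT x|leb. F' x * G x + F x * G' x) = 0"
    by (rule LINT_periodic_derivative[of "\<lambda>x. F x * G x"])
       (use per in \<open>auto intro!: derivative_eq_intros F G continuous_intros c cF cG\<close>)
  moreover have "(LINT x|leb. F' x * G x + F x * G' x) = ip F' G + ip F G'"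
    unfolding L2_inner_def
    by (intro Bochner_Integration.integral_add square_integrable_integrable_mult square_integrable_cont c cF cG)
  ultimately show ?thesis by simp
qed

lemma trig_has_weak_deriv: "has_weak_deriv L (trig N c) (trig N (dcoef c))"
  unfolding has_weak_deriv_def
proof (intro conjI ballI trig_L2_per)
  fix \<phi> assume p: "\<phi> \<in> smooth_per L"
  then have d: "(deriv ^^ k) \<phi> field_differentiable at x" for k x by (auto simp: smooth_per_def)
  have "(\<phi> has_real_derivative deriv \<phi> x) (at x)" for x
    using d[of 0 x] by (simp add: DERIV_deriv_iff_field_differentiable)
  moreover have "continuous_on UNIV (deriv \<phi>)"
    using d[of 1] by (auto intro!: continuous_at_imp_continuous_on field_differentiable_imp_continuous_at)
  moreover have "\<phi> L = \<phi> 0" "trig N c L = trig N c 0"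
    using p trig_per[of N c 0] by (auto simp: smooth_per_def dest: spec[of _ 0])
  ultimately show "ip (trig N c) (deriv \<phi>) = - ip (trig N (dcoef c)) \<phi>"
    by (intro periodic_by_parts trig_deriv trig_cont) auto
qed

lemma trig_Hdot_1: "trig N c \<in> Hdot L 1"
  using trig_has_weak_deriv[of N c] mean_zero_trig[of N c]
  by (auto simp: Hdot_def trig_L2_per trig_cont mean_zero_def)

lemma has_weak_deriv_weak_deriv:
  "has_weak_deriv L u v \<Longrightarrow> has_weak_deriv L u (weak_deriv L u)"
  unfolding weak_deriv_def by (rule someI[of "has_weak_deriv L u"])

lemma weak_deriv_trig: "has_weak_deriv L (trig N c) (weak_deriv L (trig N c))"
  using has_weak_deriv_weak_deriv trig_has_weak_deriv by blast

lemma ip_zero_nrm: "square_integrable f \<Longrightarrow> square_integrable g \<Longrightarrow> square_integrable h \<Longrightarrow> nrm (\<lambda>x. f x - g x) = 0 \<Longrightarrow> ip h f = ip h g"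
  using cauchy_schwarz[of h "\<lambda>x. f x - g x"] by (simp add: square_integrable_diff ip_diff_right)

text \<open>
The weak derivative is an arbitrary representative of its class; pairings do not depend on the choice.
\<close>

lemma ip_weak_deriv_trig:
  assumes "square_integrable h"
  shows "ip h (weak_deriv L (trig N c)) = ip h (trig N (dcoef c))"
  by (rule ip_zero_nrm)
     (use assms weak_deriv_unique[OF weak_deriv_trig trig_has_weak_deriv] weak_deriv_trig in
       \<open>auto simp: has_weak_deriv_def intro: square_integrable_L2_per trig_square_integrable\<close>)

lemma Hdot_norm_1_trig: "Hdot_norm L 1 (trig N c) = nrm (trig N (dcoef c))"
proof -
  let ?v = "weak_deriv L (trig N c)" and ?d = "trig N (dcoef c)"
  have s: "square_integrable ?v" using weak_deriv_trig by (auto simp: has_weak_deriv_def intro: square_integrable_L2_per)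
  have "ip ?v ?v = ip ?d ?d"
    using ip_weak_deriv_trig[OF s, of N c] ip_weak_deriv_trig[OF trig_square_integrable[of N "dcoef c"], of N c] ip_commute[of ?d ?v] by simp
  then show ?thesis by (simp add: Hdot_norm_def nrm_eq)
qed

lemma Hdot_2D:
  assumes "u \<in> Hdot L 2"
  shows "u \<in> L2_per L" "mean_zero u" "continuous_on UNIV u"
    "has_weak_deriv L u (weak_deriv L u)"
    "has_weak_deriv L (weak_deriv L u) (weak_deriv L (weak_deriv L u))"
proof -
  have "\<forall>j<2. \<exists>v. has_weak_deriv L ((weak_deriv L ^^ j) u) v" using assms by (simp add: Hdot_def)
  from this[rule_format, of 0] this[rule_format, of 1]
  show "has_weak_deriv L u (weak_deriv L u)"
    "has_weak_deriv L (weak_deriv L u) (weak_deriv L (weak_deriv L u))"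
    by (auto intro: has_weak_deriv_weak_deriv)
qed (use assms in \<open>auto simp: Hdot_def mean_zero_def\<close>)

lemma Hdot_norms: "Hdot_norm L 1 u = nrm (weak_deriv L u)" "Hdot_norm L 2 u = nrm (weak_deriv L (weak_deriv L u))"
  by (simp_all add: Hdot_norm_def numeral_2_eq_2)

lemma sup_norm_ge:
  assumes "continuous_on UNIV u" "x \<in> {0..L}"
  shows "\<bar>u x\<bar> \<le> sup_norm L u"
  unfolding sup_norm_def
proof (rule cSUP_upper[OF assms(2)])
  have "compact ((\<lambda>x. \<bar>u x\<bar>) ` {0..L})"
    using assms(1) by (intro compact_continuous_image continuous_intros) (auto intro: continuous_on_subset)
  then show "bdd_above ((\<lambda>x. \<bar>u x\<bar>) ` {0..L})" by (intro bounded_imp_bdd_above compact_imp_bounded)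
qed

section \<open>The spectral projection\<close>

text \<open>
Real coefficients \<open>c\<close> in the Hartley basis correspond to the Hermitian complex coefficients
\<open>C k = ((1 - \<i>) c k + (1 + \<i>) c (- k)) / (2 sqrt L)\<close>. The imaginary parts cancel in the pairs \<open>k\<close>, \<open>- k\<close>.
\<close>

lemma trig_in_fourier_modes: "trig m c \<in> fourier_modes L m"
proof -
  define C where "C k = Complex ((c k + c (- k)) / (2 * sqrt L)) ((c (- k) - c k) / (2 * sqrt L))" for k
  have "complex_of_real (trig m c x) = (\<Sum>k\<in>modes m. C k * cis (of_int k * x * (2 * pi / L)))" for x
  proof (rule complex_eqI)
    have arg: "of_int k * x * (2 * pi / L) = wavenum k * x" for k by (simp add: wavenum_def)
    let ?c = "\<lambda>k. cos (wavenum k * x) / (2 * sqrt L)" and ?s = "\<lambda>k. sin (wavenum k * x) / (2 * sqrt L)"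
    have "Re (\<Sum>k\<in>modes m. C k * cis (of_int k * x * (2 * pi / L)))
        = (\<Sum>k\<in>modes m. c k * (?c k + ?s k)) + (\<Sum>k\<in>modes m. c (- k) * (?c k - ?s k))"
      unfolding arg by (simp add: C_def sum.distrib[symmetric] add_divide_distrib diff_divide_distrib algebra_simps)
    also have "(\<Sum>k\<in>modes m. c (- k) * (?c k - ?s k)) = (\<Sum>k\<in>modes m. c k * (?c k + ?s k))"
      by (subst sum_modes_uminus[symmetric]) simp
    also have "(\<Sum>k\<in>modes m. c k * (?c k + ?s k)) + (\<Sum>k\<in>modes m. c k * (?c k + ?s k)) = trig m c x"
      unfolding trig_def hartley_def sum.distrib[symmetric] by (rule sum.cong) (auto simp: add_divide_distrib[symmetric])
    finally show "Re (complex_of_real (trig m c x)) = Re (\<Sum>k\<in>modes m. C k * cis (of_int k * x * (2 * pi / L)))" by simp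
    have "Im (\<Sum>k\<in>modes m. C k * cis (of_int k * x * (2 * pi / L)))
        = (\<Sum>k\<in>modes m. Re (C k) * sin (wavenum k * x) + Im (C k) * cos (wavenum k * x))"
      unfolding arg by (simp add: algebra_simps)
    moreover have "\<dots> = (\<Sum>k\<in>modes m. - (Re (C k) * sin (wavenum k * x) + Im (C k) * cos (wavenum k * x)))"
    proof (subst sum_modes_uminus[symmetric], rule sum.cong[OF refl])
      fix k
      have "Re (C (- k)) = Re (C k)" "Im (C (- k)) = - Im (C k)"
        by (simp_all add: C_def add.commute diff_divide_distrib)
      then show "Re (C (- k)) * sin (wavenum (- k) * x) + Im (C (- k)) * cos (wavenum (- k) * x)
          = - (Re (C k) * sin (wavenum k * x) + Im (C k) * cos (wavenum k * x))" by simp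
    qed
    ultimately show "Im (complex_of_real (trig m c x)) = Im (\<Sum>k\<in>modes m. C k * cis (of_int k * x * (2 * pi / L)))"
      unfolding sum_negf Im_complex_of_real by linarith
  qed
  then show ?thesis unfolding fourier_modes_def modes_def by blast
qed

lemma fourier_modes_trig:
  assumes "g \<in> fourier_modes L m"
  shows "\<exists>c. g = trig m c"
proof -
  obtain C :: "int \<Rightarrow> complex" where C: "\<And>x. complex_of_real (g x) = (\<Sum>k\<in>modes m. C k * cis (of_int k * x * (2 * pi / L)))"
    using assms unfolding fourier_modes_def modes_def by blast
  define c where "c k = sqrt L / 2 * (Re (C k) + Re (C (- k)) + Im (C (- k)) - Im (C k))" for k
  have "g x = trig m c x" for x
  proof -
    have arg: "of_int k * x * (2 * pi / L) = wavenum k * x" for k by (simp add: wavenum_def)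
    have sL: "sqrt L > 0" using L_pos by simp
    let ?h = "\<lambda>k. cos (wavenum k * x) + sin (wavenum k * x)"
    have "g x = Re (\<Sum>k\<in>modes m. C k * cis (of_int k * x * (2 * pi / L)))" using C[of x] by (metis Re_complex_of_real)
    also have "\<dots> = (\<Sum>k\<in>modes m. (Re (C k) - Im (C k)) / 2 * ?h k) + (\<Sum>k\<in>modes m. (Re (C k) + Im (C k)) / 2 * ?h (- k))"
      unfolding arg Re_sum sum.distrib[symmetric] by (rule sum.cong) (auto simp: field_simps)
    also have "(\<Sum>k\<in>modes m. (Re (C k) + Im (C k)) / 2 * ?h (- k)) = (\<Sum>k\<in>modes m. (Re (C (- k)) + Im (C (- k))) / 2 * ?h k)"
      by (subst sum_modes_uminus[symmetric]) simp
    also have "(\<Sum>k\<in>modes m. (Re (C k) - Im (C k)) / 2 * ?h k) + \<dots> = trig m c x"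
      unfolding trig_def hartley_def sum.distrib[symmetric]
      by (rule sum.cong) (use sL in \<open>auto simp: c_def field_simps\<close>)
    finally show ?thesis .
  qed
  then show ?thesis by blast
qed

lemma proj_eq_trunc:
  assumes u: "square_integrable u"
  shows "proj L m u = trunc m u"
  unfolding proj_def
proof (rule the_equality)
  show "trunc m u \<in> fourier_modes L m \<and> (\<forall>g\<in>fourier_modes L m. ip (\<lambda>x. u x - trunc m u x) g = 0)"
    using trig_in_fourier_modes fourier_modes_trig trunc_orthogonal[OF u] by metis
next
  fix v assume v: "v \<in> fourier_modes L m \<and> (\<forall>g\<in>fourier_modes L m. ip (\<lambda>x. u x - v x) g = 0)"
  then obtain c where c: "v = trig m c" using fourier_modes_trig by blast
  have "c k = coef u k" if "k \<in> modes m" for k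
  proof -
    have "trig m (\<lambda>j. if j = k then 1 else 0) = hartley k"
      using that by (simp add: fun_eq_iff trig_def if_distrib[of "\<lambda>z. z * _"] sum.delta' cong: if_cong)
    then have "ip (\<lambda>x. u x - v x) (hartley k) = 0" using v trig_in_fourier_modes by metis
    then show ?thesis
      using coef_trig[of m c k] that u by (simp add: c ip_diff_left trig_square_integrable hartley_square_integrable coef_def)
  qed
  then show "v = trunc m u" unfolding c by (rule trig_cong)
qed

section \<open>Agmon's inequality\<close>

text \<open>
A function of mean zero has a zero \<open>x0\<close>. Its square at \<open>x\<close> is the integral of \<open>2 g g'\<close> along either of the two
arcs from \<open>x0\<close> to \<open>x\<close>; adding the two gives the sharp constant \<open>1\<close>, on which the sizes of
\<open>C_3\<^sup>0\<close> and of the Young constant depend.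
\<close>

lemma agmon:
  assumes x: "x \<in> {0..L}"
  shows "(trig N c x)\<^sup>2 \<le> nrm (trig N c) * nrm (trig N (dcoef c))"
proof -
  let ?g = "trig N c" and ?d = "trig N (dcoef c)"
  have "\<exists>x0\<in>{0..L}. ?g x0 = 0"
  proof (rule ccontr)
    assume n: "\<not> (\<exists>x0\<in>{0..L}. ?g x0 = 0)"
    have "(\<forall>x\<in>{0..L}. ?g x \<ge> 0) \<or> (\<forall>x\<in>{0..L}. - ?g x \<ge> 0)"
    proof (rule ccontr)
      assume "\<not> ?thesis"
      then obtain p q where "p \<in> {0..L}" "q \<in> {0..L}" "?g p \<le> 0" "0 \<le> ?g q" by force
      moreover have "connected (?g ` {0..L})"
        by (intro connected_continuous_image trig_cont) simp
      ultimately have "0 \<in> ?g ` {0..L}" by (meson connectedD_interval image_eqI)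
      then show False using n by auto
    qed
    then show False
    proof
      assume "\<forall>x\<in>{0..L}. ?g x \<ge> 0"
      then have "\<forall>x\<in>{0..L}. ?g x = 0" using integralL_eq_0_iff[of 0 L ?g] L_pos mean_zero_trig[of N c]
        by (auto simp: trig_cont mean_zero_def)
      then show False using n L_pos by auto
    next
      assume "\<forall>x\<in>{0..L}. - ?g x \<ge> 0"
      then have "\<forall>x\<in>{0..L}. - ?g x = 0" using integralL_eq_0_iff[of 0 L "\<lambda>x. - ?g x"] L_pos mean_zero_trig[of N c]
          continuous_on_minus[OF trig_cont[of "{0..L}" N c]]
        by (auto simp: mean_zero_def)
      then show False using n L_pos by auto
    qed
  qed
  then obtain x0 where x0: "x0 \<in> {0..L}" "?g x0 = 0" by blast
  let ?h = "\<lambda>x. 2 * ?g x * ?d x"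
  have hc: "continuous_on S ?h" for S by (intro continuous_intros trig_cont)
  have "?g L = ?g 0" using trig_per[of N c 0] by simp
  have ftc: "(?g b)\<^sup>2 - (?g a)\<^sup>2 = integral {a..b} ?h" if "a \<le> b" for a b
  proof -
    have "(LINT x|lebesgue_on {a..b}. ?h x) = (?g b)\<^sup>2 - (?g a)\<^sup>2"
      by (rule LINT_derivative[OF _ hc that]) (auto intro!: derivative_eq_intros trig_deriv)
    then show ?thesis by (simp add: lebesgue_integral_eq_integral continuous_imp_integrable_real hc)
  qed
  have bd: "\<bar>integral {a..b} ?h\<bar> \<le> integral {a..b} (\<lambda>x. \<bar>?h x\<bar>)" for a b
  proof -
    have "?h integrable_on {a..b}" "(\<lambda>x. \<bar>?h x\<bar>) integrable_on {a..b}"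
      by (intro integrable_continuous_real continuous_intros trig_cont)+
    from integral_norm_bound_integral[OF this] show ?thesis by simp
  qed
  have comb: "integral {a..b} (\<lambda>x. \<bar>?h x\<bar>) + integral {b..c} (\<lambda>x. \<bar>?h x\<bar>) = integral {a..c} (\<lambda>x. \<bar>?h x\<bar>)"
    if "a \<le> b" "b \<le> c" for a b c
    using that by (intro Henstock_Kurzweil_Integration.integral_combine) (auto intro!: integrable_continuous_real continuous_intros trig_cont)
  \<comment> \<open>One arc from \<open>x0\<close> to \<open>x\<close> is \<open>{p..q}\<close>; the other is the rest of the period.\<close>
  define p q where "p = min x x0" and "q = max x x0"
  have pq: "0 \<le> p" "p \<le> q" "q \<le> L" using x x0 by (auto simp: p_def q_def)
  have "2 * (?g x)\<^sup>2 \<le> integral {0..L} (\<lambda>x. \<bar>?h x\<bar>)"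
  proof -
    have "(?g x)\<^sup>2 = \<bar>(?g q)\<^sup>2 - (?g p)\<^sup>2\<bar>"
      using x0 by (auto simp: p_def q_def min_def max_def)
    also have "\<dots> \<le> integral {p..q} (\<lambda>x. \<bar>?h x\<bar>)" using ftc[of p q] pq bd by simp
    finally have 1: "(?g x)\<^sup>2 \<le> integral {p..q} (\<lambda>x. \<bar>?h x\<bar>)" .
    have "(?g x)\<^sup>2 = \<bar>(?g q)\<^sup>2 - (?g p)\<^sup>2\<bar>"
      using x0 by (auto simp: p_def q_def min_def max_def)
    also have "\<dots> = \<bar>integral {0..p} ?h + integral {q..L} ?h\<bar>"
      using ftc[of 0 p] ftc[of q L] pq \<open>?g L = ?g 0\<close> by simp
    also have "\<dots> \<le> integral {0..p} (\<lambda>x. \<bar>?h x\<bar>) + integral {q..L} (\<lambda>x. \<bar>?h x\<bar>)"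
      using bd[of 0 p] bd[of q L] by linarith
    finally have 2: "(?g x)\<^sup>2 \<le> integral {0..p} (\<lambda>x. \<bar>?h x\<bar>) + integral {q..L} (\<lambda>x. \<bar>?h x\<bar>)" .
    show ?thesis using 1 2 comb[of 0 p q] comb[of 0 q L] pq by linarith
  qed
  also have "\<dots> = 2 * ip (\<lambda>x. \<bar>?g x\<bar>) (\<lambda>x. \<bar>?d x\<bar>)"
  proof -
    have "integral {0..L} (\<lambda>x. \<bar>?h x\<bar>) = (LINT x|leb. \<bar>?h x\<bar>)"
      by (subst lebesgue_integral_eq_integral) (auto intro!: continuous_imp_integrable_real continuous_intros trig_cont)
    also have "\<dots> = (LINT x|leb. 2 * (\<bar>?g x\<bar> * \<bar>?d x\<bar>))" by (simp add: abs_mult mult.assoc)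
    finally show ?thesis by (simp add: L2_inner_def)
  qed
  also have "\<dots> \<le> 2 * (nrm (\<lambda>x. \<bar>?g x\<bar>) * nrm (\<lambda>x. \<bar>?d x\<bar>))"
    using cauchy_schwarz[of "\<lambda>x. \<bar>?g x\<bar>" "\<lambda>x. \<bar>?d x\<bar>"]
    by (auto intro!: square_integrable_cont continuous_intros trig_cont dest: abs_le_D1)
  also have "\<dots> = 2 * (nrm ?g * nrm ?d)" by (simp add: L2_norm_def)
  finally show ?thesis by simp
qed

section \<open>Truncation of functions in the second Sobolev space\<close>

abbreviation "wd \<equiv> weak_deriv L"

text \<open>
All bounds that the estimates need on one solution at one instant, with a single constant, so that
the truncation errors are uniform in time.
\<close>

definition controlled :: "real \<Rightarrow> (real \<Rightarrow> real) \<Rightarrow> bool" where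
  "controlled B u \<longleftrightarrow> u \<in> Hdot L 2 \<and> (\<forall>x\<in>{0..L}. \<bar>u x\<bar> \<le> B) \<and>
     nrm u \<le> B \<and> nrm (wd u) \<le> B \<and> nrm (wd (wd u)) \<le> B"

text \<open>
The reciprocal of the smallest frequency above the modes up to \<open>N\<close>.
\<close>

definition tail :: "nat \<Rightarrow> real" where
  "tail N = L / (2 * pi * (real N + 1))"

lemma tail_nonneg: "0 \<le> tail N"
  using L_pos by (auto simp: tail_def)

lemma controlledD:
  assumes "controlled B u"
  shows "u \<in> Hdot L 2" "square_integrable u" "square_integrable (wd u)" "square_integrable (wd (wd u))" "0 \<le> B" "continuous_on UNIV u"
    "\<And>x. x \<in> {0..L} \<Longrightarrow> \<bar>u x\<bar> \<le> B" "nrm u \<le> B" "nrm (wd u) \<le> B" "nrm (wd (wd u)) \<le> B"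
    "trunc N (wd u) = trig N (dcoef (coef u))"
    "trunc N (wd (wd u)) = trig N (dcoef (dcoef (coef u)))"
proof -
  have H: "u \<in> Hdot L 2" using assms by (simp add: controlled_def)
  note h = Hdot_2D[OF H]
  show "square_integrable u" "square_integrable (wd u)" "square_integrable (wd (wd u))"
    using h by (auto simp: has_weak_deriv_def intro: square_integrable_L2_per)
  show "0 \<le> B" using assms nrm_nonneg[of u] by (simp add: controlled_def)
  show "trunc N (wd u) = trig N (dcoef (coef u))"
    "trunc N (wd (wd u)) = trig N (dcoef (dcoef (coef u)))"
    by (simp_all add: coef_weak_deriv[OF h(4)] coef_weak_deriv[OF h(5)])
qed (use assms Hdot_2D(3) in \<open>auto simp: controlled_def\<close>)

lemma agmon_bound:
  assumes "x \<in> {0..L}" "nrm (trig N c) \<le> a" "nrm (trig N (dcoef c)) \<le> b"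
  shows "\<bar>trig N c x\<bar> \<le> sqrt (a * b)"
proof -
  have "(trig N c x)\<^sup>2 \<le> a * b"
    using agmon[OF assms(1), of N c] mult_mono[OF assms(2,3)] nrm_nonneg order_trans[OF nrm_nonneg assms(2)]
    by (meson order_trans)
  then show ?thesis using real_le_rsqrt by simp
qed

text \<open>
Sup norms of truncations are not bounded by the sup norm of the function, uniformly in \<open>N\<close>. The bounds of the truncation and of its
derivative come from Agmon's inequality and the bounds of one derivative more.
\<close>

lemma controlled_trunc:
  assumes "controlled B u"
  shows "nrm (trunc N u) \<le> B" "nrm (trig N (dcoef (coef u))) \<le> B" "nrm (trig N (dcoef (dcoef (coef u)))) \<le> B"
    "nrm (\<lambda>x. u x - trunc N u x) \<le> B * tail N"
    "nrm (\<lambda>x. wd u x - trig N (dcoef (coef u)) x) \<le> B * tail N"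
    "x \<in> {0..L} \<Longrightarrow> \<bar>trunc N u x\<bar> \<le> B" "x \<in> {0..L} \<Longrightarrow> \<bar>trig N (dcoef (coef u)) x\<bar> \<le> B"
proof -
  note c = controlledD[OF assms]
  note h = Hdot_2D[OF c(1)]
  show 1: "nrm (trunc N u) \<le> B" using nrm_trunc_le[OF c(2), of N] c(8) by linarith
  show 2: "nrm (trig N (dcoef (coef u))) \<le> B"
    using nrm_trunc_le[OF c(3), of N] c(9) c(11)[of N] by simp
  show 3: "nrm (trig N (dcoef (dcoef (coef u)))) \<le> B"
    using nrm_trunc_le[OF c(4), of N] c(10) c(12)[of N] by simp
  have t: "tail N * nrm (wd u) \<le> B * tail N" "tail N * nrm (wd (wd u)) \<le> B * tail N"
    using mult_left_mono[OF c(9) tail_nonneg] mult_left_mono[OF c(10) tail_nonneg] by (simp_all add: mult.commute)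
  show "nrm (\<lambda>x. u x - trunc N u x) \<le> B * tail N"
    using trunc_tail[OF h(1,2,4), of N] t(1) by (simp add: tail_def)
  have "wd u \<in> L2_per L" "mean_zero (wd u)" using h(4) has_weak_deriv_mean_zero by (auto simp: has_weak_deriv_def)
  from trunc_tail[OF this h(5), of N]
  show "nrm (\<lambda>x. wd u x - trig N (dcoef (coef u)) x) \<le> B * tail N"
    using t(2) by (simp add: tail_def c(11))
  show "\<bar>trunc N u x\<bar> \<le> B" if "x \<in> {0..L}" using agmon_bound[OF that 1 2] c(5) by simp
  show "\<bar>trig N (dcoef (coef u)) x\<bar> \<le> B" if "x \<in> {0..L}" using agmon_bound[OF that 2 3] c(5) by simp
qed

text \<open>
The part of the nonlinearity, tested with a polynomial of degree \<open>N\<close>, that the truncated equation misses.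
\<close>

definition advection_error :: "nat \<Rightarrow> (real \<Rightarrow> real) \<Rightarrow> (int \<Rightarrow> real) \<Rightarrow> real" where
  "advection_error N u c = ip (\<lambda>x. u x * wd u x) (trig N c)
     - ip (\<lambda>x. trunc N u x * trig N (dcoef (coef u)) x) (trig N c)"

lemma square_integrable_advection: "controlled B u \<Longrightarrow> square_integrable (\<lambda>x. u x * wd u x)"
  using controlledD by (intro square_integrable_bounded_mult(1)[where B = B]) (auto intro: square_integrable_measurable)

text \<open>
Write \<open>u u_x - u_N u_N,x = u (u_x - u_N,x) + u_N,x (u - u_N)\<close>. In each product the factor that is
not small is bounded in the sup norm, and the truncation error is \<open>O(1/N)\<close> in \<open>L\<^sup>2\<close>.
\<close>

lemma advection_error_bound:
  assumes "controlled B u"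
  shows "\<bar>advection_error N u c\<bar> \<le> 2 * B\<^sup>2 * tail N * nrm (trig N c)"
proof -
  note d = controlledD[OF assms]
  note t = controlled_trunc[OF assms]
  let ?ux = "trig N (dcoef (coef u))"
  have m: "u \<in> borel_measurable leb" "?ux \<in> borel_measurable leb" using d(2) trig_square_integrable by (auto intro: square_integrable_measurable)
  have s: "square_integrable (\<lambda>x. wd u x - ?ux x)" "square_integrable (\<lambda>x. u x - trunc N u x)"
    by (intro square_integrable_diff d trig_square_integrable)+
  note b1 = square_integrable_bounded_mult[OF s(1) m(1) d(7)]
  note b2 = square_integrable_bounded_mult[OF s(2) m(2) t(7)]
  have "advection_error N u c = ip (\<lambda>x. u x * wd u x - trunc N u x * ?ux x) (trig N c)"
    unfolding advection_error_def
    by (intro ip_diff_left[symmetric] square_integrable_advection[OF assms] trig_square_integrable square_integrable_cont continuous_intros trig_cont)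
  also have "\<dots> = ip (\<lambda>x. u x * (wd u x - ?ux x) + ?ux x * (u x - trunc N u x)) (trig N c)"
    by (simp add: algebra_simps)
  finally have e: "advection_error N u c = ip (\<lambda>x. u x * (wd u x - ?ux x) + ?ux x * (u x - trunc N u x)) (trig N c)" .
  have "nrm (\<lambda>x. u x * (wd u x - ?ux x) + ?ux x * (u x - trunc N u x)) \<le> B * (B * tail N) + B * (B * tail N)"
    using nrm_triangle[OF b1(1) b2(1)] b1(2) b2(2) mult_left_mono[OF t(4)[of N] d(5)] mult_left_mono[OF t(5)[of N] d(5)] by linarith
  then have "nrm (\<lambda>x. u x * (wd u x - ?ux x) + ?ux x * (u x - trunc N u x)) * nrm (trig N c) \<le> 2 * B\<^sup>2 * tail N * nrm (trig N c)"
    by (intro mult_right_mono nrm_nonneg) (simp add: power2_eq_square)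
  then show ?thesis
    unfolding e using cauchy_schwarz[OF square_integrable_add[OF b1(1) b2(1)] trig_square_integrable[of N c]] by linarith
qed

end

section \<open>The truncated difference of two solutions\<close>

text \<open>
The two solutions at one instant, truncated to the modes up to \<open>N\<close>. The coefficients of the
truncated difference, of the truncated mean and of the test function \<open>V_xx + P_N (A V)\<close> are \<open>z\<close>, \<open>a\<close> and \<open>q\<close>.
\<close>

locale galerkin_pair = period +
  fixes B :: real and m N :: nat and u w :: "real \<Rightarrow> real"
  assumes mN: "m \<le> N" and cu: "controlled B u" and cw: "controlled B w"
begin

definition z where "z k = coef w k - coef u k"
definition a where "a k = (coef u k + coef w k) / 2"
definition q where "q k = dcoef (dcoef z) k + coef (\<lambda>x. trig N a x * trig N z x) k"

abbreviation "V \<equiv> trig N z"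
abbreviation "Vx \<equiv> trig N (dcoef z)"
abbreviation "Vxx \<equiv> trig N (dcoef (dcoef z))"
abbreviation "A \<equiv> trig N a"
abbreviation "Ax \<equiv> trig N (dcoef a)"
abbreviation "P \<equiv> trig m z"
abbreviation "err c \<equiv> advection_error N w c - advection_error N u c"

lemma square_integrable_intros:
  "square_integrable (trig n c)" "square_integrable (\<lambda>x. trig n c x * trig n' d x)"
  "square_integrable (\<lambda>x. trig n c x * trig n' d x * trig n'' e x)"
  by (intro square_integrable_cont continuous_intros trig_cont)+

lemma ip_by_parts_zero: "ip (trig N c) (trig N (dcoef c)) = 0"
  using periodic_by_parts[of "trig N c" "trig N (dcoef c)" "trig N c" "trig N (dcoef c)"]
    trig_per[of N c 0] ip_commute[of "trig N c" "trig N (dcoef c)"]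
  by (auto simp: trig_deriv trig_cont)

lemma trunc_m_trig: "trunc m (trig N c) = trig m c"
  by (rule trig_cong) (use modes_mono[OF mN] in \<open>auto simp: coef_trig\<close>)

lemma ip_P_V: "ip P V = (nrm P)\<^sup>2"
  using ip_trunc[OF trig_square_integrable, of m N z z] by (simp add: trunc_m_trig nrm_sq ip_commute)

definition "J = ip (\<lambda>x. A x * V x) V"

text \<open>
The test function \<open>V_xx + P_N (A V)\<close> is the truncation of the flux.
\<close>

lemma trig_q: "trig N q = trunc N (\<lambda>x. Vxx x + A x * V x)"
  by (rule trig_cong)
     (simp add: q_def coef_def ip_add_left square_integrable_intros hartley_square_integrable coef_trig[unfolded coef_def])

lemma ip_nrm_Px: "ip P Vxx = - (nrm (trig m (dcoef z)))\<^sup>2"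
proof -
  have "ip P Vxx = ip P (trig m (dcoef (dcoef z)))"
    using ip_trunc[OF trig_square_integrable, of m N "dcoef (dcoef z)" z]
    by (simp add: trunc_m_trig ip_commute[of P])
  also have "\<dots> = - (nrm (trig m (dcoef z)))\<^sup>2"
    using periodic_by_parts[of P "trig m (dcoef z)" "trig m (dcoef z)" "trig m (dcoef (dcoef z))"]
      trig_per[of m z 0] trig_per[of m "dcoef z" 0]
    by (auto simp: trig_deriv trig_cont nrm_sq)
  finally show ?thesis .
qed

end

section \<open>The energy of the truncated difference\<close>

text \<open>
In terms of the square roots \<open>p\<close> of \<open>X\<close> and \<open>q\<close> of \<open>Y\<close> and of \<open>t = r p / \<gamma>\<close> this is the positivity of
\<open>q\<^sup>4 - 2 t q\<^sup>3 + 2 t\<^sup>4\<close>, a sum of two squares.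
\<close>

lemma young_quarter:
  fixes X Y S r \<gamma> :: real
  assumes "0 < \<gamma>" "0 \<le> r" "0 \<le> X" "0 \<le> Y" "S = sqrt (X * Y)"
  shows "2 * r * S * Y \<le> \<gamma> * Y\<^sup>2 + 2 * r^4 * \<gamma> powi (-3) * X\<^sup>2"
proof -
  define p q t where "p = sqrt X" and "q = sqrt Y" and "t = r * p / \<gamma>"
  have X: "X = p\<^sup>2" and Y: "Y = q\<^sup>2" and S: "S = p * q"
    using assms by (simp_all add: p_def q_def real_sqrt_mult)
  have g3: "\<gamma> powi (-3) = 1 / \<gamma>^3"
    by (simp add: power_int_def field_simps)
  have "0 \<le> (q\<^sup>2 - t * q - t\<^sup>2)\<^sup>2 + (t * (q - t))\<^sup>2" by simp
  also have "\<dots> = q^4 - 2 * t * q^3 + 2 * t^4"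
    by (simp add: power2_eq_square power3_eq_cube power4_eq_xxxx algebra_simps)
  finally have "\<gamma> * (2 * t * q^3) \<le> \<gamma> * (q^4 + 2 * t^4)" using assms(1) by (intro mult_left_mono) auto
  moreover have "\<gamma> * (2 * t * q^3) = 2 * r * S * Y"
    using assms(1) by (simp add: t_def S Y power2_eq_square power3_eq_cube)
  moreover have "\<gamma> * (q^4 + 2 * t^4) = \<gamma> * Y\<^sup>2 + 2 * r^4 * \<gamma> powi (-3) * X\<^sup>2"
    using assms(1) unfolding g3 t_def X Y
    by (simp add: field_simps power4_eq_xxxx power2_eq_square power3_eq_cube)
  ultimately show ?thesis by simp
qed

text \<open>
The bookkeeping of the energy estimate. Here \<open>X\<close> and \<open>Y\<close> stand for \<open>|v|\<close> and \<open>|v_x|\<close>, \<open>p\<close> and \<open>xq\<close> for the low and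
high modes of \<open>v\<close>, \<open>J\<close> and \<open>I\<close> for \<open>\<integral> a v\<^sup>2\<close> and \<open>\<integral> a v P_m v\<close>, \<open>\<alpha>\<close> for \<open>\<integral> a_s v\<^sup>2\<close>, and \<open>dV\<close>, \<open>dq\<close> for the equation
tested with \<open>v\<close> and with \<open>v_xx + a v\<close>; \<open>e1\<close>, \<open>e2\<close>, \<open>e3\<close> are truncation errors. The \<open>Y\<^sup>2\<close> terms balance exactly: of the
damping \<open>2 \<gamma> / M\<close> a quarter goes to the high modes of the bad term, half to Young's inequality, and a
quarter is the decay rate.
\<close>

lemma decay_algebra:
  fixes X Y p xq t C3 \<gamma> \<mu> M Ri K dV dq \<alpha> J I e1 e2 e3 r S :: real
  assumes pos: "0 < \<gamma>" "0 < \<mu>" "0 < M" "0 \<le> Ri" "0 \<le> C3" "0 \<le> K" "0 \<le> p" "0 \<le> X" "0 \<le> xq"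
    and split: "X\<^sup>2 = p\<^sup>2 + xq\<^sup>2" and xq: "xq \<le> t * Y"
    and C3: "C3 \<le> \<mu>" "C3 * t\<^sup>2 \<le> \<gamma> / (2 * M)"
    and large: "1 / M * ((\<gamma> + 2 * \<mu>) * Ri + K) \<le> \<gamma> / 2"
    and dV: "dV \<le> C3 / 2 * X\<^sup>2 - \<gamma> * X\<^sup>2 - \<mu> * p\<^sup>2 + e1"
    and dq: "\<gamma> * (Y\<^sup>2 - J) - \<mu> * I - e2 \<le> dq"
    and \<alpha>: "- \<alpha> \<le> \<gamma> * Y\<^sup>2 + K * X\<^sup>2"
    and J: "J \<le> Ri * X\<^sup>2 + e3" and I: "I \<le> Ri * X\<^sup>2 + e3"
  shows "2 * dV + 1 / M * (- 2 * dq - \<alpha>)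
    \<le> - (\<gamma> / 2) * (X\<^sup>2 + 1 / M * (Y\<^sup>2 - J)) + (2 * e1 + 1 / M * (2 * e2 + (3/2 * \<gamma> + 2 * \<mu>) * e3))"
proof -
  define i where "i = 1 / M"
  have i: "0 < i" using pos by (simp add: i_def)
  have "xq\<^sup>2 \<le> (t * Y)\<^sup>2" using xq pos by (intro power_mono)
  then have "C3 * xq\<^sup>2 \<le> C3 * t\<^sup>2 * Y\<^sup>2" using pos by (simp add: power_mult_distrib mult_left_mono mult.assoc)
  also have "\<dots> \<le> \<gamma> / (2 * M) * Y\<^sup>2" using C3(2) by (rule mult_right_mono) simp
  finally have 1: "C3 * X\<^sup>2 \<le> \<mu> * p\<^sup>2 + i * (\<gamma> / 2 * Y\<^sup>2)"
    using mult_right_mono[OF C3(1), of "p\<^sup>2"] unfolding split i_def by (simp add: algebra_simps)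
  have mu_p: "0 \<le> \<mu> * p\<^sup>2" using pos by simp
  have "- 2 * dq - \<alpha> + \<gamma> / 2 * (Y\<^sup>2 - J) \<le> - (\<gamma> / 2 * Y\<^sup>2) + 3/2 * \<gamma> * J + 2 * \<mu> * I + 2 * e2 + K * X\<^sup>2"
    using dq \<alpha> by (simp add: algebra_simps)
  also have "\<dots> \<le> - (\<gamma> / 2 * Y\<^sup>2) + 3/2 * \<gamma> * (Ri * X\<^sup>2 + e3) + 2 * \<mu> * (Ri * X\<^sup>2 + e3) + 2 * e2 + K * X\<^sup>2"
    using mult_left_mono[OF J, of "3/2 * \<gamma>"] mult_left_mono[OF I, of "2 * \<mu>"] pos by linarith
  finally have "i * (- 2 * dq - \<alpha> + \<gamma> / 2 * (Y\<^sup>2 - J))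
    \<le> i * (- (\<gamma> / 2 * Y\<^sup>2) + 3/2 * \<gamma> * (Ri * X\<^sup>2 + e3) + 2 * \<mu> * (Ri * X\<^sup>2 + e3) + 2 * e2 + K * X\<^sup>2)"
    using i by (intro mult_left_mono) auto
  also have "\<dots> = - (i * (\<gamma> / 2 * Y\<^sup>2)) + X\<^sup>2 * (i * ((3/2 * \<gamma> + 2 * \<mu>) * Ri + K)) + i * (2 * e2 + (3/2 * \<gamma> + 2 * \<mu>) * e3)"
    by (simp add: algebra_simps)
  also have "X\<^sup>2 * (i * ((3/2 * \<gamma> + 2 * \<mu>) * Ri + K)) \<le> X\<^sup>2 * (3/2 * \<gamma>)"
  proof (rule mult_left_mono)
    have "(3/2 * \<gamma> + 2 * \<mu>) * Ri + K \<le> 3/2 * ((\<gamma> + 2 * \<mu>) * Ri + K)"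
    proof -
      have "3/2 * ((\<gamma> + 2 * \<mu>) * Ri + K) - ((3/2 * \<gamma> + 2 * \<mu>) * Ri + K) = \<mu> * Ri + K / 2"
        by (simp add: field_simps)
      moreover have "0 \<le> \<mu> * Ri" using pos by simp
      ultimately show ?thesis using pos by linarith
    qed
    then have "i * ((3/2 * \<gamma> + 2 * \<mu>) * Ri + K) \<le> 3/2 * (i * ((\<gamma> + 2 * \<mu>) * Ri + K))"
      using mult_left_mono[of _ _ i] i by fastforce
    also have "i * ((\<gamma> + 2 * \<mu>) * Ri + K) \<le> \<gamma>"
      by (rule order_trans[OF large[folded i_def]]) (use pos in simp)
    finally show "i * ((3/2 * \<gamma> + 2 * \<mu>) * Ri + K) \<le> 3/2 * \<gamma>" by simp
  qed simp
  finally have 2: "i * (- 2 * dq - \<alpha> + \<gamma> / 2 * (Y\<^sup>2 - J))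
    \<le> - (i * (\<gamma> / 2 * Y\<^sup>2)) + X\<^sup>2 * (3/2 * \<gamma>) + i * (2 * e2 + (3/2 * \<gamma> + 2 * \<mu>) * e3)" by simp
  have 3: "i * (- 2 * dq - \<alpha> + \<gamma> / 2 * (Y\<^sup>2 - J)) = i * (- 2 * dq - \<alpha>) + \<gamma> / 2 * (i * (Y\<^sup>2 - J))"
    by (simp add: algebra_simps)
  have 4: "X\<^sup>2 * (3/2 * \<gamma>) = 3/2 * (\<gamma> * X\<^sup>2)" by simp
  have 5: "- (\<gamma> / 2) * (X\<^sup>2 + i * (Y\<^sup>2 - J)) = - (3/2 * (\<gamma> * X\<^sup>2)) + \<gamma> * X\<^sup>2 - \<gamma> / 2 * (i * (Y\<^sup>2 - J))"
    by (simp add: field_simps)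
  have 6: "dV \<le> 1/2 * (C3 * X\<^sup>2) - \<gamma> * X\<^sup>2 - \<mu> * p\<^sup>2 + e1" using dV by simp
  have sum: "2 * dV + T \<le> - (3/2 * g) + g - Z + (2 * e1 + E)"
    if "c \<le> mp + h" "T + Z \<le> - h + 3/2 * g + E" "dV \<le> 1/2 * c - g - mp + e1" "0 \<le> mp" for c mp h T Z g E
    using that by linarith
  show ?thesis unfolding i_def[symmetric] 5 by (rule sum[OF 1 2[unfolded 3 4] 6 mu_p])
qed

text \<open>
Everything that multiplies \<open>tail N\<close> in the energy inequality, collected into a constant that is independent of \<open>N\<close> and of
time.
\<close>

definition residual :: "real \<Rightarrow> real \<Rightarrow> real \<Rightarrow> real" where
  "residual B \<gamma> \<mu> = 16 * B^3 + (16 * B^3 + 16 * B^4 + (6 * \<gamma> + 8 * \<mu>) * B^3)"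

context galerkin_pair
begin

definition "a0 x = (u x + w x) / 2"

lemma V_eq: "V x = trunc N w x - trunc N u x"
  unfolding z_def[abs_def] trig_diff[symmetric] ..

lemma A_eq: "A x = (trunc N u x + trunc N w x) / 2"
proof -
  have "a = (\<lambda>k. 1/2 * (coef u k + coef w k))" by (auto simp: a_def)
  then show ?thesis using trig_scale[of "1/2" N "\<lambda>k. coef u k + coef w k" x] by (simp add: trig_add[symmetric])
qed

lemma dcoef_diff: "dcoef (\<lambda>k. c k - d k) = (\<lambda>k. dcoef c k - dcoef d k)"
  by (auto simp: dcoef_def algebra_simps)

lemma difference_bounds:
  "nrm V \<le> 2 * B" "nrm Vx \<le> 2 * B" "nrm Vxx \<le> 2 * B"
  "x \<in> {0..L} \<Longrightarrow> \<bar>V x\<bar> \<le> 2 * B" "x \<in> {0..L} \<Longrightarrow> \<bar>A x\<bar> \<le> B"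
proof -
  note tu = controlled_trunc[OF cu] and tw = controlled_trunc[OF cw]
  have "nrm V \<le> nrm (trunc N w) + nrm (trunc N u)"
    unfolding V_eq[abs_def] by (intro nrm_triangle_diff trig_square_integrable)
  then show "nrm V \<le> 2 * B" using tu(1)[of N] tw(1)[of N] by linarith
  have "Vx = (\<lambda>x. trig N (dcoef (coef w)) x - trig N (dcoef (coef u)) x)"
    unfolding z_def[abs_def] dcoef_diff trig_diff ..
  then have "nrm Vx \<le> nrm (trig N (dcoef (coef w))) + nrm (trig N (dcoef (coef u)))"
    using nrm_triangle_diff[OF trig_square_integrable trig_square_integrable] by simp
  then show "nrm Vx \<le> 2 * B" using tu(2)[of N] tw(2)[of N] by linarith
  have "Vxx = (\<lambda>x. trig N (dcoef (dcoef (coef w))) x - trig N (dcoef (dcoef (coef u))) x)"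
    unfolding z_def[abs_def] dcoef_diff trig_diff ..
  then have "nrm Vxx \<le> nrm (trig N (dcoef (dcoef (coef w)))) + nrm (trig N (dcoef (dcoef (coef u))))"
    using nrm_triangle_diff[OF trig_square_integrable trig_square_integrable] by simp
  then show "nrm Vxx \<le> 2 * B" using tu(3)[of N] tw(3)[of N] by linarith
  show "\<bar>V x\<bar> \<le> 2 * B" "\<bar>A x\<bar> \<le> B" if "x \<in> {0..L}"
  proof -
    have "\<bar>trunc N u x + trunc N w x\<bar> \<le> 2 * B" "\<bar>trunc N w x - trunc N u x\<bar> \<le> 2 * B"
      using tu(6)[OF that, of N] tw(6)[OF that, of N] by linarith+
    then show "\<bar>V x\<bar> \<le> 2 * B" "\<bar>A x\<bar> \<le> B" by (simp_all add: V_eq A_eq)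
  qed
qed

lemma B_nonneg: "0 \<le> B" using controlledD(5)[OF cu] .

lemma P_split: "(nrm V)\<^sup>2 = (nrm P)\<^sup>2 + (nrm (\<lambda>x. V x - P x))\<^sup>2" "nrm P \<le> nrm V"
  "nrm (\<lambda>x. V x - P x) \<le> tail m * nrm Vx"
proof -
  show "(nrm V)\<^sup>2 = (nrm P)\<^sup>2 + (nrm (\<lambda>x. V x - P x))\<^sup>2"
    using nrm_sub_trunc[OF trig_square_integrable, of N z m] ip_trunc_self[OF trig_square_integrable, of m N z] by (simp add: trunc_m_trig nrm_sq)
  show "nrm P \<le> nrm V" using nrm_trunc_le[OF trig_square_integrable, of m N z] by (simp add: trunc_m_trig)
  show "nrm (\<lambda>x. V x - P x) \<le> tail m * nrm Vx"
    using trunc_tail[OF trig_L2_per mean_zero_trig trig_has_weak_deriv, of N z m] by (simp add: trunc_m_trig tail_def)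
qed

text \<open>
The sup norm bound \<open>Ri\<close> holds for the mean \<open>a0\<close> of the solutions but not for its truncation \<open>A\<close>, so the
product is compared with \<open>a0 V\<close>.
\<close>

lemma nrm_AV:
  assumes "\<And>x. x \<in> {0..L} \<Longrightarrow> \<bar>u x\<bar> \<le> Ri" "\<And>x. x \<in> {0..L} \<Longrightarrow> \<bar>w x\<bar> \<le> Ri"
  shows "nrm (\<lambda>x. A x * V x) \<le> Ri * nrm V + 2 * B\<^sup>2 * tail N"
proof -
  note du = controlledD[OF cu] and dw = controlledD[OF cw]
  have sa0: "square_integrable a0"
    using square_integrable_scale[OF square_integrable_add[OF du(2) dw(2)], of "1/2"] by (simp add: a0_def[abs_def])
  have s1: "square_integrable (\<lambda>x. a0 x * V x)" and b1: "nrm (\<lambda>x. a0 x * V x) \<le> Ri * nrm V"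
  proof -
    have "\<bar>a0 x\<bar> \<le> Ri" if "x \<in> {0..L}" for x
    proof -
      have "\<bar>u x + w x\<bar> \<le> 2 * Ri" using assms(1)[OF that] assms(2)[OF that] by linarith
      then show ?thesis by (simp add: a0_def)
    qed
    from square_integrable_bounded_mult[OF trig_square_integrable square_integrable_measurable[OF sa0] this]
    show "square_integrable (\<lambda>x. a0 x * V x)" "nrm (\<lambda>x. a0 x * V x) \<le> Ri * nrm V" by simp_all
  qed
  have sd: "square_integrable (\<lambda>x. A x - a0 x)" by (intro square_integrable_diff trig_square_integrable sa0)
  have "nrm (\<lambda>x. A x - a0 x) \<le> B * tail N"
  proof -
    have su: "square_integrable (\<lambda>x. u x - trunc N u x)" "square_integrable (\<lambda>x. w x - trunc N w x)" by (intro square_integrable_diff trig_square_integrable du dw)+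
    have "(\<lambda>x. A x - a0 x) = (\<lambda>x. (-1/2) * ((u x - trunc N u x) + (w x - trunc N w x)))"
      by (auto simp: A_eq a0_def field_simps)
    then have "nrm (\<lambda>x. A x - a0 x) = 1/2 * nrm (\<lambda>x. (u x - trunc N u x) + (w x - trunc N w x))"
      by (simp only: nrm_scale)
    also have "nrm (\<lambda>x. (u x - trunc N u x) + (w x - trunc N w x)) \<le> B * tail N + B * tail N"
      using nrm_triangle[OF su] controlled_trunc(4)[OF cu, of N] controlled_trunc(4)[OF cw, of N] by linarith
    finally show ?thesis by simp
  qed
  then have "2 * B * nrm (\<lambda>x. A x - a0 x) \<le> 2 * B * (B * tail N)"
    using B_nonneg by (intro mult_left_mono) auto
  with square_integrable_bounded_mult[OF sd square_integrable_measurable[OF trig_square_integrable] difference_bounds(4)]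
  have s2: "square_integrable (\<lambda>x. V x * (A x - a0 x))" and b2: "nrm (\<lambda>x. V x * (A x - a0 x)) \<le> 2 * B * (B * tail N)"
    by (blast intro: order_trans)+
  have "nrm (\<lambda>x. A x * V x) = nrm (\<lambda>x. a0 x * V x + V x * (A x - a0 x))"
    by (simp add: algebra_simps)
  also have "\<dots> \<le> Ri * nrm V + 2 * B\<^sup>2 * tail N"
    using nrm_triangle[OF s1 s2] b1 b2 by (simp add: power2_eq_square)
  finally show ?thesis .
qed

lemma nrm_q: "nrm (trig N q) \<le> 2 * B + 2 * B\<^sup>2"
proof -
  have b: "nrm (\<lambda>x. A x * V x) \<le> B * nrm V"
    by (rule square_integrable_bounded_mult(2)[OF trig_square_integrable square_integrable_measurable[OF trig_square_integrable] difference_bounds(5)])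
  have "nrm (trig N q) \<le> nrm (\<lambda>x. Vxx x + A x * V x)"
    unfolding trig_q by (intro nrm_trunc_le square_integrable_add square_integrable_intros)
  also have "\<dots> \<le> nrm Vxx + nrm (\<lambda>x. A x * V x)" by (intro nrm_triangle square_integrable_intros)
  also have "\<dots> \<le> 2 * B + B * (2 * B)"
    using b difference_bounds(3) mult_left_mono[OF difference_bounds(1) B_nonneg] by linarith
  finally show ?thesis by (simp add: power2_eq_square)
qed

text \<open>
Truncation commutes with differentiation, \<open>(V\<^sup>2)_x = 2 V V_x\<close>, and Agmon's inequality bounds \<open>V\<close>.
\<close>

lemma nrm_deriv_square:
  "nrm (trig N (dcoef (coef (\<lambda>x. V x * V x)))) \<le> 2 * sqrt (nrm V * nrm Vx) * nrm Vx"
proof -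
  have "coef (\<lambda>x. 2 * (V x * Vx x)) k = dcoef (coef (\<lambda>x. V x * V x)) k" for k
  proof -
    have "ip (\<lambda>x. V x * V x) (\<lambda>x. wavenum k * hartley (- k) x) = - ip (\<lambda>x. 2 * (V x * Vx x)) (hartley k)"
      using trig_per[of N z 0] hartley_per[of k 0]
      by (intro periodic_by_parts) (auto intro!: derivative_eq_intros trig_deriv hartley_deriv continuous_intros trig_cont hartley_cont)
    then show ?thesis by (simp add: coef_def dcoef_def ip_scale_right)
  qed
  then have "trig N (dcoef (coef (\<lambda>x. V x * V x))) = trunc N (\<lambda>x. 2 * (V x * Vx x))" by presburger
  then have "nrm (trig N (dcoef (coef (\<lambda>x. V x * V x)))) \<le> 2 * nrm (\<lambda>x. V x * Vx x)"
    using nrm_trunc_le[of "\<lambda>x. 2 * (V x * Vx x)" N] by (simp add: square_integrable_scale square_integrable_intros nrm_scale)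
  moreover have "nrm (\<lambda>x. V x * Vx x) \<le> sqrt (nrm V * nrm Vx) * nrm Vx"
    by (rule square_integrable_bounded_mult(2)) (auto intro!: trig_square_integrable square_integrable_measurable agmon_bound)
  ultimately show ?thesis by simp
qed

lemma err_bound: "\<bar>err c\<bar> \<le> 4 * B\<^sup>2 * tail N * nrm (trig N c)"
  using advection_error_bound[OF cu, of N c] advection_error_bound[OF cw, of N c] by linarith

definition "energy = (nrm V)\<^sup>2 + 1 / real m * ((nrm Vx)\<^sup>2 - J)"

lemma AV_pairing:
  assumes "\<And>x. x \<in> {0..L} \<Longrightarrow> \<bar>u x\<bar> \<le> Ri" "\<And>x. x \<in> {0..L} \<Longrightarrow> \<bar>w x\<bar> \<le> Ri"
    and g: "square_integrable g" "nrm g \<le> nrm V"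
  shows "\<bar>ip (\<lambda>x. A x * V x) g\<bar> \<le> Ri * (nrm V)\<^sup>2 + 4 * B^3 * tail N"
proof -
  have Ri: "0 \<le> Ri" using assms(1)[of 0] L_pos by auto
  have "\<bar>ip (\<lambda>x. A x * V x) g\<bar> \<le> nrm (\<lambda>x. A x * V x) * nrm g"
    by (rule cauchy_schwarz) (intro square_integrable_intros g)+
  also have "\<dots> \<le> (Ri * nrm V + 2 * B\<^sup>2 * tail N) * nrm V"
    using nrm_AV[OF assms(1,2)] g Ri tail_nonneg nrm_nonneg by (intro mult_mono add_nonneg_nonneg mult_nonneg_nonneg) auto
  also have "\<dots> \<le> Ri * (nrm V)\<^sup>2 + 2 * B\<^sup>2 * tail N * (2 * B)"
  proof -
    have "0 \<le> 2 * B\<^sup>2 * tail N" using tail_nonneg by simp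
    from mult_left_mono[OF difference_bounds(1) this]
    show ?thesis by (simp only: power2_eq_square distrib_right mult.assoc add_left_mono)
  qed
  finally show ?thesis by (simp add: power2_eq_square power3_eq_cube algebra_simps)
qed

text \<open>
The indefinite term \<open>J\<close> is at most \<open>Ri |V|\<^sup>2\<close> up to truncation errors, which after division by \<open>m\<close> costs at
most half of \<open>|V|\<^sup>2\<close>.
\<close>

lemma energy_bounds:
  assumes m: "m > 0"
    and Ri: "\<And>x. x \<in> {0..L} \<Longrightarrow> \<bar>u x\<bar> \<le> Ri" "\<And>x. x \<in> {0..L} \<Longrightarrow> \<bar>w x\<bar> \<le> Ri"
    and Rm: "1 / real m * Ri \<le> 1 / 2"
  shows "(nrm V)\<^sup>2 / 2 - 4 * B^3 * tail N \<le> energy"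
    and "energy \<le> 8 * B\<^sup>2 + 4 * B^3"
proof -
  have t0: "0 \<le> tail N" by (rule tail_nonneg)
  have J: "\<bar>J\<bar> \<le> Ri * (nrm V)\<^sup>2 + 4 * B^3 * tail N"
    unfolding J_def by (rule AV_pairing[OF Ri trig_square_integrable]) simp_all
  have im: "1 / real m \<le> 1" "0 < 1 / real m" using m by auto
  have t3: "0 \<le> 4 * B^3 * tail N" using t0 B_nonneg by simp
  have "1 / real m * J \<le> 1 / real m * (Ri * (nrm V)\<^sup>2 + 4 * B^3 * tail N)"
    using J im by (intro mult_left_mono) auto
  also have "\<dots> = 1 / real m * Ri * (nrm V)\<^sup>2 + 1 / real m * (4 * B^3 * tail N)" by (simp add: algebra_simps)
  also have "\<dots> \<le> 1/2 * (nrm V)\<^sup>2 + 1 * (4 * B^3 * tail N)"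
    using Rm im t3 by (intro add_mono mult_right_mono) auto
  finally have "1 / real m * J \<le> (nrm V)\<^sup>2 / 2 + 4 * B^3 * tail N" by simp
  moreover have "0 \<le> 1 / real m * (nrm Vx)\<^sup>2" by simp
  ultimately show "(nrm V)\<^sup>2 / 2 - 4 * B^3 * tail N \<le> energy"
    unfolding energy_def right_diff_distrib by linarith
  have "\<bar>J\<bar> \<le> nrm (\<lambda>x. A x * V x) * nrm V" unfolding J_def by (intro cauchy_schwarz square_integrable_intros)
  also have "\<dots> \<le> (B * nrm V) * nrm V"
    by (intro mult_right_mono nrm_nonneg square_integrable_bounded_mult(2) trig_square_integrable square_integrable_measurable difference_bounds(5))
  also have "\<dots> \<le> (B * (2 * B)) * (2 * B)"
    using B_nonneg nrm_nonneg difference_bounds(1) by (intro mult_mono mult_left_mono) auto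
  finally have J': "\<bar>J\<bar> \<le> 4 * B^3" by (simp add: power3_eq_cube)
  have V2: "(nrm V)\<^sup>2 \<le> (2 * B)\<^sup>2" "(nrm Vx)\<^sup>2 \<le> (2 * B)\<^sup>2"
    using difference_bounds(1,2) nrm_nonneg by (intro power_mono; simp)+
  have "1 / real m * ((nrm Vx)\<^sup>2 - J) \<le> 1 / real m * ((2 * B)\<^sup>2 + 4 * B^3)"
    using im V2 J' by (intro mult_left_mono) auto
  also have "\<dots> \<le> 1 * ((2 * B)\<^sup>2 + 4 * B^3)" using im B_nonneg by (intro mult_right_mono) auto
  finally show "energy \<le> 8 * B\<^sup>2 + 4 * B^3" using V2 by (simp add: energy_def)
qed

end

section \<open>The energy inequality\<close>

text \<open>
\<open>U\<close> and \<open>W\<close> are the time derivatives of the two solutions at the instant considered, as functionals.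
\<close>

locale galerkin = galerkin_pair +
  fixes \<gamma> \<mu> :: real and f :: "real \<Rightarrow> real" and U W :: "(real \<Rightarrow> real) \<Rightarrow> real"
  assumes \<mu>: "\<mu> > 0" and f: "square_integrable f"
    and Ueq: "\<And>\<phi>. \<phi> \<in> Hdot L 1 \<Longrightarrow> U \<phi> + ip (\<lambda>x. u x * weak_deriv L u x) \<phi>
          + (- ip (weak_deriv L (weak_deriv L u)) (weak_deriv L \<phi>)) + \<gamma> * ip u \<phi> = ip f \<phi>"
    and Weq: "\<And>\<phi>. \<phi> \<in> Hdot L 1 \<Longrightarrow> W \<phi> + ip (\<lambda>x. w x * weak_deriv L w x) \<phi>
          + (- ip (weak_deriv L (weak_deriv L w)) (weak_deriv L \<phi>)) + \<gamma> * ip w \<phi>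
          = ip (\<lambda>x. f x - \<mu> * (proj L m w x - proj L m u x)) \<phi>"
begin

text \<open>
The truncated equation for the difference: after subtraction the nonlinearity becomes \<open>(A V)_x\<close>, and together with the
dispersion it is the derivative of the flux \<open>V_xx + A V\<close>. Every linear term sees only the truncation.
\<close>

lemma tested_difference:
  "W (trig N c) - U (trig N c) = ip (\<lambda>x. Vxx x + A x * V x) (trig N (dcoef c))
     - \<gamma> * ip V (trig N c) - \<mu> * ip P (trig N c) - err c"
proof -
  note du = controlledD[OF cu] and dw = controlledD[OF cw]
  let ?p = "trig N c" and ?px = "trig N (dcoef c)"
  let ?u = "trunc N u" and ?w = "trunc N w"
  let ?ux = "trig N (dcoef (coef u))" and ?wx = "trig N (dcoef (coef w))"
  have Vc: "V x = ?w x - ?u x" and Ac: "A x = (?u x + ?w x) / 2" for x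
    unfolding z_def[abs_def] a_def[abs_def] using trig_scale[of "1/2" N "\<lambda>k. coef u k + coef w k" x]
    by (simp_all add: trig_diff[symmetric] trig_add[symmetric])
  have dz: "dcoef z = (\<lambda>k. dcoef (coef w) k - dcoef (coef u) k)"
    by (auto simp: dcoef_def z_def algebra_simps)
  have da: "dcoef a = (\<lambda>k. 1/2 * (dcoef (coef w) k + dcoef (coef u) k))"
    by (auto simp: dcoef_def a_def field_simps)
  have Vxc: "Vx x = ?wx x - ?ux x" and Axc: "Ax x = (?wx x + ?ux x) / 2" for x
    unfolding dz da trig_diff[symmetric] trig_scale[symmetric] trig_add[symmetric] by simp_all
  have ddz: "dcoef (dcoef z) = (\<lambda>k. dcoef (dcoef (coef w)) k - dcoef (dcoef (coef u)) k)"
    by (auto simp: dcoef_def z_def algebra_simps)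
  have Vxxc: "Vxx x = trig N (dcoef (dcoef (coef w))) x - trig N (dcoef (dcoef (coef u))) x" for x
    unfolding ddz trig_diff[symmetric] ..
  have Pc: "P = (\<lambda>x. proj L m w x - proj L m u x)"
    by (simp add: fun_eq_iff proj_eq_trunc du dw trig_diff) (simp add: z_def[abs_def])
  have U: "U ?p = ip f ?p - ip (\<lambda>x. u x * wd u x) ?p + ip (wd (wd u)) ?px - \<gamma> * ip u ?p"
    using Ueq[OF trig_Hdot_1, of N c] by (simp add: ip_weak_deriv_trig du)
  have W: "W ?p = ip f ?p - \<mu> * ip P ?p - ip (\<lambda>x. w x * wd w x) ?p + ip (wd (wd w)) ?px - \<gamma> * ip w ?p"
  proof -
    have "ip (\<lambda>x. f x - \<mu> * (proj L m w x - proj L m u x)) ?p = ip f ?p - \<mu> * ip P ?p"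
      unfolding Pc[symmetric] fun_cong[OF Pc, symmetric]
      by (simp add: ip_diff_left f square_integrable_scale trig_square_integrable ip_scale_left)
    then show ?thesis using Weq[OF trig_Hdot_1, of N c] by (simp add: ip_weak_deriv_trig dw)
  qed
  have lin: "ip w ?p - ip u ?p = ip V ?p"
  proof -
    have "ip V ?p = ip ?w ?p - ip ?u ?p"
      unfolding Vc[abs_def] by (simp add: ip_diff_left trig_square_integrable)
    then show ?thesis by (simp add: ip_trunc du dw)
  qed
  have disp: "ip (wd (wd w)) ?px - ip (wd (wd u)) ?px = ip Vxx ?px"
  proof -
    have "ip Vxx ?px = ip (trunc N (wd (wd w))) ?px - ip (trunc N (wd (wd u))) ?px"
      unfolding Vxxc[abs_def] du(12) dw(12) by (intro ip_diff_left trig_square_integrable)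
    then show ?thesis by (simp only: ip_trunc[OF du(4)] ip_trunc[OF dw(4)])
  qed
  have nl: "ip (\<lambda>x. w x * wd w x) ?p - ip (\<lambda>x. u x * wd u x) ?p = err c - ip (\<lambda>x. A x * V x) ?px"
  proof -
    have "ip (\<lambda>x. ?w x * ?wx x) ?p - ip (\<lambda>x. ?u x * ?ux x) ?p = ip (\<lambda>x. ?w x * ?wx x - ?u x * ?ux x) ?p"
      by (intro ip_diff_left[symmetric] square_integrable_intros)
    also have "(\<lambda>x. ?w x * ?wx x - ?u x * ?ux x) = (\<lambda>x. Ax x * V x + A x * Vx x)"
      by (auto simp: Vc Ac Vxc Axc field_simps)
    also have "ip (\<lambda>x. Ax x * V x + A x * Vx x) ?p = - ip (\<lambda>x. A x * V x) ?px"
    proof -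
      have "ip (\<lambda>x. A x * V x) ?px = - ip (\<lambda>x. Ax x * V x + A x * Vx x) ?p"
        using trig_per[of N a 0] trig_per[of N z 0] trig_per[of N c 0]
        by (intro periodic_by_parts) (auto intro!: derivative_eq_intros trig_deriv continuous_intros trig_cont)
      then show ?thesis by simp
    qed
    finally show ?thesis by (simp add: advection_error_def)
  qed
  have split: "ip (\<lambda>x. Vxx x + A x * V x) ?px = ip Vxx ?px + ip (\<lambda>x. A x * V x) ?px"
    by (intro ip_add_left square_integrable_intros)
  have "\<gamma> * ip w ?p - \<gamma> * ip u ?p = \<gamma> * ip V ?p" using lin by (simp add: right_diff_distrib[symmetric])
  then show ?thesis unfolding split U W using disp nl by linarith
qed

text \<open>
The dispersive term vanishes, and since \<open>A_x = u_x + V_x / 2\<close> on truncations, where \<open>V_x V\<^sup>2\<close> integrates to zero, the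
nonlinearity leaves only \<open>u_x V\<^sup>2\<close>.
\<close>

lemma tested_energy:
  "W V - U V = - (1/2) * ip (\<lambda>x. trig N (dcoef (coef u)) x * V x) V
     - \<gamma> * (nrm V)\<^sup>2 - \<mu> * (nrm P)\<^sup>2 - err z"
proof -
  let ?ux = "trig N (dcoef (coef u))"
  have "ip (\<lambda>x. Vxx x + A x * V x) Vx = ip (\<lambda>x. A x * V x) Vx"
    using ip_by_parts_zero[of "dcoef z"] ip_commute[of Vx Vxx] by (simp add: ip_add_left square_integrable_intros)
  also have "\<dots> = - (1/2) * ip (\<lambda>x. ?ux x * V x) V"
  proof -
    have Ax: "Ax x = ?ux x + Vx x / 2" for x
    proof -
      have da: "dcoef a = (\<lambda>k. dcoef (coef u) k + 1/2 * dcoef z k)"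
        by (auto simp: dcoef_def a_def z_def field_simps)
      show ?thesis unfolding da trig_add[symmetric] trig_scale[symmetric] by simp
    qed
    have "(LINT x|leb. Ax x * V x * V x + A x * (2 * V x * Vx x) - V x * V x * Vx x / 2) = 0"
      \<comment> \<open>The cubic term accounts for the part \<open>V_x / 2\<close> of \<open>A_x\<close>.\<close>
      by (rule LINT_periodic_derivative[of "\<lambda>x. A x * (V x)\<^sup>2 - (V x)^3 / 6"])
         (use trig_per[of N a 0] trig_per[of N z 0] in \<open>auto intro!: derivative_eq_intros trig_deriv continuous_intros trig_cont
           simp: power2_eq_square power3_eq_cube\<close>)
    also have "(\<lambda>x. Ax x * V x * V x + A x * (2 * V x * Vx x) - V x * V x * Vx x / 2)
        = (\<lambda>x. ?ux x * V x * V x + 2 * (A x * V x * Vx x))"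
      by (auto simp: Ax field_simps)
    also have "(LINT x|leb. ?ux x * V x * V x + 2 * (A x * V x * Vx x))
        = ip (\<lambda>x. ?ux x * V x) V + 2 * ip (\<lambda>x. A x * V x) Vx"
      unfolding L2_inner_def
      by (subst Bochner_Integration.integral_add)
         (auto intro!: square_integrable_integrable square_integrable_cont continuous_intros trig_cont)
    finally show ?thesis by simp
  qed
  finally show ?thesis
    using tested_difference[of z] by (simp add: ip_P_V nrm_sq)
qed

text \<open>
The flux is paired with the derivative of the test function, which is a polynomial of degree \<open>N\<close>. Hence the flux may be
truncated, becoming the test function itself, and a periodic function is orthogonal to its own
derivative. This cancellation removes all terms without a definite sign except those of lower order.
\<close>

lemma tested_H1:
  "W (trig N q) - U (trig N q) = \<gamma> * ((nrm Vx)\<^sup>2 - J)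
     + \<mu> * ((nrm (trig m (dcoef z)))\<^sup>2 - ip (\<lambda>x. A x * V x) P) - err q"
proof -
  have sAV: "square_integrable (\<lambda>x. A x * V x)" by (rule square_integrable_intros)
  have s: "square_integrable (\<lambda>x. Vxx x + A x * V x)" by (intro square_integrable_add square_integrable_intros)
  have 0: "ip (\<lambda>x. Vxx x + A x * V x) (trig N (dcoef q)) = 0"
    using ip_trunc[OF s, of N "dcoef q"] ip_by_parts_zero[of q] by (simp add: trig_q)
  have VVxx: "ip V Vxx = - (nrm Vx)\<^sup>2"
    using periodic_by_parts[of V Vx Vx Vxx] trig_per[of N z 0] trig_per[of N "dcoef z" 0]
    by (auto simp: trig_deriv trig_cont nrm_sq)
  have "ip V (trig N q) = ip V (\<lambda>x. Vxx x + A x * V x)"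
    unfolding trig_q using ip_trunc[OF s, of N z] by (simp add: ip_commute)
  also have "\<dots> = - (nrm Vx)\<^sup>2 + J"
    unfolding J_def by (simp add: ip_add_right square_integrable_intros VVxx ip_commute)
  finally have 1: "ip V (trig N q) = - (nrm Vx)\<^sup>2 + J" .
  have "ip P (trig N q) = ip P (\<lambda>x. Vxx x + A x * V x)"
    unfolding trig_q trig_extend[OF mN, of z] using ip_trunc[OF s, of N] by (simp add: ip_commute)
  also have "\<dots> = - (nrm (trig m (dcoef z)))\<^sup>2 + ip (\<lambda>x. A x * V x) P"
    by (simp add: ip_add_right square_integrable_intros ip_nrm_Px ip_commute)
  finally have 2: "ip P (trig N q) = - (nrm (trig m (dcoef z)))\<^sup>2 + ip (\<lambda>x. A x * V x) P" .
  show ?thesis using tested_difference[of q] unfolding 0 1 2 by (simp add: algebra_simps)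
qed
text \<open>
The time derivative of the energy. Since \<open>- 2 (W - U) (V_xx + P_N (A V))\<close> contains the contributions of both
factors \<open>V\<close> in \<open>|V_x|\<^sup>2 - \<integral> A V\<^sup>2\<close>, only the contribution of the factor \<open>A\<close> is added separately.
\<close>

definition "energy_rate = 2 * (W V - U V) + 1 / real m * (- 2 * (W (trig N q) - U (trig N q))
   - (U (trunc N (\<lambda>x. V x * V x)) + W (trunc N (\<lambda>x. V x * V x))) / 2)"

lemma energy_inequality:
  assumes \<gamma>: "\<gamma> > 0" and m: "m > 0"
    and Ri: "\<And>x. x \<in> {0..L} \<Longrightarrow> \<bar>u x\<bar> \<le> Ri" "\<And>x. x \<in> {0..L} \<Longrightarrow> \<bar>w x\<bar> \<le> Ri"
    and R': "\<And>c. \<bar>U (trig N c)\<bar> \<le> R' * nrm (trig N (dcoef c))" "\<And>c. \<bar>W (trig N c)\<bar> \<le> R' * nrm (trig N (dcoef c))"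
    and R'0: "0 \<le> R'"
    and R10: "nrm (wd u) \<le> R1_0" and R20: "nrm (wd (wd u)) \<le> R2_0"
    and C3: "sqrt (R1_0 * R2_0) \<le> \<mu>" "sqrt (R1_0 * R2_0) * (tail m)\<^sup>2 \<le> \<gamma> / (2 * real m)"
    and large: "1 / real m * ((\<gamma> + 2 * \<mu>) * Ri + 2 * R'^4 * \<gamma> powi (-3)) \<le> \<gamma> / 2"
  shows "energy_rate \<le> - (\<gamma> / 2) * energy + residual B \<gamma> \<mu> * tail N"
proof -
  let ?C3 = "sqrt (R1_0 * R2_0)" and ?ux = "trig N (dcoef (coef u))"
  note du = controlledD[OF cu]
  have Ri0: "0 \<le> Ri" using Ri(1)[of 0] L_pos by auto
  have r: "0 \<le> R1_0" "0 \<le> R2_0" using R10 R20 nrm_nonneg order_trans by blast+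
  have K0: "0 \<le> 2 * R'^4 * \<gamma> powi (-3)" using \<gamma> by (simp add: zero_le_power_int)
  have ux: "\<bar>?ux x\<bar> \<le> ?C3" if "x \<in> {0..L}" for x
    using agmon_bound[OF that, of N "dcoef (coef u)" R1_0 R2_0]
      nrm_trunc_le[OF du(3), of N] nrm_trunc_le[OF du(4), of N] R10 R20 by (simp add: du)
  have "\<bar>ip (\<lambda>x. ?ux x * V x) V\<bar> \<le> nrm (\<lambda>x. ?ux x * V x) * nrm V"
    by (intro cauchy_schwarz square_integrable_intros)
  also have "\<dots> \<le> (?C3 * nrm V) * nrm V"
    by (intro mult_right_mono square_integrable_bounded_mult(2) trig_square_integrable square_integrable_measurable ux nrm_nonneg)
  finally have dVb: "\<bar>ip (\<lambda>x. ?ux x * V x) V\<bar> \<le> ?C3 * (nrm V)\<^sup>2" by (simp add: power2_eq_square mult.assoc)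
  have J: "\<bar>J\<bar> \<le> Ri * (nrm V)\<^sup>2 + 4 * B^3 * tail N"
    unfolding J_def by (rule AV_pairing[OF Ri trig_square_integrable]) simp_all
  have I: "\<bar>ip (\<lambda>x. A x * V x) P\<bar> \<le> Ri * (nrm V)\<^sup>2 + 4 * B^3 * tail N"
    by (rule AV_pairing[OF Ri trig_square_integrable P_split(2)])
  let ?s = "coef (\<lambda>x. V x * V x)"
  have "\<bar>(U (trig N ?s) + W (trig N ?s)) / 2\<bar> \<le> R' * nrm (trig N (dcoef ?s))"
  proof -
    have "\<bar>U (trig N ?s) + W (trig N ?s)\<bar> \<le> 2 * (R' * nrm (trig N (dcoef ?s)))"
      using R'(1)[of ?s] R'(2)[of ?s] by linarith
    then show ?thesis by simp
  qed
  also have "\<dots> \<le> R' * (2 * sqrt (nrm V * nrm Vx) * nrm Vx)"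
    by (rule mult_left_mono[OF nrm_deriv_square R'0])
  also have "\<dots> \<le> \<gamma> * (nrm Vx)\<^sup>2 + 2 * R'^4 * \<gamma> powi (-3) * (nrm V)\<^sup>2"
    using young_quarter[OF \<gamma> R'0 nrm_nonneg nrm_nonneg refl, of V Vx] by (simp add: mult_ac)
  finally have \<alpha>: "\<bar>(U (trig N ?s) + W (trig N ?s)) / 2\<bar> \<le> \<gamma> * (nrm Vx)\<^sup>2 + 2 * R'^4 * \<gamma> powi (-3) * (nrm V)\<^sup>2" .
  have t0: "0 \<le> tail N" by (rule tail_nonneg)
  have e1: "\<bar>err z\<bar> \<le> 8 * B^3 * tail N"
  proof -
    have "4 * B\<^sup>2 * tail N * nrm V \<le> 4 * B\<^sup>2 * tail N * (2 * B)"
      using t0 by (intro mult_left_mono difference_bounds(1)) auto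
    then show ?thesis using err_bound[of z] by (simp add: power2_eq_square power3_eq_cube algebra_simps)
  qed
  have e2: "\<bar>err q\<bar> \<le> (8 * B^3 + 8 * B^4) * tail N"
  proof -
    have "4 * B\<^sup>2 * tail N * nrm (trig N q) \<le> 4 * B\<^sup>2 * tail N * (2 * B + 2 * B\<^sup>2)"
      using t0 by (intro mult_left_mono nrm_q) auto
    then show ?thesis using err_bound[of q] by (simp add: power2_eq_square power3_eq_cube power4_eq_xxxx algebra_simps)
  qed
  have "energy_rate \<le> - (\<gamma> / 2) * energy + (2 * (8 * B^3 * tail N) + 1 / real m *
      (2 * ((8 * B^3 + 8 * B^4) * tail N) + (3/2 * \<gamma> + 2 * \<mu>) * (4 * B^3 * tail N)))"
    unfolding energy_rate_def energy_def
  proof (rule decay_algebra[where p = "nrm P" and xq = "nrm (\<lambda>x. V x - P x)" and t = "tail m" and ?C3.0 = ?C3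
        and Ri = Ri and K = "2 * R'^4 * \<gamma> powi (-3)" and I = "ip (\<lambda>x. A x * V x) P"])
    show "W V - U V \<le> ?C3 / 2 * (nrm V)\<^sup>2 - \<gamma> * (nrm V)\<^sup>2 - \<mu> * (nrm P)\<^sup>2 + 8 * B^3 * tail N"
      unfolding tested_energy using dVb e1 by linarith
    have "0 \<le> \<mu> * (nrm (trig m (dcoef z)))\<^sup>2" using \<mu> by simp
    then show "\<gamma> * ((nrm Vx)\<^sup>2 - J) - \<mu> * ip (\<lambda>x. A x * V x) P - (8 * B^3 + 8 * B^4) * tail N \<le> W (trig N q) - U (trig N q)"
      unfolding tested_H1 right_diff_distrib[of \<mu>] using e2 by linarith
    show "- ((U (trig N ?s) + W (trig N ?s)) / 2) \<le> \<gamma> * (nrm Vx)\<^sup>2 + 2 * R'^4 * \<gamma> powi (-3) * (nrm V)\<^sup>2"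
      using abs_le_D2[OF \<alpha>] .
    show "(nrm V)\<^sup>2 = (nrm P)\<^sup>2 + (nrm (\<lambda>x. V x - P x))\<^sup>2" by (rule P_split)
  qed (use \<gamma> \<mu> m Ri0 r K0 nrm_nonneg P_split(3) C3 large abs_le_D1[OF J] abs_le_D1[OF I] in simp_all)
  also have "2 * (8 * B^3 * tail N) + 1 / real m *
      (2 * ((8 * B^3 + 8 * B^4) * tail N) + (3/2 * \<gamma> + 2 * \<mu>) * (4 * B^3 * tail N))
     \<le> 2 * (8 * B^3 * tail N) + 1 * (2 * ((8 * B^3 + 8 * B^4) * tail N) + (3/2 * \<gamma> + 2 * \<mu>) * (4 * B^3 * tail N))"
    using m \<gamma> \<mu> B_nonneg t0 by (intro add_left_mono mult_right_mono) auto
  also have "\<dots> = residual B \<gamma> \<mu> * tail N" by (simp add: residual_def algebra_simps)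
  finally show "energy_rate \<le> - (\<gamma> / 2) * energy + residual B \<gamma> \<mu> * tail N" by simp
qed

end

section \<open>Lipschitz primitives and the Gronwall inequality\<close>

text \<open>
\<open>x\<close> is a primitive of the bounded measurable function \<open>y\<close> on \<open>{a..b}\<close>. This is the form in which a time
derivative that exists only almost everywhere is given, and it is stable under products.
\<close>

definition lipschitz_primitive :: "real \<Rightarrow> real \<Rightarrow> (real \<Rightarrow> real) \<Rightarrow> (real \<Rightarrow> real) \<Rightarrow> bool" where
  "lipschitz_primitive a b x y \<longleftrightarrow> y \<in> borel_measurable (lebesgue_on {a..b}) \<and>
     (\<exists>M. AE s in lebesgue_on {a..b}. \<bar>y s\<bar> \<le> M) \<and>
     (\<forall>s t. a \<le> s \<and> s \<le> t \<and> t \<le> b \<longrightarrow> x t - x s = (LINT r|lebesgue_on {s..t}. y r))"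

lemma AE_lebesgue_on_subset:
  assumes "AE x in lebesgue_on T. P x" "S \<subseteq> T" "S \<in> sets lebesgue" "T \<in> sets lebesgue"
  shows "AE x in lebesgue_on S. P x"
  using assms by (auto simp: AE_restrict_space_iff elim: eventually_mono)

lemma integrable_bounded_interval:
  fixes y :: "real \<Rightarrow> real"
  assumes "y \<in> borel_measurable (lebesgue_on {a..b})" "AE s in lebesgue_on {a..b}. \<bar>y s\<bar> \<le> M"
  shows "integrable (lebesgue_on {a..b}) y"
  using assms by (intro finite_measure.integrable_const_bound[where B = M] finite_measure_lebesgue_on) auto

lemma lipschitz_primitive_integrable:
  assumes "lipschitz_primitive a b x y" "a \<le> s" "t \<le> b"
  shows "integrable (lebesgue_on {s..t}) y"
proof -
  have "integrable (lebesgue_on {a..b}) y"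
    using assms(1) integrable_bounded_interval unfolding lipschitz_primitive_def by blast
  then show ?thesis by (rule integrable_subinterval) (use assms in auto)
qed

lemma LINT_bound:
  fixes y :: "real \<Rightarrow> real"
  assumes "integrable (lebesgue_on {s..t}) y" "AE r in lebesgue_on {s..t}. \<bar>y r\<bar> \<le> M" "s \<le> t"
  shows "\<bar>LINT r|lebesgue_on {s..t}. y r\<bar> \<le> M * (t - s)"
proof -
  have "\<bar>LINT r|lebesgue_on {s..t}. y r\<bar> \<le> (LINT r|lebesgue_on {s..t}. \<bar>y r\<bar>)"
    by (rule integral_abs_bound)
  also have "\<dots> \<le> (LINT r|lebesgue_on {s..t}. M)"
    using assms(1,2) by (intro integral_mono_AE) auto
  also have "\<dots> = M * (t - s)" using assms(3) by (simp add: measure_restrict_space)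
  finally show ?thesis .
qed

lemma lipschitz_primitive_bounds:
  assumes x: "lipschitz_primitive a b x y"
  obtains M where "0 \<le> M" "AE s in lebesgue_on {a..b}. \<bar>y s\<bar> \<le> M"
    "\<And>s t. a \<le> s \<Longrightarrow> s \<le> t \<Longrightarrow> t \<le> b \<Longrightarrow> \<bar>x t - x s\<bar> \<le> M * (t - s)"
    "continuous_on {a..b} x" "\<And>s. s \<in> {a..b} \<Longrightarrow> \<bar>x s\<bar> \<le> M"
proof -
  obtain M0 where M0: "AE s in lebesgue_on {a..b}. \<bar>y s\<bar> \<le> M0" using x unfolding lipschitz_primitive_def by blast
  have lip: "\<bar>x t - x s\<bar> \<le> \<bar>M0\<bar> * (t - s)" if "a \<le> s" "s \<le> t" "t \<le> b" for s t
  proof -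
    have "AE r in lebesgue_on {s..t}. \<bar>y r\<bar> \<le> \<bar>M0\<bar>"
      by (rule AE_lebesgue_on_subset[where T = "{a..b}"]) (use M0 that in \<open>auto elim: eventually_mono\<close>)
    then have "\<bar>LINT r|lebesgue_on {s..t}. y r\<bar> \<le> \<bar>M0\<bar> * (t - s)"
      using that by (intro LINT_bound lipschitz_primitive_integrable[OF x]) auto
    then show ?thesis using x that unfolding lipschitz_primitive_def by simp
  qed
  have "\<bar>M0\<bar>-lipschitz_on {a..b} x"
  proof (rule lipschitz_onI)
    fix s t assume "s \<in> {a..b}" "t \<in> {a..b}"
    then show "dist (x s) (x t) \<le> \<bar>M0\<bar> * dist s t"
      using lip[of s t] lip[of t s] by (cases "s \<le> t") (auto simp: dist_real_def abs_minus_commute)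
  qed simp
  then have cont: "continuous_on {a..b} x" by (rule lipschitz_on_continuous_on)
  then have "bounded (x ` {a..b})" by (intro compact_imp_bounded compact_continuous_image) auto
  then have "\<exists>K. \<forall>s\<in>{a..b}. \<bar>x s\<bar> \<le> K" by (simp add: bounded_iff)
  then obtain K where K: "\<And>s. s \<in> {a..b} \<Longrightarrow> \<bar>x s\<bar> \<le> K" by blast
  define M where "M = max \<bar>M0\<bar> K"
  have M: "0 \<le> M" "\<bar>M0\<bar> \<le> M" "K \<le> M" by (auto simp: M_def)
  have "AE s in lebesgue_on {a..b}. \<bar>y s\<bar> \<le> M" using M0 by eventually_elim (use M in linarith)
  moreover have "\<bar>x t - x s\<bar> \<le> M * (t - s)" if "a \<le> s" "s \<le> t" "t \<le> b" for s t
    using lip[OF that] mult_right_mono[OF M(2), of "t - s"] that by linarith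
  ultimately show ?thesis using that[of M] M K cont by force
qed

lemma lipschitz_primitive_const: "lipschitz_primitive a b (\<lambda>_. c) (\<lambda>_. 0)"
  by (auto simp: lipschitz_primitive_def)

lemma lipschitz_primitive_add:
  assumes "lipschitz_primitive a b x1 y1" "lipschitz_primitive a b x2 y2"
  shows "lipschitz_primitive a b (\<lambda>s. x1 s + x2 s) (\<lambda>s. y1 s + y2 s)"
proof -
  obtain M1 M2 where M: "AE s in lebesgue_on {a..b}. \<bar>y1 s\<bar> \<le> M1" "AE s in lebesgue_on {a..b}. \<bar>y2 s\<bar> \<le> M2"
    using assms unfolding lipschitz_primitive_def by blast
  from M have "AE s in lebesgue_on {a..b}. \<bar>y1 s + y2 s\<bar> \<le> M1 + M2" by eventually_elim linarith
  moreover have "(x1 t + x2 t) - (x1 s + x2 s) = (LINT r|lebesgue_on {s..t}. y1 r + y2 r)"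
    if "a \<le> s" "s \<le> t" "t \<le> b" for s t
    using assms lipschitz_primitive_integrable[OF assms(1) that(1,3)] lipschitz_primitive_integrable[OF assms(2) that(1,3)] that
    unfolding lipschitz_primitive_def by (subst Bochner_Integration.integral_add) (auto simp: algebra_simps)
  ultimately show ?thesis using assms unfolding lipschitz_primitive_def by auto
qed

lemma lipschitz_primitive_scale:
  assumes "lipschitz_primitive a b x y"
  shows "lipschitz_primitive a b (\<lambda>s. c * x s) (\<lambda>s. c * y s)"
proof -
  obtain M where M: "AE s in lebesgue_on {a..b}. \<bar>y s\<bar> \<le> M"
    using assms unfolding lipschitz_primitive_def by blast
  then have "AE s in lebesgue_on {a..b}. \<bar>c * y s\<bar> \<le> \<bar>c\<bar> * M"
    by eventually_elim (simp add: abs_mult mult_left_mono)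
  then show ?thesis using assms unfolding lipschitz_primitive_def
    by (auto simp: right_diff_distrib[symmetric])
qed

lemma lipschitz_primitive_diff:
  assumes "lipschitz_primitive a b x1 y1" "lipschitz_primitive a b x2 y2"
  shows "lipschitz_primitive a b (\<lambda>s. x1 s - x2 s) (\<lambda>s. y1 s - y2 s)"
  using lipschitz_primitive_add[OF assms(1) lipschitz_primitive_scale[OF assms(2), of "-1"]] by simp

lemma lipschitz_primitive_sum:
  assumes "\<And>i. i \<in> I \<Longrightarrow> lipschitz_primitive a b (x i) (y i)"
  shows "lipschitz_primitive a b (\<lambda>s. \<Sum>i\<in>I. x i s) (\<lambda>s. \<Sum>i\<in>I. y i s)"
  using assms
  by (induction I rule: infinite_finite_induct) (auto intro: lipschitz_primitive_const lipschitz_primitive_add)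

text \<open>
Quadratic increments force the derivative to vanish at every point, not only almost everywhere.
\<close>

lemma quadratic_increments_imp_constant:
  fixes D :: "real \<Rightarrow> real"
  assumes D: "\<And>s t. a \<le> s \<Longrightarrow> s \<le> t \<Longrightarrow> t \<le> b \<Longrightarrow> \<bar>D t - D s\<bar> \<le> C * (t - s)\<^sup>2"
    and "s \<in> {a..b}" "t \<in> {a..b}"
  shows "D s = D t"
proof -
  have "(D has_field_derivative 0) (at x within {a..b})" if x: "x \<in> {a..b}" for x
    unfolding has_field_derivative_iff
  proof (rule Lim_null_comparison)
    have "norm ((D y - D x) / (y - x)) \<le> C * \<bar>y - x\<bar>" if "y \<in> {a..b}" "y \<noteq> x" for y
    proof -
      have "\<bar>D y - D x\<bar> \<le> C * (y - x)\<^sup>2"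
        using D[of x y] D[of y x] x that by (cases "x \<le> y") (auto simp: abs_minus_commute power2_commute)
      also have "\<dots> = C * \<bar>y - x\<bar> * \<bar>y - x\<bar>" by (simp add: power2_eq_square)
      finally show ?thesis using that by (simp add: pos_divide_le_eq)
    qed
    then show "\<forall>\<^sub>F y in at x within {a..b}. norm ((D y - D x) / (y - x)) \<le> C * \<bar>y - x\<bar>"
      by (auto simp: eventually_at_filter)
    have "((\<lambda>y. C * \<bar>y - x\<bar>) \<longlongrightarrow> C * \<bar>x - x\<bar>) (at x within {a..b})" by (intro tendsto_intros)
    then show "((\<lambda>y. C * \<bar>y - x\<bar>) \<longlongrightarrow> 0) (at x within {a..b})" by simp
  qed
  from has_field_derivative_zero_constant[OF _ this] show ?thesis using assms(2,3) by auto
qed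

text \<open>
The defect in the product rule is additive over intervals, and on an interval of length \<open>h\<close> it is \<open>O(h\<^sup>2)\<close> because
both factors are Lipschitz; so it vanishes.
\<close>

lemma lipschitz_primitive_mult:
  assumes 1: "lipschitz_primitive a b x1 y1" and 2: "lipschitz_primitive a b x2 y2"
  shows "lipschitz_primitive a b (\<lambda>s. x1 s * x2 s) (\<lambda>s. y1 s * x2 s + x1 s * y2 s)"
proof -
  obtain M where M0: "0 \<le> M" and M: "AE s in lebesgue_on {a..b}. \<bar>y1 s\<bar> \<le> M"
    and lip1: "\<And>s t. a \<le> s \<Longrightarrow> s \<le> t \<Longrightarrow> t \<le> b \<Longrightarrow> \<bar>x1 t - x1 s\<bar> \<le> M * (t - s)"
    and c1: "continuous_on {a..b} x1" and b1: "\<And>s. s \<in> {a..b} \<Longrightarrow> \<bar>x1 s\<bar> \<le> M"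
    using lipschitz_primitive_bounds[OF 1] by metis
  obtain K where K0: "0 \<le> K" and K: "AE s in lebesgue_on {a..b}. \<bar>y2 s\<bar> \<le> K"
    and lip2: "\<And>s t. a \<le> s \<Longrightarrow> s \<le> t \<Longrightarrow> t \<le> b \<Longrightarrow> \<bar>x2 t - x2 s\<bar> \<le> K * (t - s)"
    and c2: "continuous_on {a..b} x2" and b2: "\<And>s. s \<in> {a..b} \<Longrightarrow> \<bar>x2 s\<bar> \<le> K"
    using lipschitz_primitive_bounds[OF 2] by metis
  let ?y = "\<lambda>s. y1 s * x2 s + x1 s * y2 s"
  have ym: "y1 \<in> borel_measurable (lebesgue_on {a..b})" "y2 \<in> borel_measurable (lebesgue_on {a..b})"
    using 1 2 by (auto simp: lipschitz_primitive_def)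
  have xm: "x1 \<in> borel_measurable (lebesgue_on {a..b})" "x2 \<in> borel_measurable (lebesgue_on {a..b})"
    using c1 c2 by (auto intro: continuous_imp_measurable_on_sets_lebesgue)
  have meas: "?y \<in> borel_measurable (lebesgue_on {a..b})" using ym xm by measurable
  have sp: "AE s in lebesgue_on {a..b}. s \<in> {a..b}" by (rule AE_I2) simp
  have bnd: "AE s in lebesgue_on {a..b}. \<bar>?y s\<bar> \<le> M * K + M * K"
    using M K sp
  proof eventually_elim
    case (elim s)
    have "\<bar>y1 s * x2 s\<bar> \<le> M * K" "\<bar>x1 s * y2 s\<bar> \<le> M * K"
      unfolding abs_mult using elim b1 b2 M0 K0 by (auto intro!: mult_mono)
    then show ?case by linarith
  qed
  have int: "integrable (lebesgue_on {a..b}) ?y" by (rule integrable_bounded_interval[OF meas bnd])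
  have inc: "\<bar>x1 t * x2 t - x1 s * x2 s - (LINT r|lebesgue_on {s..t}. ?y r)\<bar> \<le> 2 * M * K * (t - s)\<^sup>2"
    if st: "a \<le> s" "s \<le> t" "t \<le> b" for s t
  proof -
    have i: "integrable (lebesgue_on {s..t}) ?y" using integrable_subinterval[OF int] st by auto
    have i1: "integrable (lebesgue_on {s..t}) y1" and i2: "integrable (lebesgue_on {s..t}) y2"
      using lipschitz_primitive_integrable 1 2 st by blast+
    have "x1 t * x2 t - x1 s * x2 s = (x1 t - x1 s) * x2 t + x1 s * (x2 t - x2 s)" by (simp add: algebra_simps)
    also have "\<dots> = (LINT r|lebesgue_on {s..t}. y1 r * x2 t) + (LINT r|lebesgue_on {s..t}. x1 s * y2 r)"
      using 1 2 st unfolding lipschitz_primitive_def by simp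
    finally have e: "x1 t * x2 t - x1 s * x2 s - (LINT r|lebesgue_on {s..t}. ?y r)
        = (LINT r|lebesgue_on {s..t}. y1 r * x2 t + x1 s * y2 r - ?y r)"
      using i i1 i2 by simp
    have "\<bar>LINT r|lebesgue_on {s..t}. y1 r * x2 t + x1 s * y2 r - ?y r\<bar> \<le> (2 * M * K * (t - s)) * (t - s)"
    proof (rule LINT_bound)
      have sub: "{s..t} \<subseteq> {a..b}" using st by auto
      have "AE r in lebesgue_on {s..t}. \<bar>y1 r\<bar> \<le> M" "AE r in lebesgue_on {s..t}. \<bar>y2 r\<bar> \<le> K"
        using M K AE_lebesgue_on_subset[OF _ sub] by auto
      moreover have "AE r in lebesgue_on {s..t}. r \<in> {s..t}" by (rule AE_I2) simp
      ultimately show "AE r in lebesgue_on {s..t}. \<bar>y1 r * x2 t + x1 s * y2 r - ?y r\<bar> \<le> 2 * M * K * (t - s)"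
      proof eventually_elim
        case (elim r)
        have "\<bar>x2 t - x2 r\<bar> \<le> K * (t - s)"
          using lip2[of r t] elim st K0 mult_left_mono[of "t - r" "t - s" K] by auto
        then have "\<bar>y1 r * (x2 t - x2 r)\<bar> \<le> M * (K * (t - s))"
          unfolding abs_mult using elim M0 by (intro mult_mono) auto
        moreover
        have "\<bar>x1 s - x1 r\<bar> \<le> M * (t - s)"
          using lip1[of s r] elim st M0 mult_left_mono[of "r - s" "t - s" M] by (auto simp: abs_minus_commute)
        then have "\<bar>(x1 s - x1 r) * y2 r\<bar> \<le> M * (t - s) * K"
          unfolding abs_mult using elim M0 st by (intro mult_mono) auto
        moreover have "y1 r * x2 t + x1 s * y2 r - ?y r = y1 r * (x2 t - x2 r) + (x1 s - x1 r) * y2 r"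
          by (simp add: algebra_simps)
        moreover have "2 * M * K * (t - s) = M * (K * (t - s)) + M * (t - s) * K"
          by (simp add: algebra_simps)
        ultimately show ?case by (simp only:)
      qed
    qed (use i i1 i2 st in auto)
    then show ?thesis unfolding e by (simp add: power2_eq_square mult.assoc)
  qed
  define D where "D t = x1 t * x2 t - (LINT r|lebesgue_on {a..t}. ?y r)" for t
  have comb: "(LINT r|lebesgue_on {a..t}. ?y r) = (LINT r|lebesgue_on {a..s}. ?y r) + (LINT r|lebesgue_on {s..t}. ?y r)"
    if "a \<le> s" "s \<le> t" "t \<le> b" for s t
    by (rule integral_combine) (use that integrable_subinterval[OF int] in auto)
  have Dst: "D t - D s = x1 t * x2 t - x1 s * x2 s - (LINT r|lebesgue_on {s..t}. ?y r)"
    if "a \<le> s" "s \<le> t" "t \<le> b" for s t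
    using comb[OF that] by (simp add: D_def)
  have "x1 t * x2 t - x1 s * x2 s = (LINT r|lebesgue_on {s..t}. ?y r)" if "a \<le> s" "s \<le> t" "t \<le> b" for s t
  proof -
    have "D s = D t"
      by (rule quadratic_increments_imp_constant[of a b D "2 * M * K"]) (use Dst inc that in auto)
    then show ?thesis using Dst[OF that] by simp
  qed
  then show ?thesis using meas bnd unfolding lipschitz_primitive_def by blast
qed

lemma lipschitz_primitive_exp: "lipschitz_primitive a b (\<lambda>s. exp (c * s)) (\<lambda>s. c * exp (c * s))"
  unfolding lipschitz_primitive_def
proof (intro conjI allI impI)
  have cont: "continuous_on S (\<lambda>s. c * exp (c * s))" for S by (intro continuous_intros)
  show "(\<lambda>s. c * exp (c * s)) \<in> borel_measurable (lebesgue_on {a..b})"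
    by (rule continuous_imp_measurable_on_sets_lebesgue[OF cont]) simp
  have "bounded ((\<lambda>s. c * exp (c * s)) ` {a..b})"
    by (intro compact_imp_bounded compact_continuous_image cont) simp
  then have "\<exists>K. \<forall>s\<in>{a..b}. \<bar>c * exp (c * s)\<bar> \<le> K" by (simp add: bounded_iff)
  then obtain K where "\<And>s. s \<in> {a..b} \<Longrightarrow> \<bar>c * exp (c * s)\<bar> \<le> K" by blast
  then show "\<exists>M. AE s in lebesgue_on {a..b}. \<bar>c * exp (c * s)\<bar> \<le> M" by (intro exI[of _ K] AE_I2) auto
  fix s t assume "a \<le> s \<and> s \<le> t \<and> t \<le> b"
  then show "exp (c * t) - exp (c * s) = (LINT r|lebesgue_on {s..t}. c * exp (c * r))"
    by (intro LINT_derivative[symmetric] cont) (auto intro!: derivative_eq_intros)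
qed

text \<open>
The product rule applied to \<open>exp (c s) (F s - \<epsilon> / c)\<close>.
\<close>

lemma gronwall:
  assumes F: "lipschitz_primitive a b F G" and ab: "a \<le> b" and c: "0 < c" and e: "0 \<le> \<epsilon>"
    and G: "AE s in lebesgue_on {a..b}. G s \<le> - c * F s + \<epsilon>"
  shows "F b \<le> exp (- c * (b - a)) * F a + \<epsilon> / c"
proof -
  let ?H = "\<lambda>s. F s - \<epsilon> / c"
  have H: "lipschitz_primitive a b ?H G"
    using lipschitz_primitive_diff[OF F lipschitz_primitive_const] by simp
  let ?P = "\<lambda>s. exp (c * s) * ?H s" and ?Q = "\<lambda>s. c * exp (c * s) * ?H s + exp (c * s) * G s"
  have P: "lipschitz_primitive a b ?P ?Q"
    by (rule lipschitz_primitive_mult[OF lipschitz_primitive_exp H])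
  have "?P b - ?P a = (LINT r|lebesgue_on {a..b}. ?Q r)"
    using P ab unfolding lipschitz_primitive_def by blast
  also have "\<dots> \<le> (LINT r|lebesgue_on {a..b}. 0)"
  proof (rule integral_mono_AE[OF lipschitz_primitive_integrable[OF P]])
    show "AE r in lebesgue_on {a..b}. ?Q r \<le> 0"
      using G
    proof eventually_elim
      case (elim r)
      have "?Q r = exp (c * r) * (G r + c * F r - \<epsilon>)" using c by (simp add: field_simps)
      then show ?case using elim by (simp add: mult_nonneg_nonpos)
    qed
  qed auto
  finally have le: "exp (c * b) * ?H b \<le> exp (c * a) * ?H a" by simp
  have "?H b = exp (- c * b) * (exp (c * b) * ?H b)" by (simp add: exp_minus)
  also have "\<dots> \<le> exp (- c * b) * (exp (c * a) * ?H a)" using le by (intro mult_left_mono) auto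
  also have "\<dots> = exp (- c * (b - a)) * ?H a"
  proof -
    have "exp (- c * b) * exp (c * a) = exp (- c * b + c * a)" by (rule exp_add[symmetric])
    also have "- c * b + c * a = - c * (b - a)" by (simp add: algebra_simps)
    finally show ?thesis by (simp only: mult.assoc[symmetric])
  qed
  also have "\<dots> \<le> exp (- c * (b - a)) * F a" using c e by (intro mult_left_mono) auto
  finally show ?thesis by simp
qed

section \<open>The evolution of the truncated energy\<close>

context period
begin

lemma hartley_eq_trig: "k \<in> modes N \<Longrightarrow> hartley k = trig N (\<lambda>j. if j = k then 1 else 0)"
  by (simp add: fun_eq_iff trig_def if_distrib[of "\<lambda>z. z * _"] sum.delta' cong: if_cong)

lemma dual_linear:
  assumes F: "F \<in> Hdot_dual L"
  shows "F (trig N c) = (\<Sum>k\<in>modes N. c k * F (hartley k))"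
proof -
  have lin: "F (\<lambda>x. r * \<phi> x + t * \<psi> x) = r * F \<phi> + t * F \<psi>" if "\<phi> \<in> Hdot L 1" "\<psi> \<in> Hdot L 1" for \<phi> \<psi> r t
    using F that by (simp add: Hdot_dual_def)
  have "F (trig N (\<lambda>k. if k \<in> S then c k else 0)) = (\<Sum>k\<in>S. c k * F (hartley k))" if "S \<subseteq> modes N" for S
    using finite_subset[OF that finite_modes] that
  proof (induction S rule: finite_induct)
    case empty
    have "F (\<lambda>x. 0 * trig N c x + 0 * trig N c x) = 0"
      using lin[OF trig_Hdot_1[of N c] trig_Hdot_1[of N c], of 0 0] by simp
    then show ?case by (simp add: trig_def[abs_def])
  next
    case (insert k S)
    have h: "hartley k \<in> Hdot L 1" using insert.prems hartley_eq_trig[of k N] trig_Hdot_1 by simp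
    have "trig N (\<lambda>j. if j \<in> insert k S then c j else 0) x = c k * hartley k x + 1 * trig N (\<lambda>j. if j \<in> S then c j else 0) x" for x
    proof -
      have "hartley k x = trig N (\<lambda>j. if j = k then 1 else 0) x" using insert.prems hartley_eq_trig[of k N] by simp
      then show ?thesis
        unfolding trig_scale \<open>hartley k x = _\<close> trig_add by (intro fun_cong[OF trig_cong]) (use insert.hyps in auto)
    qed
    then have "F (trig N (\<lambda>j. if j \<in> insert k S then c j else 0)) = c k * F (hartley k) + 1 * F (trig N (\<lambda>j. if j \<in> S then c j else 0))"
      using lin[OF h trig_Hdot_1, of "c k" 1] by presburger
    then show ?case using insert by simp
  qed
  from this[OF subset_refl] show ?thesis
    by (simp add: trig_cong[of N "\<lambda>k. if k \<in> modes N then c k else 0" c])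
qed

text \<open>
The dual norm is a supremum over the unit ball, so the polynomial is rescaled to unit norm; the
supremum is finite because the functional is bounded.
\<close>

lemma dual_bound:
  assumes F: "F \<in> Hdot_dual L"
  shows "\<bar>F (trig N c)\<bar> \<le> Hdot_dual_norm L F * nrm (trig N (dcoef c))"
proof -
  obtain B where B: "\<And>\<phi>. \<phi> \<in> Hdot L 1 \<Longrightarrow> \<bar>F \<phi>\<bar> \<le> B * Hdot_norm L 1 \<phi>"
    using F unfolding Hdot_dual_def by blast
  let ?h = "nrm (trig N (dcoef c))"
  show ?thesis
  proof (cases "?h = 0")
    case True
    then show ?thesis using B[OF trig_Hdot_1, of N c] by (simp add: Hdot_norm_1_trig[unfolded One_nat_def])
  next
    case False
    then have h: "0 < ?h" using nrm_nonneg[of "trig N (dcoef c)"] by linarith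
    let ?c = "\<lambda>k. (1 / ?h) * c k"
    have dc: "dcoef ?c = (\<lambda>k. (1 / ?h) * dcoef c k)" by (auto simp: dcoef_def)
    have n: "nrm (trig N (dcoef ?c)) = 1"
      unfolding dc using h nrm_scale[of "1 / ?h" "trig N (dcoef c)"] by (simp only: trig_scale) simp
    have "\<bar>F (trig N ?c)\<bar> \<le> Hdot_dual_norm L F"
      unfolding Hdot_dual_norm_def
    proof (rule cSUP_upper)
      show "trig N ?c \<in> {\<phi> \<in> Hdot L 1. Hdot_norm L 1 \<phi> \<le> 1}"
        using n trig_Hdot_1 Hdot_norm_1_trig[of N ?c] by simp
      have "\<bar>F \<phi>\<bar> \<le> \<bar>B\<bar>" if "\<phi> \<in> Hdot L 1" "Hdot_norm L 1 \<phi> \<le> 1" for \<phi>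
      proof -
        have "0 \<le> Hdot_norm L 1 \<phi>" by (simp only: Hdot_norms nrm_nonneg)
        then have "B * Hdot_norm L 1 \<phi> \<le> \<bar>B\<bar> * 1" using that by (intro mult_mono) auto
        then show ?thesis using B[OF that(1)] by simp
      qed
      then show "bdd_above ((\<lambda>\<phi>. \<bar>F \<phi>\<bar>) ` {\<phi> \<in> Hdot L 1. Hdot_norm L 1 \<phi> \<le> 1})" by (intro bdd_aboveI2) auto
    qed
    moreover have "F (trig N ?c) = F (trig N c) / ?h"
      by (simp add: dual_linear[OF F] sum_divide_distrib)
    ultimately show ?thesis using h by (simp add: pos_divide_le_eq)
  qed
qed

text \<open>
The coefficients of the cubic term of the energy; they are symmetric in the three indices.
\<close>

definition triple :: "int \<Rightarrow> int \<Rightarrow> int \<Rightarrow> real" where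
  "triple i j k = ip (\<lambda>x. hartley i x * hartley j x) (hartley k)"

lemma triple_swap: "triple i j k = triple j i k" "triple i j k = triple i k j"
  by (simp_all add: triple_def L2_inner_def mult_ac)

lemma hartley_product_square_integrable: "square_integrable (\<lambda>x. hartley i x * hartley j x)"
  by (intro square_integrable_cont continuous_intros hartley_cont)

lemma coef_trig_product:
  "coef (\<lambda>x. trig N c x * trig N d x) k = (\<Sum>i\<in>modes N. \<Sum>j\<in>modes N. c i * d j * triple i j k)"
proof -
  have "(\<lambda>x. trig N c x * trig N d x) = (\<lambda>x. \<Sum>i\<in>modes N. \<Sum>j\<in>modes N. (c i * d j) * (hartley i x * hartley j x))"
    by (simp add: trig_def sum_product mult_ac)
  then show ?thesis
    unfolding coef_def triple_def
    by (simp add: ip_sum_left square_integrable_sum square_integrable_scale hartley_product_square_integrable hartley_square_integrable ip_scale_left)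
qed

text \<open>
The energy as a polynomial in the coefficients \<open>a\<close> of the mean and \<open>z\<close> of the difference. The squares are
written as products so that the product rule applies verbatim.
\<close>

definition energy_poly :: "nat \<Rightarrow> nat \<Rightarrow> (int \<Rightarrow> real) \<Rightarrow> (int \<Rightarrow> real) \<Rightarrow> real" where
  "energy_poly m N a z = (\<Sum>k\<in>modes N. z k * z k) + 1 / real m * ((\<Sum>k\<in>modes N. (wavenum k)\<^sup>2 * (z k * z k))
     - (\<Sum>i\<in>modes N. \<Sum>j\<in>modes N. \<Sum>k\<in>modes N. triple i j k * (a i * (z j * z k))))"

definition energy_poly_rate :: "nat \<Rightarrow> nat \<Rightarrow> (int \<Rightarrow> real) \<Rightarrow> (int \<Rightarrow> real) \<Rightarrow> (int \<Rightarrow> real) \<Rightarrow> (int \<Rightarrow> real) \<Rightarrow> real" where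
  "energy_poly_rate m N a z a' z' = (\<Sum>k\<in>modes N. z' k * z k + z k * z' k)
     + 1 / real m * ((\<Sum>k\<in>modes N. (wavenum k)\<^sup>2 * (z' k * z k + z k * z' k))
     - (\<Sum>i\<in>modes N. \<Sum>j\<in>modes N. \<Sum>k\<in>modes N. triple i j k * (a' i * (z j * z k) + a i * (z' j * z k + z j * z' k))))"

lemma energy_poly_primitive:
  assumes "\<And>k. k \<in> modes N \<Longrightarrow> lipschitz_primitive p r (\<lambda>s. a s k) (\<lambda>s. a' s k)"
    and "\<And>k. k \<in> modes N \<Longrightarrow> lipschitz_primitive p r (\<lambda>s. z s k) (\<lambda>s. z' s k)"
  shows "lipschitz_primitive p r (\<lambda>s. energy_poly m N (a s) (z s)) (\<lambda>s. energy_poly_rate m N (a s) (z s) (a' s) (z' s))"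
  unfolding energy_poly_def energy_poly_rate_def
  by (intro lipschitz_primitive_add lipschitz_primitive_sum lipschitz_primitive_mult lipschitz_primitive_scale
       lipschitz_primitive_diff assms)

end

context galerkin_pair
begin

lemma J_expand: "J = (\<Sum>i\<in>modes N. \<Sum>j\<in>modes N. \<Sum>k\<in>modes N. triple i j k * (a i * (z j * z k)))"
proof -
  have "J = (\<Sum>k\<in>modes N. z k * (\<Sum>i\<in>modes N. \<Sum>j\<in>modes N. a i * z j * triple i j k))"
    unfolding J_def by (simp add: ip_trig square_integrable_intros coef_trig_product)
  also have "\<dots> = (\<Sum>k\<in>modes N. \<Sum>i\<in>modes N. \<Sum>j\<in>modes N. triple i j k * (a i * (z j * z k)))"
    by (simp add: sum_distrib_left mult_ac)
  also have "\<dots> = (\<Sum>i\<in>modes N. \<Sum>k\<in>modes N. \<Sum>j\<in>modes N. triple i j k * (a i * (z j * z k)))"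
    by (rule sum.swap)
  also have "\<dots> = (\<Sum>i\<in>modes N. \<Sum>j\<in>modes N. \<Sum>k\<in>modes N. triple i j k * (a i * (z j * z k)))"
    by (rule sum.cong[OF refl], rule sum.swap)
  finally show ?thesis .
qed

lemma energy_eq_poly: "energy = energy_poly m N a z"
proof -
  have "(nrm Vx)\<^sup>2 = (\<Sum>k\<in>modes N. (wavenum k)\<^sup>2 * (z k * z k))"
    unfolding nrm_sq ip_trig_trig
    by (subst sum_modes_uminus[symmetric]) (simp add: dcoef_def power2_eq_square mult_ac)
  then show ?thesis unfolding energy_def energy_poly_def J_expand nrm_sq[of V] ip_trig_trig by simp
qed

end

context galerkin
begin

text \<open>
Testing with a polynomial is the linear combination of the tests with basis functions. By the symmetry of \<open>triple\<close>
the two factors \<open>z\<close> of the cubic term contribute equally, which turns the sum into one test with \<open>P_N (A V)\<close>.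
\<close>

lemma energy_rate_eq_poly:
  assumes U: "U \<in> Hdot_dual L" and W: "W \<in> Hdot_dual L"
  shows "energy_rate = energy_poly_rate m N a z (\<lambda>k. (U (hartley k) + W (hartley k)) / 2) (\<lambda>k. W (hartley k) - U (hartley k))"
proof -
  let ?D = "\<lambda>k. W (hartley k) - U (hartley k)" and ?A = "\<lambda>k. (U (hartley k) + W (hartley k)) / 2"
  have D: "W (trig N c) - U (trig N c) = (\<Sum>k\<in>modes N. c k * ?D k)" for c
    by (simp add: dual_linear[OF U] dual_linear[OF W] sum_subtractf right_diff_distrib)
  have Av: "(U (trig N c) + W (trig N c)) / 2 = (\<Sum>k\<in>modes N. c k * ?A k)" for c
    by (simp add: dual_linear[OF U] dual_linear[OF W] sum.distrib distrib_left add_divide_distrib sum_divide_distrib)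
  let ?S = "\<lambda>F. \<Sum>i\<in>modes N. \<Sum>j\<in>modes N. \<Sum>k\<in>modes N. triple i j k * F i j k"
  have 1: "2 * (W V - U V) = (\<Sum>k\<in>modes N. ?D k * z k + z k * ?D k)"
    unfolding D sum_distrib_left by (simp add: mult_ac)
  have q: "q k = - ((wavenum k)\<^sup>2 * z k) + (\<Sum>i\<in>modes N. \<Sum>j\<in>modes N. a i * z j * triple i j k)" for k
    by (simp add: q_def dcoef_def coef_trig_product power2_eq_square)
  have 2: "- 2 * (W (trig N q) - U (trig N q)) = (\<Sum>k\<in>modes N. (wavenum k)\<^sup>2 * (?D k * z k + z k * ?D k))
      - 2 * (\<Sum>k\<in>modes N. \<Sum>i\<in>modes N. \<Sum>j\<in>modes N. triple i j k * (a i * (z j * ?D k)))"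
  proof -
    have "W (trig N q) - U (trig N q) = (\<Sum>k\<in>modes N. - ((wavenum k)\<^sup>2 * (z k * ?D k))
        + (\<Sum>i\<in>modes N. \<Sum>j\<in>modes N. triple i j k * (a i * (z j * ?D k))))"
      unfolding D
    proof (rule sum.cong[OF refl])
      fix k
      have "q k * ?D k = - ((wavenum k)\<^sup>2 * z k) * ?D k + (\<Sum>i\<in>modes N. \<Sum>j\<in>modes N. a i * z j * triple i j k * ?D k)"
        unfolding q distrib_right sum_distrib_right ..
      also have "- ((wavenum k)\<^sup>2 * z k) * ?D k = - ((wavenum k)\<^sup>2 * (z k * ?D k))" by simp
      also have "(\<Sum>i\<in>modes N. \<Sum>j\<in>modes N. a i * z j * triple i j k * ?D k)
          = (\<Sum>i\<in>modes N. \<Sum>j\<in>modes N. triple i j k * (a i * (z j * ?D k)))"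
        by (simp only: mult_ac)
      finally show "q k * ?D k = - ((wavenum k)\<^sup>2 * (z k * ?D k))
          + (\<Sum>i\<in>modes N. \<Sum>j\<in>modes N. triple i j k * (a i * (z j * ?D k)))" .
    qed
    also have "\<dots> = - (\<Sum>k\<in>modes N. (wavenum k)\<^sup>2 * (z k * ?D k))
        + (\<Sum>k\<in>modes N. \<Sum>i\<in>modes N. \<Sum>j\<in>modes N. triple i j k * (a i * (z j * ?D k)))"
      by (simp only: sum.distrib sum_negf)
    moreover have "(\<Sum>k\<in>modes N. (wavenum k)\<^sup>2 * (?D k * z k + z k * ?D k)) = 2 * (\<Sum>k\<in>modes N. (wavenum k)\<^sup>2 * (z k * ?D k))"
      unfolding sum_distrib_left by (simp add: mult_ac)
    ultimately show ?thesis by simp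
  qed
  have 3: "(\<Sum>k\<in>modes N. \<Sum>i\<in>modes N. \<Sum>j\<in>modes N. triple i j k * (a i * (z j * ?D k))) = ?S (\<lambda>i j k. a i * (z j * ?D k))"
  proof -
    have "(\<Sum>k\<in>modes N. \<Sum>i\<in>modes N. \<Sum>j\<in>modes N. triple i j k * (a i * (z j * ?D k)))
        = (\<Sum>i\<in>modes N. \<Sum>k\<in>modes N. \<Sum>j\<in>modes N. triple i j k * (a i * (z j * ?D k)))"
      by (rule sum.swap)
    also have "\<dots> = ?S (\<lambda>i j k. a i * (z j * ?D k))"
      by (rule sum.cong[OF refl], rule sum.swap)
    finally show ?thesis .
  qed
  have 4: "?S (\<lambda>i j k. a i * (?D j * z k)) = ?S (\<lambda>i j k. a i * (z j * ?D k))"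
  proof (rule sum.cong[OF refl])
    fix i
    have "(\<Sum>j\<in>modes N. \<Sum>k\<in>modes N. triple i j k * (a i * (?D j * z k))) = (\<Sum>k\<in>modes N. \<Sum>j\<in>modes N. triple i j k * (a i * (?D j * z k)))"
      by (rule sum.swap)
    then show "(\<Sum>j\<in>modes N. \<Sum>k\<in>modes N. triple i j k * (a i * (?D j * z k))) = (\<Sum>j\<in>modes N. \<Sum>k\<in>modes N. triple i j k * (a i * (z j * ?D k)))"
      by (simp only: triple_swap(2)[of i] mult.commute)
  qed
  have 5: "(U (trunc N (\<lambda>x. V x * V x)) + W (trunc N (\<lambda>x. V x * V x))) / 2 = ?S (\<lambda>i j k. ?A i * (z j * z k))"
  proof -
    have "(U (trunc N (\<lambda>x. V x * V x)) + W (trunc N (\<lambda>x. V x * V x))) / 2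
        = (\<Sum>i\<in>modes N. (\<Sum>j\<in>modes N. \<Sum>k\<in>modes N. z j * z k * triple j k i) * ?A i)"
      unfolding Av coef_trig_product ..
    also have "\<dots> = ?S (\<lambda>i j k. ?A i * (z j * z k))"
    proof (rule sum.cong[OF refl])
      fix i
      have "triple j k i = triple i j k" for j k by (metis triple_swap)
      then show "(\<Sum>j\<in>modes N. \<Sum>k\<in>modes N. z j * z k * triple j k i) * ?A i = (\<Sum>j\<in>modes N. \<Sum>k\<in>modes N. triple i j k * (?A i * (z j * z k)))"
        unfolding sum_distrib_right by (simp only: mult_ac)
    qed
    finally show ?thesis .
  qed
  have 6: "?S (\<lambda>i j k. ?A i * (z j * z k) + a i * (?D j * z k + z j * ?D k))
      = ?S (\<lambda>i j k. ?A i * (z j * z k)) + (?S (\<lambda>i j k. a i * (?D j * z k)) + ?S (\<lambda>i j k. a i * (z j * ?D k)))"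
    by (simp only: distrib_left sum.distrib)
  show ?thesis
    unfolding energy_rate_def energy_poly_rate_def 1 2 3 5 6 4 by (simp add: algebra_simps)
qed

end

section \<open>Exponential synchronization\<close>

context period
begin

text \<open>
The \<open>L\<^sup>2\<close> norm itself is bounded through the sup norm.
\<close>

lemma controlledI:
  assumes u: "u \<in> Hdot L 2" and "sup_norm L u \<le> S" "Hdot_norm L 1 u \<le> r1" "Hdot_norm L 2 u \<le> r2"
    and B: "S \<le> B" "S * sqrt L \<le> B" "r1 \<le> B" "r2 \<le> B"
  shows "controlled B u"
proof -
  have c: "continuous_on UNIV u" using Hdot_2D(3)[OF u] .
  have S: "\<bar>u x\<bar> \<le> S" if "x \<in> {0..L}" for x using sup_norm_ge[OF c that] assms(2) by linarith
  have "nrm u \<le> S * sqrt L" by (rule nrm_bounded[OF measurable_cont[OF c] S])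
  then show ?thesis
    using assms S unfolding controlled_def Hdot_norms by (meson order_trans)
qed

lemma kdv_solution_Hdot: "kdv_solution L \<gamma> s0 g u u' \<Longrightarrow> s0 \<le> s \<Longrightarrow> u s \<in> Hdot L 2"
  by (simp add: kdv_solution_def bounded_in_Hdot2_def)

lemma kdv_solution_dual:
  assumes "kdv_solution L \<gamma> s0 g u u'"
  shows "AE s in lebesgue_on {s0..}. u' s \<in> Hdot_dual L"
proof -
  obtain B where "AE s in lebesgue_on {s0..}. u' s \<in> Hdot_dual L \<and> Hdot_dual_norm L (u' s) \<le> B"
    using assms unfolding kdv_solution_def has_time_deriv_def Linf_Hdot_dual_def by blast
  then show ?thesis by eventually_elim simp
qed

text \<open>
Each Fourier coefficient is a pairing with a fixed element of \<open>H\<^sup>1\<close>, for which the weak time derivative is an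
honest primitive in time.
\<close>

lemma coef_lipschitz_primitive:
  assumes sol: "kdv_solution L \<gamma> s0 g u u'" and k: "k \<in> modes N"
  shows "lipschitz_primitive s0 T (\<lambda>s. coef (u s) k) (\<lambda>s. u' s (hartley k))"
  unfolding lipschitz_primitive_def
proof (intro conjI allI impI)
  have t: "has_time_deriv L s0 u u'" using sol by (simp add: kdv_solution_def)
  have h: "hartley k \<in> Hdot L 1" using hartley_eq_trig[OF k] trig_Hdot_1 by simp
  have "(\<lambda>s. u' s (hartley k)) \<in> borel_measurable (lebesgue_on {s0..})"
    using t h unfolding has_time_deriv_def Linf_Hdot_dual_def by blast
  then show "(\<lambda>s. u' s (hartley k)) \<in> borel_measurable (lebesgue_on {s0..T})"
    by (rule measurable_restrict_mono) auto
  obtain B where "AE s in lebesgue_on {s0..}. u' s \<in> Hdot_dual L \<and> Hdot_dual_norm L (u' s) \<le> B"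
    using t unfolding has_time_deriv_def Linf_Hdot_dual_def by blast
  then have "AE s in lebesgue_on {s0..T}. u' s \<in> Hdot_dual L \<and> Hdot_dual_norm L (u' s) \<le> B"
    by (rule AE_lebesgue_on_subset) auto
  then have "AE s in lebesgue_on {s0..T}. \<bar>u' s (hartley k)\<bar> \<le> B * nrm (trig N (dcoef (\<lambda>j. if j = k then 1 else 0)))"
  proof eventually_elim
    case (elim s)
    then show ?case
      using dual_bound[of "u' s" N "\<lambda>j. if j = k then 1 else 0"] mult_right_mono[OF conjunct2[OF elim] nrm_nonneg]
      unfolding hartley_eq_trig[OF k] by (meson order_trans)
  qed
  then show "\<exists>M. AE s in lebesgue_on {s0..T}. \<bar>u' s (hartley k)\<bar> \<le> M" by blast
  fix a b assume "s0 \<le> a \<and> a \<le> b \<and> b \<le> T"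
  then show "coef (u b) k - coef (u a) k = (LINT s|lebesgue_on {a..b}. u' s (hartley k))"
    using t h unfolding has_time_deriv_def coef_def by blast
qed

lemma tail_tendsto_0: "tail \<longlonglongrightarrow> 0"
proof -
  have "(\<lambda>N. L / (2 * pi) * inverse (real (Suc N))) \<longlonglongrightarrow> L / (2 * pi) * 0"
    by (intro tendsto_intros LIMSEQ_inverse_real_of_nat)
  moreover have "tail = (\<lambda>N. L / (2 * pi) * inverse (real (Suc N)))"
    by (auto simp: tail_def field_simps)
  ultimately show ?thesis by simp
qed

end

theorem theorem5:
  fixes L \<gamma> R \<rho> \<mu> s0 :: real
    and m :: nat
    and f :: "real \<Rightarrow> real"
    and u w :: "real \<Rightarrow> real \<Rightarrow> real"
    and u' w' :: "real \<Rightarrow> (real \<Rightarrow> real) \<Rightarrow> real"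
    and R1 R2 Rinf R' R1_0 R2_0 C3_0 :: real
  assumes L: "L > 0"
    and \<gamma>: "\<gamma> > 0"
    and f: "f \<in> Hdot L 2"
    and R: "\<And>A v s. is_global_attractor L \<gamma> f A \<Longrightarrow> trajectory_in L \<gamma> f A v \<Longrightarrow>
              Hdot_norm L 2 (v s) \<le> R"
    and \<rho>: "\<rho> = 4 * R"
    and \<mu>: "\<mu> > 0"
    and m: "m > 0"
    and u: "kdv_solution L \<gamma> s0 (\<lambda>_. f) u u'"
    and Pu: "\<And>s. s \<ge> s0 \<Longrightarrow> Hdot_norm L 2 (proj L m (u s)) < \<rho>"
    and w: "kdv_solution L \<gamma> s0 (\<lambda>s x. f x - \<mu> * (proj L m (w s) x - proj L m (u s) x)) w w'"
    and w0: "Hdot_norm L 2 (w s0) < \<rho>"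
    and R1: "\<And>s. s \<ge> s0 \<Longrightarrow> Hdot_norm L 1 (w s) \<le> R1"
    and R2: "\<And>s. s \<ge> s0 \<Longrightarrow> Hdot_norm L 2 (w s) \<le> R2"
    and Rinf: "\<And>s. s \<ge> s0 \<Longrightarrow> sup_norm L (u s) \<le> Rinf"
              "\<And>s. s \<ge> s0 \<Longrightarrow> sup_norm L (w s) \<le> Rinf"
    and R': "AE s in lebesgue_on {s0..}. Hdot_dual_norm L (u' s) \<le> R'"
            "AE s in lebesgue_on {s0..}. Hdot_dual_norm L (w' s) \<le> R'"
    and R1_0: "\<And>s. s \<ge> s0 \<Longrightarrow> Hdot_norm L 1 (u s) \<le> R1_0"
    and R2_0: "\<And>s. s \<ge> s0 \<Longrightarrow> Hdot_norm L 2 (u s) \<le> R2_0"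
    and C3_0: "C3_0 = R1_0 powr (1/2) * R2_0 powr (1/2)"
    and large: "\<mu> * L^2 / (2 * pi^2 * (real m + 1)^2) * R1^2 \<le> \<mu>"
               "\<mu> * L^2 * R2^2 / (4 * pi^2 * (real m + 1)^2) \<le> \<mu> powr (4/3)"
               "C3_0 \<le> \<mu>"
               "C3_0 * L^2 / (4 * pi^2 * (real m + 1)^2) \<le> \<gamma> / (2 * real m)"
               "1 / real m * ((\<gamma> + 2 * \<mu>) * Rinf + 2 * R'^4 * \<gamma> powi (-3)) \<le> \<gamma> / 2"
  shows "((\<lambda>s. L2_norm L (\<lambda>x. w s x - u s x)) \<longlongrightarrow> 0) at_top \<and>
    (\<exists>K. \<forall>\<^sub>F s in at_top. L2_norm L (\<lambda>x. w s x - u s x) \<le> K * exp (- (\<gamma> / 4) * (s - s0)))"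
proof -
  interpret period L by unfold_locales (rule L)
  have H: "u s \<in> Hdot L 2" "w s \<in> Hdot L 2" if "s0 \<le> s" for s
    using kdv_solution_Hdot[OF u that] kdv_solution_Hdot[OF w that] by auto
  \<comment> \<open>One constant above all norms that occur; what matters is that it depends neither on time nor on \<open>N\<close>.\<close>
  define B where "B = \<bar>Rinf\<bar> + \<bar>Rinf * sqrt L\<bar> + \<bar>R1\<bar> + \<bar>R2\<bar> + \<bar>R1_0\<bar> + \<bar>R2_0\<bar>"
  have cu: "controlled B (u s)" if "s0 \<le> s" for s
    by (rule controlledI[OF H(1)[OF that] Rinf(1)[OF that] R1_0[OF that] R2_0[OF that]]) (auto simp: B_def)
  have cw: "controlled B (w s)" if "s0 \<le> s" for s
    by (rule controlledI[OF H(2)[OF that] Rinf(2)[OF that] R1[OF that] R2[OF that]]) (auto simp: B_def)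
  have ub: "\<bar>u s x\<bar> \<le> Rinf" and wb: "\<bar>w s x\<bar> \<le> Rinf" if "s0 \<le> s" "x \<in> {0..L}" for s x
    using sup_norm_ge[OF Hdot_2D(3)[OF H(1)[OF that(1)]] that(2)] Rinf(1)[OF that(1)]
      sup_norm_ge[OF Hdot_2D(3)[OF H(2)[OF that(1)]] that(2)] Rinf(2)[OF that(1)] by linarith+
  have r: "0 \<le> R1_0" "0 \<le> R2_0"
    using R1_0[OF order_refl] R2_0[OF order_refl] nrm_nonneg order_trans unfolding Hdot_norms by blast+
  have C3: "C3_0 = sqrt (R1_0 * R2_0)"
    using r by (simp add: C3_0 powr_half_sqrt real_sqrt_mult)
  have C3_tail: "sqrt (R1_0 * R2_0) * (tail m)\<^sup>2 \<le> \<gamma> / (2 * real m)"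
    using large(4) unfolding C3 by (simp add: tail_def power_divide power_mult_distrib)
  \<comment> \<open>The absolute value of \<open>R'\<close> is a nonnegative bound with the same fourth power.\<close>
  have large': "1 / real m * ((\<gamma> + 2 * \<mu>) * Rinf + 2 * \<bar>R'\<bar>^4 * \<gamma> powi (-3)) \<le> \<gamma> / 2"
    using large(5) by simp
  have Rinf0: "0 \<le> Rinf" using ub[OF order_refl, of 0] L by auto
  have Rm: "1 / real m * Rinf \<le> 1 / 2"
  proof -
    have "\<gamma> * Rinf \<le> (\<gamma> + 2 * \<mu>) * Rinf + 2 * \<bar>R'\<bar>^4 * \<gamma> powi (-3)"
      using \<gamma> \<mu> Rinf0 by (simp add: distrib_right zero_le_power_int)
    then have "1 / real m * (\<gamma> * Rinf) \<le> \<gamma> / 2"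
      using large' m by (meson mult_left_mono order_trans zero_le_divide_1_iff of_nat_0_le_iff)
    then have "\<gamma> * (1 / real m * Rinf) \<le> \<gamma> * (1 / 2)" by (simp add: mult.left_commute)
    then show ?thesis using \<gamma> by (rule mult_left_le_imp_le)
  qed
  let ?M = "8 * B\<^sup>2 + 4 * B^3" and ?C = "residual B \<gamma> \<mu>"
  have pair: "galerkin_pair L B m N (u s) (w s)" if "m \<le> N" "s0 \<le> s" for N s
    by unfold_locales (use that cu cw in auto)
  have B0: "0 \<le> B" by (auto simp: B_def)
  have C0: "0 \<le> ?C" using B0 \<gamma> \<mu> by (simp add: residual_def)
  have sf: "square_integrable f" using Hdot_2D(1)[OF f] square_integrable_L2_per by blast
  have pde: "AE s in lebesgue_on {s0..}. \<forall>\<phi>\<in>Hdot L 1. u' s \<phi> + ip (\<lambda>x. u s x * wd (u s) x) \<phi>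
        + (- ip (wd (wd (u s))) (wd \<phi>)) + \<gamma> * ip (u s) \<phi> = ip f \<phi>"
    "AE s in lebesgue_on {s0..}. \<forall>\<phi>\<in>Hdot L 1. w' s \<phi> + ip (\<lambda>x. w s x * wd (w s) x) \<phi>
        + (- ip (wd (wd (w s))) (wd \<phi>)) + \<gamma> * ip (w s) \<phi>
        = ip (\<lambda>x. f x - \<mu> * (proj L m (w s) x - proj L m (u s) x)) \<phi>"
    using u w by (auto simp: kdv_solution_def)
  have galerkin_decay: "(nrm (trunc N (\<lambda>x. w T x - u T x)))\<^sup>2 / 2
      \<le> exp (- (\<gamma> / 2) * (T - s0)) * ?M + (4 * B^3 + ?C / (\<gamma> / 2)) * tail N"
    if N: "m \<le> N" and T: "s0 \<le> T" for N T
  proof -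
    define a where "a s k = 1/2 * (coef (u s) k + coef (w s) k)" for s k
    define z where "z s k = coef (w s) k - coef (u s) k" for s k
    define a' where "a' s k = 1/2 * (u' s (hartley k) + w' s (hartley k))" for s k
    define z' where "z' s k = w' s (hartley k) - u' s (hartley k)" for s k
    let ?E = "\<lambda>s. energy_poly m N (a s) (z s)" and ?G = "\<lambda>s. energy_poly_rate m N (a s) (z s) (a' s) (z' s)"
    have prim: "lipschitz_primitive s0 T ?E ?G"
    proof (rule energy_poly_primitive)
      fix k assume k: "k \<in> modes N"
      note c = coef_lipschitz_primitive[OF u k] coef_lipschitz_primitive[OF w k]
      show "lipschitz_primitive s0 T (\<lambda>s. a s k) (\<lambda>s. a' s k)"
        unfolding a_def a'_def by (intro lipschitz_primitive_scale lipschitz_primitive_add c)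
      show "lipschitz_primitive s0 T (\<lambda>s. z s k) (\<lambda>s. z' s k)"
        unfolding z_def z'_def by (intro lipschitz_primitive_diff c)
    qed
    have az: "galerkin_pair.a L (u s) (w s) = a s" "galerkin_pair.z L (u s) (w s) = z s" if "s0 \<le> s" for s
      using galerkin_pair.a_def[OF pair[OF N that]] galerkin_pair.z_def[OF pair[OF N that]]
      by (auto simp: a_def z_def)
    have E: "galerkin_pair.energy L m N (u s) (w s) = ?E s" if "s0 \<le> s" for s
      using galerkin_pair.energy_eq_poly[OF pair[OF N that]] by (simp add: az that)
    have ge: "AE s in lebesgue_on {s0..}. s0 \<le> s" by (rule AE_I2) simp
    have "AE s in lebesgue_on {s0..}. ?G s \<le> - (\<gamma> / 2) * ?E s + ?C * tail N"
      using kdv_solution_dual[OF u] kdv_solution_dual[OF w] pde R' ge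
    proof eventually_elim
      case (elim s)
      have s: "s0 \<le> s" using elim by simp
      have g: "galerkin L B m N (u s) (w s) \<gamma> \<mu> f (u' s) (w' s)"
        using elim(3,4) by (intro galerkin.intro pair[OF N s] galerkin_axioms.intro \<mu> sf) auto
      have "\<bar>u' s (trig N c)\<bar> \<le> \<bar>R'\<bar> * nrm (trig N (dcoef c))" "\<bar>w' s (trig N c)\<bar> \<le> \<bar>R'\<bar> * nrm (trig N (dcoef c))" for c
        using dual_bound[OF elim(1), of N c] dual_bound[OF elim(2), of N c] elim(5,6)
          mult_right_mono[of _ "\<bar>R'\<bar>", OF _ nrm_nonneg] by (smt (verit))+
      then have "galerkin.energy_rate L m N (u s) (w s) (u' s) (w' s)
          \<le> - (\<gamma> / 2) * galerkin_pair.energy L m N (u s) (w s) + ?C * tail N"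
        using R1_0[OF s] R2_0[OF s] large(3) C3_tail large' m \<gamma> ub[OF s] wb[OF s] unfolding Hdot_norms C3
        by (intro galerkin.energy_inequality[OF g, where Ri = Rinf and R' = "\<bar>R'\<bar>" and ?R1_0.0 = R1_0 and ?R2_0.0 = R2_0]) auto
      also have "galerkin.energy_rate L m N (u s) (w s) (u' s) (w' s) = ?G s"
        using galerkin.energy_rate_eq_poly[OF g elim(1,2)]
        by (simp add: az s a'_def[abs_def] z'_def[abs_def])
      finally show ?case by (simp only: E[OF s])
    qed
    then have "AE s in lebesgue_on {s0..T}. ?G s \<le> - (\<gamma> / 2) * ?E s + ?C * tail N"
      by (rule AE_lebesgue_on_subset) auto
    then have gr: "?E T \<le> exp (- (\<gamma> / 2) * (T - s0)) * ?E s0 + ?C * tail N / (\<gamma> / 2)"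
      using prim T \<gamma> C0 tail_nonneg by (intro gronwall) auto
    have "?E s0 \<le> ?M"
      using galerkin_pair.energy_bounds(2)[OF pair[OF N order_refl] m ub wb Rm] E[of s0] by simp
    then have t1: "exp (- (\<gamma> / 2) * (T - s0)) * ?E s0 \<le> exp (- (\<gamma> / 2) * (T - s0)) * ?M"
      by (intro mult_left_mono) auto
    have t2: "(nrm (trig N (z T)))\<^sup>2 / 2 - 4 * B^3 * tail N \<le> ?E T"
      using galerkin_pair.energy_bounds(1)[OF pair[OF N T] m ub[OF T] wb[OF T] Rm] E[OF T] az(2)[OF T] by simp
    have t3: "trunc N (\<lambda>x. w T x - u T x) = trig N (z T)"
      using H[OF T] by (intro trig_cong) (simp add: z_def coef_def ip_diff_left hartley_square_integrable square_integrable_L2_per Hdot_2D(1))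
    have t4: "(4 * B^3 + ?C / (\<gamma> / 2)) * tail N = 4 * B^3 * tail N + ?C * tail N / (\<gamma> / 2)"
      by (simp add: distrib_right)
    show ?thesis unfolding t3 t4 using t1 t2 gr by linarith
  qed
  have decay: "nrm (\<lambda>x. w T x - u T x) \<le> sqrt (2 * ?M) * exp (- (\<gamma> / 4) * (T - s0))" if T: "s0 \<le> T" for T
  proof -
    let ?v = "\<lambda>x. w T x - u T x"
    note h = Hdot_2D[OF H(1)[OF T]] Hdot_2D[OF H(2)[OF T]]
    have v: "?v \<in> L2_per L" "mean_zero ?v"
      using h L2_per_diff by (auto simp: mean_zero_def square_integrable_integrable square_integrable_L2_per)
    have "(\<lambda>N. (nrm (trunc N ?v))\<^sup>2 / 2) \<longlonglongrightarrow> (nrm ?v)\<^sup>2 / 2"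
      by (intro tendsto_intros nrm_trunc_tendsto v) simp
    moreover have "(\<lambda>N. exp (- (\<gamma> / 2) * (T - s0)) * ?M + (4 * B^3 + ?C / (\<gamma> / 2)) * tail N)
        \<longlonglongrightarrow> exp (- (\<gamma> / 2) * (T - s0)) * ?M + (4 * B^3 + ?C / (\<gamma> / 2)) * 0"
      by (intro tendsto_intros tail_tendsto_0)
    ultimately have "(nrm ?v)\<^sup>2 / 2 \<le> exp (- (\<gamma> / 2) * (T - s0)) * ?M + (4 * B^3 + ?C / (\<gamma> / 2)) * 0"
      by (rule LIMSEQ_le) (use galerkin_decay T in blast)
    then have "(nrm ?v)\<^sup>2 \<le> 2 * (exp (- (\<gamma> / 2) * (T - s0)) * ?M)" by simp
    also have "\<dots> = 2 * ?M * exp (- (\<gamma> / 2) * (T - s0))" by (simp only: mult_ac)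
    also have "\<dots> = (sqrt (2 * ?M) * exp (- (\<gamma> / 4) * (T - s0)))\<^sup>2"
    proof -
      have "(exp (- (\<gamma> / 4) * (T - s0)))\<^sup>2 = exp (- (\<gamma> / 2) * (T - s0))"
        unfolding power2_eq_square exp_add[symmetric] by (simp add: field_simps)
      then show ?thesis using B0 by (simp add: power_mult_distrib)
    qed
    finally show ?thesis by (rule power2_le_imp_le) (use B0 in simp)
  qed
  have ev: "\<forall>\<^sub>F s in at_top. nrm (\<lambda>x. w s x - u s x) \<le> sqrt (2 * ?M) * exp (- (\<gamma> / 4) * (s - s0))"
    using eventually_ge_at_top[of s0] by eventually_elim (rule decay)
  have "((\<lambda>s. sqrt (2 * ?M) * exp (- (\<gamma> / 4) * (s - s0))) \<longlongrightarrow> 0) at_top"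
    using \<gamma> by real_asymp
  then have "((\<lambda>s. nrm (\<lambda>x. w s x - u s x)) \<longlongrightarrow> 0) at_top"
    by (rule Lim_null_comparison[rotated]) (use ev nrm_nonneg in simp)
  then show ?thesis using ev by blast
qed

end
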